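(* Let $p$ and $q$ be irreducible monic polynomials with degree $2$ over $\mathbb{F}$. Assume that $q=p(t+d)$ for some $d\in\mathbb{F}$, and that the characteristic of $\mathbb{F}$ is not $2$. Set $r:=(t-d)^2-\Delta$, where $\Delta=(\operatorname{tr}p)^2-4p(0)$ is the discriminant of $p$. Let $u$ be an endomorphism of a finite-dimensional vector space $V$ over $\mathbb{F}$. Then, the following conditions are equivalent: (i) $u$ is a d-exceptional $(p,q)$-difference. (ii) The minimal polynomial of $u$ is the product of a power of $t-d$ with a power of $r$. Moreover, the invariant factors of $u$ read $s_1,s_2,\dots,s_{2k-1},s_{2k},\dots$ where, for every positive integer $k$, we have $s_{2k-1}=s_{2k}$ or $s_{2k-1}=r\,s_{2k}$. (iii) In some basis of $V$, the endomorphism $u$ is represented by a block-diagonal matrix in which every diagonal block equals $C(r^{n+\epsilon})\oplus C(r^n)$ for some integer $n\geq 0$ and some $\epsilon\in\{0,1\}$, or $C\bigl((t-d)^n\bigr)\oplus C\bigl((t-d)^n\bigr)$ for some positive integer $n$.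
   Context: $\mathbb{F}$ is a field with algebraic closure $\overline{\mathbb{F}}$. For a monic polynomial $p$ of degree $n\ge 1$, $\operatorname{tr}(p)$ is the opposite of the coefficient of $p$ on $t^{n-1}$, and $\operatorname{Root}(p)$ is its set of roots in $\overline{\mathbb{F}}$. An endomorphism $u$ of $V$ is a $(p,q)$-difference if $u=a-b$ for some endomorphisms $a,b$ of $V$ with $p(a)=0$ and $q(b)=0$. It is d-exceptional with respect to $(p,q)$ if all its eigenvalues in $\overline{\mathbb{F}}$ belong to $\operatorname{Root}(p)-\operatorname{Root}(q)=\{x-y: x\in\operatorname{Root}(p),\,y\in\operatorname{Root}(q)\}$; a d-exceptional $(p,q)$-difference is a $(p,q)$-difference that is d-exceptional with respect to $(p,q)$. $C(r)$ is the companion matrix of the monic polynomial $r$ ($C(1)$ is the $0\times0$ matrix), and $\oplus$ is block-diagonal sum. The invariant factors of $u$ are the monic polynomials $s_1,s_2,\dots$ with $s_{i+1}\mid s_i$ such that $u$ is represented in some basis by $C(s_1)\oplus C(s_2)\oplus\cdots$; the finite list of nonconstant ones is extended to an infinite sequence by $s_i=1$. *)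

theory Defs
  imports
    "HOL-Algebra.Algebraic_Closure_Type"
    "Jordan_Normal_Form.Char_Poly"
begin

text \<open>
  A vector space over the field \<open>'a\<close> is a type \<open>'v\<close> with a scalar multiplication \<open>scale\<close>
  satisfying \<^term>\<open>vector_space\<close>; its endomorphisms are the maps \<open>u :: 'v \<Rightarrow> 'v\<close> with
  \<open>Vector_Spaces.linear scale scale u\<close>.  Matrices and their eigenvalues are those of
  Jordan_Normal_Form, and \<open>'a alg_closure\<close> is the algebraic closure, with embedding \<open>to_ac\<close>.
\<close>

definition poly_trace :: "'a::field poly \<Rightarrow> 'a" where
  "poly_trace p = - Polynomial.coeff p (Polynomial.degree p - 1)"

definition Root :: "'a::field poly \<Rightarrow> 'a alg_closure set" where
  "Root p = {x. poly (map_poly to_ac p) x = 0}"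

definition poly_endo ::
    "('a::field \<Rightarrow> 'v \<Rightarrow> 'v) \<Rightarrow> 'a poly \<Rightarrow> ('v::ab_group_add \<Rightarrow> 'v) \<Rightarrow> 'v \<Rightarrow> 'v" where
  "poly_endo scale f u v =
     (\<Sum>i\<le>Polynomial.degree f. scale (Polynomial.coeff f i) ((u ^^ i) v))"

definition annihilates ::
    "('a::field \<Rightarrow> 'v \<Rightarrow> 'v) \<Rightarrow> 'a poly \<Rightarrow> ('v::ab_group_add \<Rightarrow> 'v) \<Rightarrow> bool" where
  "annihilates scale f u \<longleftrightarrow> (\<forall>v. poly_endo scale f u v = 0)"

text \<open>
  The monic generator of the ideal of polynomials annihilating \<open>u\<close>; on a finite-dimensional
  space it exists and is unique (it is \<open>1\<close> on the zero space).
\<close>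
definition minimal_polynomial ::
    "('a::field \<Rightarrow> 'v \<Rightarrow> 'v) \<Rightarrow> ('v::ab_group_add \<Rightarrow> 'v) \<Rightarrow> 'a poly" where
  "minimal_polynomial scale u =
     (THE m. lead_coeff m = 1 \<and> annihilates scale m u \<and>
             (\<forall>f. annihilates scale f u \<longrightarrow> m dvd f))"

text \<open>
  The list \<open>bs\<close> is the ordered basis; column \<open>j\<close> of \<open>M\<close> holds the coordinates of
  \<open>u (bs ! j)\<close>.
\<close>
definition represented_in_basis ::
    "('a::field \<Rightarrow> 'v \<Rightarrow> 'v) \<Rightarrow> ('v::ab_group_add \<Rightarrow> 'v) \<Rightarrow> 'v list \<Rightarrow> 'a mat \<Rightarrow> bool" where
  "represented_in_basis scale u bs M \<longleftrightarrow>
     distinct bs \<and> \<not> module.dependent scale (set bs) \<and> module.span scale (set bs) = UNIV \<and>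
     M \<in> carrier_mat (length bs) (length bs) \<and>
     (\<forall>j<length bs. u (bs ! j) = (\<Sum>i<length bs. scale (M $$ (i, j)) (bs ! i)))"

definition represented_by ::
    "('a::field \<Rightarrow> 'v \<Rightarrow> 'v) \<Rightarrow> ('v::ab_group_add \<Rightarrow> 'v) \<Rightarrow> 'a mat \<Rightarrow> bool" where
  "represented_by scale u M \<longleftrightarrow> (\<exists>bs. represented_in_basis scale u bs M)"

text \<open>
  The eigenvalues of \<open>u\<close> in the algebraic closure are those of any matrix representing \<open>u\<close>,
  viewed over the closure; they do not depend on the chosen basis.
\<close>
definition eigenvalues_in_closure ::
    "('a::field \<Rightarrow> 'v \<Rightarrow> 'v) \<Rightarrow> ('v::ab_group_add \<Rightarrow> 'v) \<Rightarrow> 'a alg_closure set" where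
  "eigenvalues_in_closure scale u =
     {x. \<exists>M. represented_by scale u M \<and> eigenvalue (map_mat to_ac M) x}"

definition is_difference ::
    "('a::field \<Rightarrow> 'v \<Rightarrow> 'v) \<Rightarrow> 'a poly \<Rightarrow> 'a poly \<Rightarrow> ('v::ab_group_add \<Rightarrow> 'v) \<Rightarrow> bool" where
  "is_difference scale p q u \<longleftrightarrow>
     (\<exists>a b. Vector_Spaces.linear scale scale a \<and> Vector_Spaces.linear scale scale b \<and>
            annihilates scale p a \<and> annihilates scale q b \<and> u = (\<lambda>v. a v - b v))"

definition d_exceptional ::
    "('a::field \<Rightarrow> 'v \<Rightarrow> 'v) \<Rightarrow> 'a poly \<Rightarrow> 'a poly \<Rightarrow> ('v::ab_group_add \<Rightarrow> 'v) \<Rightarrow> bool" where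
  "d_exceptional scale p q u \<longleftrightarrow>
     eigenvalues_in_closure scale u \<subseteq> {x - y |x y. x \<in> Root p \<and> y \<in> Root q}"

text \<open>
  Ones on the subdiagonal, negated coefficients in the last column; the \<open>0 \<times> 0\<close> matrix for
  \<open>r = 1\<close>.
\<close>
definition companion_mat :: "'a::field poly \<Rightarrow> 'a mat" where
  "companion_mat r =
     (let n = Polynomial.degree r in
      mat n n (\<lambda>(i, j). if j = n - 1 then - Polynomial.coeff r i
                        else if i = j + 1 then 1 else 0))"

text \<open>
  The sequence of invariant factors \<open>s 1, s 2, \<dots>\<close> is indexed from 1 (\<open>s 0\<close> is irrelevant)
  and is eventually \<open>1\<close>.
\<close>
definition invariant_factors ::
    "('a::field \<Rightarrow> 'v \<Rightarrow> 'v) \<Rightarrow> ('v::ab_group_add \<Rightarrow> 'v) \<Rightarrow> (nat \<Rightarrow> 'a poly) \<Rightarrow> bool" where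
  "invariant_factors scale u s \<longleftrightarrow>
     (\<forall>i\<ge>1. lead_coeff (s i) = 1 \<and> s (i + 1) dvd s i) \<and>
     (\<exists>N. (\<forall>i>N. s i = 1) \<and>
          represented_by scale u (diag_block_mat (map (\<lambda>i. companion_mat (s i)) [1..<N + 1])))"

end

(* Put w = u - d.  Completing the square, u is a (p,q)-difference iff there is s with s w = - w s and
   s^2 + w^2 = Delta, where Delta is not a square.  These relations are symmetric in s and w.
   On the part of V where w is nilpotent, and on the part where r(w) = - s^2 is nilpotent, the
   nilpotent one of w, s together with the other one (a square root of Delta modulo nilpotents)
   behaves like a nilpotent operator over a division ring, so V is a direct sum of subspaces
   generated by single vectors v.  Such a subspace is F[u] v + F[u] s v, and this sum is direct with
   annihilators (t-d)^m, (t-d)^m respectively r^k, r^l, where k, l are the two halves of m.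
   This gives (i) => (iii).  Sorting the exponents gives (ii); conversely, a pair of generators x, y
   with annihilators f, g, where f = g or f = r g, carries an operator s with s x = y, s y = - r(u) x. *)
theory Submission
  imports Defs
begin

text \<open>The operators s and w are the half sum and the half difference of 2 a - tr p and 2 b -
  tr q, which both have square Delta because translating p keeps its discriminant. Irreducibility of
  p makes Delta a nonsquare, so \<alpha>^2 - \<beta>^2 Delta, the norm of \<alpha> + \<beta> sqrt
  Delta, vanishes only for \<alpha> = \<beta> = 0; division always means multiplying by a conjugate
  \<alpha> - \<beta> x. The obstacle is that u and s do not commute: a decomposition under u alone
  need not respect s. Summands must be stable under both, and moving s past a polynomial in u
  replaces t by 2 d - t. This fixes r and negates t - d, so both primary parts are kept. The two
  kinds of blocks differ by what is nilpotent. Where w is nilpotent, v and s v have the same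
  annihilator. Where s is nilpotent, one factor r uses up two steps of s, so a chain of m steps is
  shared between v and s v. On the way back, (ii) serves through the fact that in each pair f, g of
  invariant factors g divides f and f divides r g.\<close>

section \<open>Polynomials over a field\<close>

text \<open>The combinations of \<open>f\<close> and \<open>g\<close> form an ideal. By division
  with remainder, a nonzero element of least degree divides every element of it, in particular
  \<open>f\<close> and \<open>g\<close>.\<close>

lemma poly_bezout:
  fixes f g :: "'a::field poly"
  obtains a b where "a * f + b * g dvd f" "a * f + b * g dvd g"
proof -
  define I where "I = {a * f + b * g | a b. True}"
  have closed: "y - c * x \<in> I" if xy: "x \<in> I" "y \<in> I" for x y c
  proof -
    obtain a b a' b' where "x = a * f + b * g" "y = a' * f + b' * g"
      using xy unfolding I_def by blast
    then have "y - c * x = (a' - c * a) * f + (b' - c * b) * g" by (simp add: algebra_simps)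
    then show ?thesis unfolding I_def by blast
  qed
  have "f = 1 * f + 0 * g" "g = 0 * f + 1 * g" by auto
  then have fg: "f \<in> I" "g \<in> I" unfolding I_def by blast+
  show ?thesis
  proof (cases "f = 0 \<and> g = 0")
    case True
    then show ?thesis using that by auto
  next
    case False
    then have ex: "\<exists>h. h \<in> I \<and> h \<noteq> 0" using fg by blast
    obtain h where h: "h \<in> I" "h \<noteq> 0"
      and min: "\<And>k. k \<in> I \<Longrightarrow> k \<noteq> 0 \<Longrightarrow> Polynomial.degree h \<le> Polynomial.degree k"
      using ex_has_least_nat[of "\<lambda>h. h \<in> I \<and> h \<noteq> 0" _ Polynomial.degree] ex by metis
    have dvd: "h dvd k" if "k \<in> I" for k
    proof (rule ccontr)
      assume "\<not> h dvd k"
      then have nz: "k mod h \<noteq> 0" by (simp add: mod_eq_0_iff_dvd)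
      have "k mod h \<in> I"
        using closed[OF h(1) that, of "k div h"] by (simp add: minus_div_mult_eq_mod)
      with min nz have "Polynomial.degree h \<le> Polynomial.degree (k mod h)" by blast
      with degree_mod_less[OF h(2), of k] nz show False by simp
    qed
    obtain a b where "h = a * f + b * g" using h(1) by (auto simp: I_def)
    with dvd[OF fg(1)] dvd[OF fg(2)] that show ?thesis by blast
  qed
qed

text \<open>The common divisor from \<open>poly_bezout\<close> divides the irreducible
  \<open>f\<close>, so it is a unit or an associate of \<open>f\<close>; an associate of
  \<open>f\<close> cannot divide \<open>g\<close>.\<close>

lemma irreducible_bezout:
  fixes f g :: "'a::field poly"
  assumes "Factorial_Ring.irreducible f" "\<not> f dvd g"
  obtains a b where "a * f + b * g = 1"
proof -
  obtain a b where ab: "a * f + b * g dvd f" "a * f + b * g dvd g" by (rule poly_bezout)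
  from ab(1) obtain k where k: "f = (a * f + b * g) * k" by (rule dvdE)
  have "\<not> is_unit k"
  proof
    assume "is_unit k"
    then have "f dvd a * f + b * g" by (metis k dvd_refl mult_unit_dvd_iff)
    with ab(2) assms(2) show False using dvd_trans by blast
  qed
  then have "is_unit (a * f + b * g)" using assms(1) k by (auto dest: irreducibleD)
  then obtain c where "1 = (a * f + b * g) * c" by (rule dvdE)
  then have "(c * a) * f + (c * b) * g = 1" by (simp add: algebra_simps)
  then show ?thesis by (rule that)
qed

lemma exists_irreducible_factor:
  fixes f :: "'a::field poly"
  assumes "Polynomial.degree f \<noteq> 0"
  shows "\<exists>g. Factorial_Ring.irreducible g \<and> g dvd f"
  using assms
proof (induction "Polynomial.degree f" arbitrary: f rule: less_induct)
  case less
  show ?case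
  proof (cases "Factorial_Ring.irreducible f")
    case True
    then show ?thesis by (intro exI[of _ f]) simp
  next
    case False
    have "f \<noteq> 0" "\<not> is_unit f" using less.prems by (auto simp: is_unit_iff_degree)
    with False obtain a b where ab: "f = a * b" "\<not> is_unit a" "\<not> is_unit b"
      by (auto simp: irreducible_def)
    with \<open>f \<noteq> 0\<close> have nz: "a \<noteq> 0" "b \<noteq> 0" by auto
    then have "Polynomial.degree f = Polynomial.degree a + Polynomial.degree b" "Polynomial.degree a \<noteq> 0" "Polynomial.degree b \<noteq> 0"
      using ab by (auto simp: degree_mult_eq is_unit_iff_degree)
    then show ?thesis using less.hyps[of a] ab(1) dvd_mult2 by force
  qed
qed

text \<open>Coprimality is kept as a Bezout identity because this identity, acting on vectors, gives
  the projections in \<open>exists_good_blocks\<close> and the generators in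
  \<open>splits_merge\<close>.\<close>

definition comaximal :: "'a::comm_ring_1 \<Rightarrow> 'a \<Rightarrow> bool" where
  "comaximal f g \<longleftrightarrow> (\<exists>a b. a * f + b * g = 1)"

lemma comaximal_sym: "comaximal f g \<Longrightarrow> comaximal g f"
  unfolding comaximal_def by (metis add.commute)

lemma comaximal_1: "comaximal f 1" "comaximal 1 f"
proof -
  have "0 * f + 1 * 1 = 1" by simp
  then show "comaximal f 1" unfolding comaximal_def by blast
  then show "comaximal 1 f" by (rule comaximal_sym)
qed

lemma comaximal_mult:
  assumes "comaximal f g" "comaximal f h"
  shows "comaximal f (g * h)"
proof -
  obtain a b a' b' where 1: "a * f + b * g = 1" "a' * f + b' * h = 1"
    using assms by (auto simp: comaximal_def)
  have "(a + b * g * a') * f + (b * b') * (g * h) = a * f + b * g * (a' * f + b' * h)"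
    by (simp add: algebra_simps)
  also have "\<dots> = 1" using 1 by simp
  finally show ?thesis unfolding comaximal_def by blast
qed

lemma comaximal_power_right: "comaximal f g \<Longrightarrow> comaximal f (g ^ n)"
  by (induction n) (auto simp: comaximal_1 comaximal_mult)

lemma comaximal_power: "comaximal f g \<Longrightarrow> comaximal (f ^ m) (g ^ n)"
  by (rule comaximal_power_right[OF comaximal_sym[OF comaximal_power_right[OF comaximal_sym]]])

text \<open>The difference of \<open>l ^ 2\<close> and \<open>l ^ 2 - [:c:]\<close> is the nonzero
  constant \<open>c\<close>. For \<open>l = t - d\<close> and \<open>c = \<Delta>\<close> this
  separates the two primary parts.\<close>

lemma comaximal_square_diff:
  fixes l :: "'a::field poly"
  assumes "c \<noteq> 0"
  shows "comaximal l (l ^ 2 - [:c:])"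
proof -
  have "[:1 / c:] * l * l + [:- 1 / c:] * (l ^ 2 - [:c:]) = 1"
    using assms by (simp add: power2_eq_square algebra_simps one_pCons)
  then show ?thesis unfolding comaximal_def by blast
qed

lemma comaximal_dvd_mult:
  assumes "comaximal f g" "f dvd h" "g dvd h"
  shows "f * g dvd h"
proof -
  obtain a b where 1: "a * f + b * g = 1" using assms(1) by (auto simp: comaximal_def)
  have "h = (a * f + b * g) * h" using 1 by simp
  also have "\<dots> = a * (f * h) + b * (h * g)" by (simp add: algebra_simps)
  finally have eq: "h = a * (f * h) + b * (h * g)" .
  have "f * g dvd f * h" "f * g dvd h * g" using assms by (auto intro: mult_dvd_mono)
  then have "f * g dvd a * (f * h) + b * (h * g)" by (simp add: dvd_add dvd_mult)
  then show ?thesis using eq by simp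
qed

text \<open>Irreducible polynomials over a field are prime, so each irreducible factor of
  \<open>l ^ a * q ^ b\<close> can be cancelled either from \<open>f\<close> or from its cofactor.
  This later shows that an invariant factor is associated to its reflection.\<close>

lemma dvd_power_mult_power:
  fixes f l q :: "'a::field poly"
  assumes l: "Factorial_Ring.irreducible l" and q: "Factorial_Ring.irreducible q"
    and "f dvd l ^ a * q ^ b"
  obtains c i j where "is_unit c" "f = c * l ^ i * q ^ j"
proof -
  have "\<exists>c i j. is_unit c \<and> f = c * l ^ i * q ^ j"
    using assms(3)
  proof (induction "a + b" arbitrary: a b f rule: less_induct)
    case less
    obtain h where h: "l ^ a * q ^ b = f * h" using less.prems by (rule dvdE)
    have step: "\<exists>c i j. is_unit c \<and> f = c * l ^ i * q ^ j"
      if \<pi>: "Factorial_Ring.irreducible \<pi>" "\<pi> = l \<or> \<pi> = q" and eq: "l ^ a * q ^ b = \<pi> * (l ^ a' * q ^ b')"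
        and lt: "a' + b' < a + b" for \<pi> a' b'
    proof -
      have nz: "\<pi> \<noteq> 0" using \<pi>(1) by auto
      have "\<pi> dvd f * h" unfolding h[symmetric] eq by simp
      then consider "\<pi> dvd f" | "\<pi> dvd h" using prime_elem_dvd_mult_iff[OF field_poly_irreducible_imp_prime[OF \<pi>(1)]] by blast
      then show ?thesis
      proof cases
        case 1
        then obtain f' where f': "f = \<pi> * f'" by (rule dvdE)
        have "\<pi> * (l ^ a' * q ^ b') = \<pi> * (f' * h)" using eq h f' by (metis mult.assoc)
        then have "l ^ a' * q ^ b' = f' * h" using nz mult_left_cancel by blast
        then have "f' dvd l ^ a' * q ^ b'" by simp
        then obtain c i j where *: "is_unit c" "f' = c * l ^ i * q ^ j" using less.hyps[OF lt] by blast
        from \<pi>(2) show ?thesis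
        proof
          assume "\<pi> = l"
          then have "f = c * l ^ Suc i * q ^ j" using f' * by simp
          then show ?thesis using * by blast
        next
          assume "\<pi> = q"
          then have "f = c * l ^ i * q ^ Suc j" using f' * by simp
          then show ?thesis using * by blast
        qed
      next
        case 2
        then obtain h' where h': "h = \<pi> * h'" by (rule dvdE)
        have "\<pi> * (l ^ a' * q ^ b') = \<pi> * (f * h')" using eq h h' by (metis mult.left_commute)
        then have "l ^ a' * q ^ b' = f * h'" using nz mult_left_cancel by blast
        then have "f dvd l ^ a' * q ^ b'" by simp
        then show ?thesis using less.hyps[OF lt] by blast
      qed
    qed
    consider a' where "a = Suc a'" | b' where "a = 0" "b = Suc b'" | "a = 0" "b = 0"
      by (metis not0_implies_Suc)
    then show ?case
    proof cases
      case 1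
      then show ?thesis using step[OF l, of a' b] by (simp add: mult.assoc)
    next
      case 2
      then show ?thesis using step[OF q, of 0 b'] by simp
    next
      case 3
      then have "is_unit f" "f = f * l ^ 0 * q ^ 0" using less.prems by auto
      then show ?thesis by blast
    qed
  qed
  then show ?thesis using that by blast
qed

section \<open>Polynomials acting on a vector space\<close>

text \<open>The space is the whole type and \<open>u\<close> stays fixed; invariant subspaces are
  sets, so that restrictions of \<open>u\<close> do not need types of their own.\<close>

locale endomorphism = vector_space scale
  for scale :: "'a::field \<Rightarrow> 'v::ab_group_add \<Rightarrow> 'v" +
  fixes u :: "'v \<Rightarrow> 'v"
  assumes linear_u: "Vector_Spaces.linear scale scale u"
begin

lemma linear_add: "Vector_Spaces.linear scale scale f \<Longrightarrow> f (x + y) = f x + f y"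
  and linear_scale: "Vector_Spaces.linear scale scale f \<Longrightarrow> f (scale c x) = scale c (f x)"
  by (simp_all add: Vector_Spaces.linear_def module_hom_def module_hom_axioms_def)

lemma linearI:
  assumes "\<And>x y. f (x + y) = f x + f y" "\<And>c x. f (scale c x) = scale c (f x)"
  shows "Vector_Spaces.linear scale scale f"
  using assms vector_space_axioms module_axioms
  by (simp add: Vector_Spaces.linear_def module_hom_def module_hom_axioms_def)

lemma linear_zero: "Vector_Spaces.linear scale scale f \<Longrightarrow> f 0 = 0"
  using linear_scale[of f 0 0] by simp

lemma linear_minus: "Vector_Spaces.linear scale scale f \<Longrightarrow> f (- x) = - f x"
  using linear_scale[of f "- 1" x] by simp

lemma linear_diff: "Vector_Spaces.linear scale scale f \<Longrightarrow> f (x - y) = f x - f y"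
  using linear_add[of f x "- y"] linear_minus[of f y] by simp

lemma linear_sum: "Vector_Spaces.linear scale scale f \<Longrightarrow> f (\<Sum>i\<in>I. g i) = (\<Sum>i\<in>I. f (g i))"
  by (induction I rule: infinite_finite_induct) (auto simp: linear_zero linear_add)

lemmas u_simps = linear_add[OF linear_u] linear_scale[OF linear_u] linear_zero[OF linear_u]
  linear_minus[OF linear_u] linear_diff[OF linear_u]

abbreviation act :: "'a poly \<Rightarrow> 'v \<Rightarrow> 'v" where
  "act f v \<equiv> poly_endo scale f u v"

lemma act_sum:
  assumes "Polynomial.degree f \<le> n"
  shows "act f v = (\<Sum>i\<le>n. scale (Polynomial.coeff f i) ((u ^^ i) v))"
proof -
  have "(\<Sum>i\<le>n. scale (Polynomial.coeff f i) ((u ^^ i) v)) =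
      (\<Sum>i\<le>Polynomial.degree f. scale (Polynomial.coeff f i) ((u ^^ i) v))"
    using assms by (intro sum.mono_neutral_right) (auto simp: coeff_eq_0)
  then show ?thesis by (simp add: poly_endo_def)
qed

lemma act_0 [simp]: "act 0 v = 0"
  by (simp add: poly_endo_def)

text \<open>Horner's rule. It makes the laws of the polynomial action provable by induction on the
  coefficients.\<close>

lemma act_pCons [simp]: "act (pCons a f) v = scale a v + u (act f v)"
proof -
  have "act (pCons a f) v =
      (\<Sum>i\<le>Suc (Polynomial.degree f). scale (Polynomial.coeff (pCons a f) i) ((u ^^ i) v))"
    by (rule act_sum) (simp add: degree_pCons_le)
  also have "\<dots> = scale a v +
      (\<Sum>i\<le>Polynomial.degree f. scale (Polynomial.coeff f i) (u ((u ^^ i) v)))"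
    by (subst sum.atMost_Suc_shift) simp
  also have "(\<Sum>i\<le>Polynomial.degree f. scale (Polynomial.coeff f i) (u ((u ^^ i) v))) = u (act f v)"
    by (simp add: poly_endo_def linear_sum[OF linear_u] u_simps)
  finally show ?thesis .
qed

lemma act_1 [simp]: "act 1 v = v"
  by (simp add: one_pCons u_simps)

lemma act_add: "act (f + g) v = act f v + act g v"
proof (induction f g rule: poly_induct2)
  case (pCons a p b q)
  then show ?case by (simp add: u_simps scale_left_distrib)
qed simp

lemma act_smult: "act (Polynomial.smult c f) v = scale c (act f v)"
  by (induction f) (simp_all add: u_simps scale_right_distrib)

lemma act_uminus: "act (- f) v = - act f v"
  using act_smult[of "- 1" f v] by simp

lemma act_diff: "act (f - g) v = act f v - act g v"
  using act_add[of f "- g" v] by (simp add: act_uminus)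

lemma act_mult: "act (f * g) v = act f (act g v)"
  by (induction f) (simp_all add: u_simps act_add act_smult)

lemma act_commute: "act f (act g v) = act g (act f v)"
  by (metis act_mult mult.commute)

lemma linear_act: "Vector_Spaces.linear scale scale (act f)"
proof (rule linearI)
  show "act f (x + y) = act f x + act f y" for x y
    by (induction f) (simp_all add: u_simps scale_right_distrib algebra_simps)
  show "act f (scale c x) = scale c (act f x)" for c x
    by (induction f) (simp_all add: u_simps scale_right_distrib mult.commute)
qed

lemmas act_simps = linear_add[OF linear_act] linear_scale[OF linear_act] linear_zero[OF linear_act]
  linear_minus[OF linear_act] linear_diff[OF linear_act]

lemma act_u: "act f (u v) = u (act f v)"
  using act_commute[of f "[:0, 1:]" v] by (simp add: u_simps)

lemma act_mem:
  assumes "subspace W" "\<And>x. x \<in> W \<Longrightarrow> u x \<in> W" "v \<in> W"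
  shows "act f v \<in> W"
  by (induction f) (auto intro!: subspace_add[OF assms(1)] subspace_scale[OF assms(1)]
      assms(2,3) simp: subspace_0[OF assms(1)])

lemma act_dvd: "f dvd g \<Longrightarrow> act f v = 0 \<Longrightarrow> act g v = 0"
  by (metis act_mult dvdE mult.commute act_simps(3))

lemma act_eigenvector:
  assumes "u y = scale c y"
  shows "act f y = scale (poly f c) y"
  by (induction f) (simp_all add: u_simps assms scale_left_distrib)

section \<open>Cyclic subspaces, annihilators of single vectors and internal direct sums\<close>

definition cyclic :: "'v \<Rightarrow> 'v set" where
  "cyclic v = range (\<lambda>f. act f v)"

lemma cyclicI: "act f v \<in> cyclic v"
  by (simp add: cyclic_def)

lemma cyclicE: "x \<in> cyclic v \<Longrightarrow> (\<And>f. x = act f v \<Longrightarrow> P) \<Longrightarrow> P"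
  by (auto simp: cyclic_def)

lemma subspace_cyclic: "subspace (cyclic v)"
proof (rule subspaceI)
  show "0 \<in> cyclic v" using cyclicI[of 0 v] by simp
  show "x + y \<in> cyclic v" if "x \<in> cyclic v" "y \<in> cyclic v" for x y
    using that by (metis act_add cyclicE cyclicI)
  show "scale c x \<in> cyclic v" if "x \<in> cyclic v" for x c
    using that by (metis act_smult cyclicE cyclicI)
qed

text \<open>The ideal of polynomials killing \<open>v\<close> is generated by \<open>f\<close>,
  which is thereby fixed up to a unit; \<open>f = 1\<close> describes the zero vector.\<close>

definition has_annihilator :: "'a poly \<Rightarrow> 'v \<Rightarrow> bool" where
  "has_annihilator f v \<longleftrightarrow> (\<forall>g. act g v = 0 \<longleftrightarrow> f dvd g)"

lemma has_annihilatorI: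
  "act f v = 0 \<Longrightarrow> (\<And>g. act g v = 0 \<Longrightarrow> f dvd g) \<Longrightarrow> has_annihilator f v"
  unfolding has_annihilator_def using act_dvd by blast

definition direct_sum :: "'v set \<Rightarrow> 'v set \<Rightarrow> 'v set \<Rightarrow> bool" where
  "direct_sum A B W \<longleftrightarrow> subspace A \<and> subspace B \<and> A \<inter> B = {0} \<and> W = {x + y | x y. x \<in> A \<and> y \<in> B}"

lemma direct_sum_subspace: "direct_sum A B W \<Longrightarrow> subspace W"
  unfolding direct_sum_def using subspace_sums by blast

lemma direct_sum_commute: "direct_sum A B W \<Longrightarrow> direct_sum B A W"
  unfolding direct_sum_def by (auto simp: Int_commute) (metis add.commute)+

lemma direct_sum_unique:
  assumes "direct_sum A B W" "x \<in> A" "x' \<in> A" "y \<in> B" "y' \<in> B" "x + y = x' + y'"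
  shows "x = x'" "y = y'"
proof -
  have "x - x' = y' - y" using assms(6) by (simp add: algebra_simps)
  moreover have "x - x' \<in> A" "y' - y \<in> B" using assms by (auto simp: direct_sum_def intro: subspace_diff)
  ultimately have "x - x' \<in> A \<inter> B" by simp
  then have "x - x' = 0" using assms(1) unfolding direct_sum_def by blast
  then show "x = x'" by simp
  then show "y = y'" using assms(6) by simp
qed

text \<open>Together with commutativity this is the tool by which cyclic summands are moved,
  exchanged and merged in the later decompositions.\<close>

lemma direct_sum_assoc:
  assumes "direct_sum A B C" "direct_sum C D W"
  shows "\<exists>E. direct_sum B D E \<and> direct_sum A E W"
proof -
  have sub: "subspace A" "subspace B" "subspace C" "subspace D"
    using assms by (auto simp: direct_sum_def)
  define E where "E = {x + y | x y. x \<in> B \<and> y \<in> D}"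
  have BC: "B \<subseteq> C" "A \<subseteq> C" using assms(1) sub unfolding direct_sum_def
    by (auto, metis add_0 subspace_0, metis add.right_neutral subspace_0)
  have "B \<inter> D = {0}" using BC assms(2) sub by (auto simp: direct_sum_def subspace_0)
  then have BD: "direct_sum B D E" using sub by (auto simp: direct_sum_def E_def)
  have AE: "A \<inter> E = {0}"
  proof
    show "{0} \<subseteq> A \<inter> E" using sub direct_sum_subspace[OF BD] by (auto simp: subspace_0)
    show "A \<inter> E \<subseteq> {0}"
    proof
      fix x assume "x \<in> A \<inter> E"
      then obtain b y where *: "x \<in> A" "b \<in> B" "y \<in> D" "x = b + y" by (auto simp: E_def)
      \<comment> \<open>The difference \<open>x - b\<close> equals \<open>y\<close>, so it lies in
        both \<open>C\<close> and \<open>D\<close>.\<close>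
      then have "x - b \<in> C" using BC sub by (intro subspace_diff) auto
      then have "y \<in> C \<inter> D" using * by simp
      then have "y = 0" using assms(2) by (auto simp: direct_sum_def)
      then have "x \<in> A \<inter> B" using * by simp
      then show "x \<in> {0}" using assms(1) unfolding direct_sum_def by blast
    qed
  qed
  have "W = {x + y | x y. x \<in> A \<and> y \<in> E}"
  proof -
    have "W = {(x + y) + z | x y z. x \<in> A \<and> y \<in> B \<and> z \<in> D}"
      using assms unfolding direct_sum_def by blast
    also have "\<dots> = {x + y | x y. x \<in> A \<and> y \<in> E}"
      unfolding E_def by (auto simp: add.assoc)
    finally show ?thesis .
  qed
  then show ?thesis using BD AE sub direct_sum_subspace[OF BD] by (auto simp: direct_sum_def)
qed

lemma direct_sum_zero: "subspace W \<Longrightarrow> direct_sum {0} W W" "subspace W \<Longrightarrow> direct_sum W {0} W"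
  by (auto simp: direct_sum_def subspace_0 subspace_single_0)

end

section \<open>Matrix representations on invariant subspaces\<close>

context endomorphism
begin

text \<open>Coordinates are functions on \<open>nat\<close> read below \<open>length bs\<close>,
  which lets them be glued and shifted when lists are appended.\<close>

definition lin_comb :: "'v list \<Rightarrow> (nat \<Rightarrow> 'a) \<Rightarrow> 'v" where
  "lin_comb bs c = (\<Sum>i<length bs. scale (c i) (bs ! i))"

text \<open>Independence of a list rather than of its set: a repeated entry already gives a
  nontrivial relation, so distinctness is included.\<close>

definition independent_list :: "'v list \<Rightarrow> bool" where
  "independent_list bs \<longleftrightarrow> (\<forall>c. lin_comb bs c = 0 \<longrightarrow> (\<forall>i<length bs. c i = 0))"

text \<open>The localized form of \<open>represented_in_basis\<close>: with \<open>W\<close> in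
  place of the whole space, each diagonal block can be read on its own invariant subspace.\<close>

definition represents :: "'v set \<Rightarrow> 'v list \<Rightarrow> 'a mat \<Rightarrow> bool" where
  "represents W bs M \<longleftrightarrow> independent_list bs \<and> W = range (lin_comb bs) \<and>
     M \<in> carrier_mat (length bs) (length bs) \<and>
     (\<forall>j<length bs. u (bs ! j) = lin_comb bs (\<lambda>i. M $$ (i, j)))"

lemma lin_comb_cong: "(\<And>i. i < length bs \<Longrightarrow> c i = c' i) \<Longrightarrow> lin_comb bs c = lin_comb bs c'"
  by (simp add: lin_comb_def)

lemma lin_comb_add: "lin_comb bs (\<lambda>i. c i + c' i) = lin_comb bs c + lin_comb bs c'"
  by (simp add: lin_comb_def scale_left_distrib sum.distrib)

lemma lin_comb_scale: "lin_comb bs (\<lambda>i. k * c i) = scale k (lin_comb bs c)"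
  by (simp add: lin_comb_def scale_sum_right)

lemma lin_comb_zero [simp]: "lin_comb bs (\<lambda>_. 0) = 0"
  by (simp add: lin_comb_def)

lemma lin_comb_diff: "lin_comb bs (\<lambda>i. c i - c' i) = lin_comb bs c - lin_comb bs c'"
  by (simp add: lin_comb_def scale_left_diff_distrib sum_subtractf)

lemma lin_comb_append:
  "lin_comb (xs @ ys) c = lin_comb xs c + lin_comb ys (\<lambda>i. c (i + length xs))"
proof -
  have "lin_comb (xs @ ys) c =
      (\<Sum>i<length xs. scale (c i) ((xs @ ys) ! i)) +
      (\<Sum>i<length ys. scale (c (length xs + i)) ((xs @ ys) ! (length xs + i)))"
    using sum.atLeastLessThan_concat[of 0 "length xs" "length xs + length ys"
        "\<lambda>i. scale (c i) ((xs @ ys) ! i)", symmetric]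
      sum.shift_bounds_nat_ivl[of "\<lambda>i. scale (c i) ((xs @ ys) ! i)" 0 "length xs" "length ys"]
    by (simp add: lin_comb_def lessThan_atLeast0 add.commute)
  then show ?thesis by (simp add: lin_comb_def nth_append add.commute)
qed

lemma independent_list_eqD:
  assumes "independent_list bs" "lin_comb bs c = lin_comb bs c'" "i < length bs"
  shows "c i = c' i"
proof -
  have "lin_comb bs (\<lambda>i. c i - c' i) = 0" using assms(2) by (simp add: lin_comb_diff)
  then have "c i - c' i = 0" using assms(1,3) unfolding independent_list_def by blast
  then show ?thesis by simp
qed

lemma lin_comb_nth:
  assumes "distinct bs"
  shows "lin_comb bs (\<lambda>i. r (bs ! i)) = (\<Sum>v\<in>set bs. scale (r v) v)"
proof -
  have "set bs = (!) bs ` {..<length bs}" by (auto simp: set_conv_nth)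
  moreover have "inj_on ((!) bs) {..<length bs}" using assms by (auto simp: inj_on_nth)
  ultimately show ?thesis by (simp add: lin_comb_def sum.reindex)
qed

lemma independent_list_iff:
  "independent_list bs \<longleftrightarrow> distinct bs \<and> \<not> dependent (set bs)"
proof
  assume ind: "independent_list bs"
  have dist: "distinct bs"
  proof (rule ccontr)
    assume "\<not> distinct bs"
    then obtain i j where ij: "i < length bs" "j < length bs" "i \<noteq> j" "bs ! i = bs ! j"
      by (auto simp: distinct_conv_nth)
    \<comment> \<open>Two equal entries would give one vector two different coordinate functions,
      the indicators of the two indices.\<close>
    have single: "lin_comb bs (\<lambda>k. if k = l then 1 else 0) = bs ! l" if "l < length bs" for l
    proof -
      have "lin_comb bs (\<lambda>k. if k = l then 1 else 0) = (\<Sum>k<length bs. if k = l then bs ! l else 0)"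
        unfolding lin_comb_def by (intro sum.cong) auto
      then show ?thesis using that by simp
    qed
    have "(if i = i then 1 else 0 :: 'a) = (if i = j then 1 else 0)"
      by (rule independent_list_eqD[OF ind _ ij(1)]) (simp add: single ij)
    then show False using ij by simp
  qed
  moreover have "\<not> dependent (set bs)"
  proof
    assume "dependent (set bs)"
    then obtain r v where r: "(\<Sum>v\<in>set bs. scale (r v) v) = 0" "v \<in> set bs" "r v \<noteq> 0"
      by (auto simp: dependent_finite)
    then obtain i where "i < length bs" "v = bs ! i" by (auto simp: in_set_conv_nth)
    moreover have "lin_comb bs (\<lambda>i. r (bs ! i)) = 0" using r dist by (simp add: lin_comb_nth)
    then have "\<forall>i<length bs. r (bs ! i) = 0" using ind unfolding independent_list_def by blast
    ultimately show False using r(3) by simp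
  qed
  ultimately show "distinct bs \<and> \<not> dependent (set bs)" by blast
next
  assume *: "distinct bs \<and> \<not> dependent (set bs)"
  show "independent_list bs" unfolding independent_list_def
  proof (intro allI impI)
    fix c i assume c: "lin_comb bs c = 0" and i: "i < length bs"
    \<comment> \<open>The coordinates are carried from the indices to the vectors; distinctness
      makes this well defined.\<close>
    define r where "r v = c (the_inv_into {..<length bs} ((!) bs) v)" for v
    have inj: "inj_on ((!) bs) {..<length bs}" using * by (auto simp: inj_on_nth)
    have r: "r (bs ! j) = c j" if "j < length bs" for j
      using that by (simp add: r_def the_inv_into_f_f[OF inj])
    have "lin_comb bs (\<lambda>i. r (bs ! i)) = 0" using c lin_comb_cong[of bs "\<lambda>i. r (bs ! i)" c] r by simp
    then have "(\<Sum>v\<in>set bs. scale (r v) v) = 0" using * by (simp add: lin_comb_nth)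
    then have "\<forall>v\<in>set bs. r v = 0" using * dependent_finite[of "set bs"] by blast
    then have "r (bs ! i) = 0" using i by simp
    then show "c i = 0" using r[OF i] by simp
  qed
qed

lemma subspace_range_lin_comb: "subspace (range (lin_comb bs))"
proof (rule subspaceI)
  show "0 \<in> range (lin_comb bs)" by (metis lin_comb_zero rangeI)
  show "x + y \<in> range (lin_comb bs)" if "x \<in> range (lin_comb bs)" "y \<in> range (lin_comb bs)" for x y
    using that by (metis (mono_tags) lin_comb_add rangeE rangeI)
  show "scale c x \<in> range (lin_comb bs)" if "x \<in> range (lin_comb bs)" for c x
    using that by (metis (mono_tags) lin_comb_scale rangeE rangeI)
qed

lemma span_set_list:
  assumes "distinct bs"
  shows "span (set bs) = range (lin_comb bs)"
proof
  show "span (set bs) \<subseteq> range (lin_comb bs)"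
  proof
    fix x assume "x \<in> span (set bs)"
    then obtain r where "x = (\<Sum>v\<in>set bs. scale (r v) v)" by (auto simp: span_finite)
    then have "x = lin_comb bs (\<lambda>i. r (bs ! i))" using assms by (simp add: lin_comb_nth)
    then show "x \<in> range (lin_comb bs)" by simp
  qed
  show "range (lin_comb bs) \<subseteq> span (set bs)"
    by (auto simp: lin_comb_def intro!: span_sum span_scale span_base[OF nth_mem])
qed

lemma represented_in_basis_iff: "represented_in_basis scale u bs M \<longleftrightarrow> represents UNIV bs M"
  unfolding represented_in_basis_def represents_def independent_list_iff
  using span_set_list[of bs] by (auto simp: lin_comb_def)

definition represented_on :: "'v set \<Rightarrow> 'a mat \<Rightarrow> bool" where
  "represented_on W M \<longleftrightarrow> (\<exists>bs. represents W bs M)"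

lemma represented_by_iff: "represented_by scale u M \<longleftrightarrow> represented_on UNIV M"
  by (simp add: represented_by_def represented_on_def represented_in_basis_iff)

text \<open>A relation on \<open>xs @ ys\<close> is an equality between a combination of
  \<open>xs\<close> and one of \<open>ys\<close>, so beyond the two separate independences it
  concerns just the intersection of the spans.\<close>

lemma independent_append_iff:
  "independent_list (xs @ ys) \<longleftrightarrow> independent_list xs \<and> independent_list ys \<and>
     range (lin_comb xs) \<inter> range (lin_comb ys) = {0}"
proof
  assume ind: "independent_list (xs @ ys)"
  have glue: "(\<forall>i<length xs. c i = 0) \<and> (\<forall>i<length ys. c' i = 0)"
    if "lin_comb xs c + lin_comb ys c' = 0" for c c'
  proof -
    define e where "e i = (if i < length xs then c i else c' (i - length xs))" for i
    have "lin_comb (xs @ ys) e = lin_comb xs e + lin_comb ys (\<lambda>i. e (i + length xs))"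
      by (rule lin_comb_append)
    also have "\<dots> = lin_comb xs c + lin_comb ys c'"
      by (intro arg_cong2[where f = "(+)"] lin_comb_cong) (auto simp: e_def)
    finally have 0: "\<forall>i<length xs + length ys. e i = 0"
      using ind that by (simp add: independent_list_def)
    have "e i = c i" if "i < length xs" for i using that by (simp add: e_def)
    moreover have "e (i + length xs) = c' i" for i by (simp add: e_def)
    ultimately show ?thesis using 0
      by (metis add.commute add_less_cancel_left trans_less_add1)
  qed
  have "independent_list xs" unfolding independent_list_def
    using glue[where c' = "\<lambda>_. 0"] by simp
  moreover have "independent_list ys" unfolding independent_list_def
    using glue[where c = "\<lambda>_. 0"] by simp
  moreover have "range (lin_comb xs) \<inter> range (lin_comb ys) \<subseteq> {0}"
  proof
    fix x assume "x \<in> range (lin_comb xs) \<inter> range (lin_comb ys)"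
    then obtain c c' where c: "x = lin_comb xs c" "x = lin_comb ys c'" by blast
    then have "lin_comb xs c + lin_comb ys (\<lambda>i. - 1 * c' i) = 0"
      by (simp only: lin_comb_scale) simp
    then have "\<forall>i<length xs. c i = 0" using glue by blast
    then have "lin_comb xs c = lin_comb xs (\<lambda>_. 0)" by (intro lin_comb_cong) simp
    then show "x \<in> {0}" using c by simp
  qed
  moreover have "0 \<in> range (lin_comb xs) \<inter> range (lin_comb ys)"
    using subspace_range_lin_comb subspace_0 by blast
  ultimately show "independent_list xs \<and> independent_list ys \<and>
     range (lin_comb xs) \<inter> range (lin_comb ys) = {0}" by blast
next
  assume *: "independent_list xs \<and> independent_list ys \<and>
     range (lin_comb xs) \<inter> range (lin_comb ys) = {0}"
  show "independent_list (xs @ ys)" unfolding independent_list_def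
  proof (intro allI impI)
    fix c i assume c: "lin_comb (xs @ ys) c = 0" and i: "i < length (xs @ ys)"
    let ?c' = "\<lambda>i. c (i + length xs)"
    have 0: "lin_comb xs c + lin_comb ys ?c' = 0" using c by (simp add: lin_comb_append)
    then have "lin_comb xs c = lin_comb ys (\<lambda>i. - 1 * ?c' i)"
      by (simp only: lin_comb_scale) (simp add: add_eq_0_iff2)
    then have "lin_comb xs c \<in> range (lin_comb xs) \<inter> range (lin_comb ys)" by (metis IntI rangeI)
    then have z: "lin_comb xs c = 0" using * by blast
    then have z': "lin_comb ys ?c' = 0" using 0 by simp
    show "c i = 0"
    proof (cases "i < length xs")
      case True
      then show ?thesis using * z by (simp add: independent_list_def)
    next
      case False
      have "\<forall>j<length ys. ?c' j = 0" using * z' unfolding independent_list_def by blast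
      moreover have "i - length xs < length ys" using i False by auto
      ultimately have "?c' (i - length xs) = 0" by blast
      then show ?thesis using False by simp
    qed
  qed
qed

lemma range_lin_comb_append:
  "range (lin_comb (xs @ ys)) = {x + y | x y. x \<in> range (lin_comb xs) \<and> y \<in> range (lin_comb ys)}"
proof
  show "range (lin_comb (xs @ ys)) \<subseteq> {x + y | x y. x \<in> range (lin_comb xs) \<and> y \<in> range (lin_comb ys)}"
    by (auto simp: lin_comb_append)
  show "{x + y | x y. x \<in> range (lin_comb xs) \<and> y \<in> range (lin_comb ys)} \<subseteq> range (lin_comb (xs @ ys))"
  proof clarify
    fix c c' :: "nat \<Rightarrow> 'a"
    define e where "e i = (if i < length xs then c i else c' (i - length xs))" for i
    have "lin_comb (xs @ ys) e = lin_comb xs e + lin_comb ys (\<lambda>i. e (i + length xs))"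
      by (rule lin_comb_append)
    also have "\<dots> = lin_comb xs c + lin_comb ys c'"
      by (intro arg_cong2[where f = "(+)"] lin_comb_cong) (auto simp: e_def)
    finally show "lin_comb xs c + lin_comb ys c' \<in> range (lin_comb (xs @ ys))" by (metis rangeI)
  qed
qed

text \<open>The zero corners say that \<open>u\<close> maps each of the two spans into itself. Both
  directions matter: one assembles a matrix from summands, the other cuts a given matrix into
  summands.\<close>

lemma represents_four_block:
  assumes A: "A \<in> carrier_mat (length xs) (length xs)" and B: "B \<in> carrier_mat (length ys) (length ys)"
  shows "represents W (xs @ ys) (four_block_mat A (0\<^sub>m (length xs) (length ys)) (0\<^sub>m (length ys) (length xs)) B)
    \<longleftrightarrow> represents (range (lin_comb xs)) xs A \<and> represents (range (lin_comb ys)) ys B \<and>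
        direct_sum (range (lin_comb xs)) (range (lin_comb ys)) W"
    (is "represents W _ ?M \<longleftrightarrow> _")
proof -
  have M: "?M \<in> carrier_mat (length (xs @ ys)) (length (xs @ ys))" using A B by simp
  have 1: "lin_comb (xs @ ys) (\<lambda>i. ?M $$ (i, j)) = lin_comb xs (\<lambda>i. A $$ (i, j))" if "j < length xs" for j
  proof -
    have "lin_comb (xs @ ys) (\<lambda>i. ?M $$ (i, j)) =
        lin_comb xs (\<lambda>i. ?M $$ (i, j)) + lin_comb ys (\<lambda>i. ?M $$ (i + length xs, j))"
      by (rule lin_comb_append)
    also have "\<dots> = lin_comb xs (\<lambda>i. A $$ (i, j)) + lin_comb ys (\<lambda>_. 0)"
      using that A B by (intro arg_cong2[where f = "(+)"] lin_comb_cong) auto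
    finally show ?thesis by simp
  qed
  have 2: "lin_comb (xs @ ys) (\<lambda>i. ?M $$ (i, j + length xs)) = lin_comb ys (\<lambda>i. B $$ (i, j))" if "j < length ys" for j
  proof -
    have "lin_comb (xs @ ys) (\<lambda>i. ?M $$ (i, j + length xs)) =
        lin_comb xs (\<lambda>i. ?M $$ (i, j + length xs)) + lin_comb ys (\<lambda>i. ?M $$ (i + length xs, j + length xs))"
      by (rule lin_comb_append)
    also have "\<dots> = lin_comb xs (\<lambda>_. 0) + lin_comb ys (\<lambda>i. B $$ (i, j))"
      using that A B by (intro arg_cong2[where f = "(+)"] lin_comb_cong) auto
    finally show ?thesis by simp
  qed
  have "(\<forall>j<length (xs @ ys). u ((xs @ ys) ! j) = lin_comb (xs @ ys) (\<lambda>i. ?M $$ (i, j))) \<longleftrightarrow>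
      (\<forall>j<length xs. u (xs ! j) = lin_comb xs (\<lambda>i. A $$ (i, j))) \<and>
      (\<forall>j<length ys. u (ys ! j) = lin_comb ys (\<lambda>i. B $$ (i, j)))" (is "?l \<longleftrightarrow> ?r")
  proof
    assume l: ?l
    show ?r
    proof (intro conjI allI impI)
      fix j assume "j < length xs"
      then show "u (xs ! j) = lin_comb xs (\<lambda>i. A $$ (i, j))"
        using l[rule_format, of j] 1[of j] by (simp add: nth_append)
    next
      fix j assume "j < length ys"
      then show "u (ys ! j) = lin_comb ys (\<lambda>i. B $$ (i, j))"
        using l[rule_format, of "j + length xs"] 2[of j] by (simp add: nth_append)
    qed
  next
    assume r: ?r
    show ?l
    proof (intro allI impI)
      fix j assume j: "j < length (xs @ ys)"
      show "u ((xs @ ys) ! j) = lin_comb (xs @ ys) (\<lambda>i. ?M $$ (i, j))"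
      proof (cases "j < length xs")
        case True
        then show ?thesis using r 1[of j] by (simp add: nth_append)
      next
        case False
        then have "j - length xs < length ys" "j - length xs + length xs = j" using j by auto
        then show ?thesis using r 2[of "j - length xs"] False by (simp add: nth_append)
      qed
    qed
  qed
  then show ?thesis
    using A B M unfolding represents_def independent_append_iff direct_sum_def range_lin_comb_append
    by (auto simp: subspace_range_lin_comb)
qed

lemma represented_on_four_block:
  assumes "square_mat A" "square_mat B"
  shows "represented_on W (four_block_mat A (0\<^sub>m (dim_row A) (dim_col B)) (0\<^sub>m (dim_row B) (dim_col A)) B)
    \<longleftrightarrow> (\<exists>W1 W2. represented_on W1 A \<and> represented_on W2 B \<and> direct_sum W1 W2 W)"
    (is "represented_on W ?M \<longleftrightarrow> ?r")
proof
  assume "represented_on W ?M"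
  then obtain bs where bs: "represents W bs ?M" by (auto simp: represented_on_def)
  define xs ys where "xs = take (dim_row A) bs" and "ys = drop (dim_row A) bs"
  have "?M \<in> carrier_mat (length bs) (length bs)" using bs by (simp add: represents_def)
  then have "dim_row ?M = length bs" by (rule carrier_matD(1))
  then have "length bs = dim_row A + dim_row B" by simp
  then have l: "length xs = dim_row A" "length ys = dim_row B" "bs = xs @ ys"
    by (auto simp: xs_def ys_def)
  have "dim_row A = dim_col A" "dim_row B = dim_col B" using assms by auto
  then have "represents W (xs @ ys) (four_block_mat A (0\<^sub>m (length xs) (length ys)) (0\<^sub>m (length ys) (length xs)) B)"
    "A \<in> carrier_mat (length xs) (length xs)" "B \<in> carrier_mat (length ys) (length ys)"
    using bs l by auto
  then show ?r using represents_four_block unfolding represented_on_def by blast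
next
  assume ?r
  then obtain xs ys where "represents (range (lin_comb xs)) xs A" "represents (range (lin_comb ys)) ys B"
    "direct_sum (range (lin_comb xs)) (range (lin_comb ys)) W"
    by (auto simp: represented_on_def) (auto simp: represents_def)
  moreover from this have "A \<in> carrier_mat (length xs) (length xs)" "B \<in> carrier_mat (length ys) (length ys)"
    by (auto simp: represents_def)
  moreover from this have "dim_row A = length xs" "dim_col A = length xs" "dim_row B = length ys" "dim_col B = length ys"
    by auto
  ultimately show "represented_on W ?M"
    using represents_four_block[of A xs B ys W] unfolding represented_on_def by auto
qed

lemma represented_on_Nil: "represented_on W (diag_block_mat []) \<longleftrightarrow> W = {0}"
proof
  assume "represented_on W (diag_block_mat [])"
  then show "W = {0}" by (auto simp: represented_on_def represents_def lin_comb_def)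
next
  assume "W = {0}"
  then have "represents W [] (diag_block_mat [])"
    by (auto simp: represents_def lin_comb_def independent_list_def)
  then show "represented_on W (diag_block_mat [])" unfolding represented_on_def by blast
qed

lemma represented_on_append:
  assumes "Ball (set As) square_mat" "Ball (set Bs) square_mat"
  shows "represented_on W (diag_block_mat (As @ Bs)) \<longleftrightarrow>
    (\<exists>W1 W2. represented_on W1 (diag_block_mat As) \<and> represented_on W2 (diag_block_mat Bs) \<and> direct_sum W1 W2 W)"
  using represented_on_four_block[OF diag_block_mat_square[OF assms(1)] diag_block_mat_square[OF assms(2)]]
  by (simp add: diag_block_mat_append Let_def)

lemma represented_on_Cons:
  assumes "square_mat A" "Ball (set Bs) square_mat"
  shows "represented_on W (diag_block_mat (A # Bs)) \<longleftrightarrow>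
    (\<exists>W1 W2. represented_on W1 A \<and> represented_on W2 (diag_block_mat Bs) \<and> direct_sum W1 W2 W)"
  using represented_on_append[of "[A]" Bs W] assms
  by (simp only: append_Cons append_Nil diag_block_mat_singleton) simp

section \<open>Companion matrices and cyclic subspaces\<close>

definition powers :: "nat \<Rightarrow> 'v \<Rightarrow> 'v list" where
  "powers n v = map (\<lambda>i. (u ^^ i) v) [0..<n]"

lemma length_powers [simp]: "length (powers n v) = n"
  by (simp add: powers_def)

lemma lin_comb_powers: "lin_comb (powers n v) c = (\<Sum>i<n. scale (c i) ((u ^^ i) v))"
  by (simp add: lin_comb_def powers_def)

lemma lin_comb_powers_act:
  assumes "Polynomial.degree f < n"
  shows "lin_comb (powers n v) (Polynomial.coeff f) = act f v"
proof -
  obtain m where m: "n = Suc m" using assms not0_implies_Suc[of n] by auto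
  then show ?thesis using assms act_sum[of f m v] by (simp add: lin_comb_powers lessThan_Suc_atMost)
qed

text \<open>Coordinates on the first \<open>n\<close> powers correspond to polynomials of degree
  below \<open>n\<close>. The alternative \<open>f = 0\<close> is there for \<open>n = 0\<close>,
  when no degree is small enough.\<close>

lemma lin_comb_powers_poly:
  "\<exists>f. (f = 0 \<or> Polynomial.degree f < n) \<and> lin_comb (powers n v) c = act f v \<and> (\<forall>i<n. Polynomial.coeff f i = c i)"
proof (cases n)
  case 0
  then show ?thesis by (intro exI[of _ 0]) (simp add: lin_comb_powers)
next
  case (Suc m)
  define f where "f = (\<Sum>i\<le>m. Polynomial.monom (c i) i)"
  have coeff: "Polynomial.coeff f i = (if i \<le> m then c i else 0)" for i
    by (simp add: f_def coeff_sum)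
  then have deg: "Polynomial.degree f < n" using Suc
    by (metis degree_le less_Suc_eq_le not_le)
  have "lin_comb (powers n v) c = lin_comb (powers n v) (Polynomial.coeff f)"
    by (intro lin_comb_cong) (use coeff Suc in auto)
  then show ?thesis using deg coeff lin_comb_powers_act[OF deg] Suc by (intro exI[of _ f]) auto
qed

text \<open>A relation among these powers is a polynomial of smaller degree than \<open>f\<close>
  that \<open>f\<close> divides, hence zero.\<close>

lemma independent_powers:
  assumes "has_annihilator f v" "n = Polynomial.degree f"
  shows "independent_list (powers n v)"
  unfolding independent_list_def
proof (intro allI impI)
  fix c i assume c: "lin_comb (powers n v) c = 0" and i: "i < length (powers n v)"
  obtain g where g: "g = 0 \<or> Polynomial.degree g < n" "lin_comb (powers n v) c = act g v"
    "\<forall>i<n. Polynomial.coeff g i = c i" using lin_comb_powers_poly by blast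
  then have "f dvd g" using c assms(1) by (simp add: has_annihilator_def)
  then have "g = 0" using g(1) assms(2) dvd_imp_degree_le[of f g] by (metis not_less)
  then show "c i = 0" using g(3) i by auto
qed

lemma range_lin_comb_powers:
  assumes "act f v = 0" "f \<noteq> 0" "n = Polynomial.degree f"
  shows "range (lin_comb (powers n v)) = cyclic v"
proof
  show "range (lin_comb (powers n v)) \<subseteq> cyclic v"
    using lin_comb_powers_poly by (metis cyclicI image_subset_iff)
  show "cyclic v \<subseteq> range (lin_comb (powers n v))"
  proof
    fix x assume "x \<in> cyclic v"
    then obtain g where "x = act g v" by (rule cyclicE)
    also have "\<dots> = act (f * (g div f) + g mod f) v" by simp
    also have "\<dots> = act (g mod f) v"
      by (simp only: act_add act_mult act_commute[of f] assms(1)) (simp add: act_simps)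
    finally have x: "x = act (g mod f) v" .
    show "x \<in> range (lin_comb (powers n v))"
    proof (cases "g mod f = 0")
      case True
      then show ?thesis using x by (metis act_0 lin_comb_zero rangeI)
    next
      case False
      then have "Polynomial.degree (g mod f) < n" using degree_mod_less[of f g] assms by auto
      then show ?thesis using x lin_comb_powers_act by (metis rangeI)
    qed
  qed
qed

lemma act_monic:
  assumes "lead_coeff f = 1"
  shows "act f v = (\<Sum>i<Polynomial.degree f. scale (Polynomial.coeff f i) ((u ^^ i) v)) + (u ^^ Polynomial.degree f) v"
  using assms by (simp add: poly_endo_def flip: lessThan_Suc_atMost)

lemma companion_carrier [simp]: "companion_mat f \<in> carrier_mat (Polynomial.degree f) (Polynomial.degree f)"
  by (simp add: companion_mat_def Let_def)

lemma companion_square: "square_mat (companion_mat f)"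
  by (simp add: companion_mat_def Let_def)

lemma lin_comb_companion:
  assumes "j < Polynomial.degree f" "length bs = Polynomial.degree f"
  shows "lin_comb bs (\<lambda>i. companion_mat f $$ (i, j)) =
    (if Suc j < Polynomial.degree f then bs ! Suc j
     else - (\<Sum>i<Polynomial.degree f. scale (Polynomial.coeff f i) (bs ! i)))"
proof -
  let ?n = "Polynomial.degree f"
  have "lin_comb bs (\<lambda>i. companion_mat f $$ (i, j)) = (\<Sum>i<?n. scale (companion_mat f $$ (i, j)) (bs ! i))"
    using assms by (simp add: lin_comb_def)
  also have "\<dots> = (\<Sum>i<?n. if Suc j < ?n then (if i = Suc j then bs ! Suc j else 0)
      else - scale (Polynomial.coeff f i) (bs ! i))"
    using assms(1) by (intro sum.cong) (auto simp: companion_mat_def Let_def)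
  finally show ?thesis by (simp add: sum_negf)
qed

lemma represents_companion:
  assumes "lead_coeff f = 1" "has_annihilator f v"
  shows "represents (cyclic v) (powers (Polynomial.degree f) v) (companion_mat f)"
proof -
  let ?n = "Polynomial.degree f"
  have 0: "act f v = 0" using assms(2) by (simp add: has_annihilator_def)
  have "f \<noteq> 0" using assms(1) by auto
  have "u (powers ?n v ! j) = lin_comb (powers ?n v) (\<lambda>i. companion_mat f $$ (i, j))" if "j < ?n" for j
  proof (cases "Suc j < ?n")
    case True
    then show ?thesis using that by (subst lin_comb_companion) (simp_all add: powers_def)
  next
    case False
    then have "Suc j = ?n" using that by simp
    then have "u ((u ^^ j) v) = (u ^^ ?n) v" by (metis comp_apply funpow.simps(2))
    moreover have "(u ^^ ?n) v = - (\<Sum>i<?n. scale (Polynomial.coeff f i) ((u ^^ i) v))"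
      using 0 act_monic[OF assms(1)] by (simp add: eq_neg_iff_add_eq_0 add.commute)
    ultimately show ?thesis using that False
      by (subst lin_comb_companion) (simp_all add: powers_def)
  qed
  then show ?thesis unfolding represents_def
    using independent_powers[OF assms(2)] range_lin_comb_powers[OF 0 \<open>f \<noteq> 0\<close>] by auto
qed

text \<open>Read in order, the columns force the basis to consist of the powers of its first vector
  \<open>v\<close>, and the last column is the relation \<open>act f v = 0\<close>. Independence
  then excludes annihilators of smaller degree.\<close>

lemma represented_on_companion:
  assumes f: "lead_coeff f = 1"
  shows "represented_on W (companion_mat f) \<longleftrightarrow> (\<exists>v. W = cyclic v \<and> has_annihilator f v)"
proof
  assume "represented_on W (companion_mat f)"
  then obtain bs where bs: "represents W bs (companion_mat f)" unfolding represented_on_def by blast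
  let ?n = "Polynomial.degree f"
  have "companion_mat f \<in> carrier_mat (length bs) (length bs)" using bs by (simp only: represents_def)
  then have len: "length bs = ?n" by (metis carrier_matD(1) companion_carrier)
  \<comment> \<open>In degree 0 the basis is empty, and 0 is the generator of the zero
    space.\<close>
  define v where "v = (if ?n = 0 then 0 else bs ! 0)"
  have u_bs: "u (bs ! j) = (if Suc j < ?n then bs ! Suc j
     else - (\<Sum>i<?n. scale (Polynomial.coeff f i) (bs ! i)))" if "j < ?n" for j
    using bs that len lin_comb_companion[OF that len] by (simp add: represents_def)
  have pow: "bs ! j = (u ^^ j) v" if "j < ?n" for j
    using that
  proof (induction j)
    case 0
    then show ?case by (simp add: v_def)
  next
    case (Suc j)
    then show ?case using u_bs[of j] by simp
  qed
  have bs_eq: "bs = powers ?n v"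
    by (intro nth_equalityI) (simp_all add: len pow powers_def)
  have 0: "act f v = 0"
  proof (cases "?n = 0")
    case True
    then show ?thesis by (simp add: v_def act_simps)
  next
    case False
    then obtain m where m: "?n = Suc m" using not0_implies_Suc by blast
    have "(u ^^ ?n) v = u (bs ! m)" using pow[of m] m by simp
    also have "\<dots> = - (\<Sum>i<?n. scale (Polynomial.coeff f i) ((u ^^ i) v))"
      using u_bs[of m] m pow by simp
    finally show ?thesis using act_monic[OF f] by simp
  qed
  have f0: "f \<noteq> 0" using f by auto
  have "has_annihilator f v"
  proof (rule has_annihilatorI[OF 0])
    fix g assume g: "act g v = 0"
    have "act (f * (g div f) + g mod f) v = 0" using g by simp
    then have "act (g mod f) v = 0"
      by (simp only: act_add act_mult act_commute[of f] 0) (simp add: act_simps)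
    show "f dvd g"
    proof (rule ccontr)
      assume "\<not> f dvd g"
      then have nz: "g mod f \<noteq> 0" by (simp add: mod_eq_0_iff_dvd)
      then have deg: "Polynomial.degree (g mod f) < ?n" using degree_mod_less[OF f0, of g] by auto
      then have "lin_comb bs (Polynomial.coeff (g mod f)) = 0"
        using \<open>act (g mod f) v = 0\<close> lin_comb_powers_act bs_eq by metis
      moreover have "independent_list bs" using bs by (simp add: represents_def)
      ultimately have "\<forall>i<?n. Polynomial.coeff (g mod f) i = 0"
        unfolding independent_list_def len by blast
      then have "Polynomial.coeff (g mod f) (Polynomial.degree (g mod f)) = 0" using deg by blast
      then show False using nz by simp
    qed
  qed
  moreover have "W = cyclic v"
    using bs range_lin_comb_powers[OF 0 f0 refl] unfolding represents_def bs_eq[symmetric] by simp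
  ultimately show "\<exists>v. W = cyclic v \<and> has_annihilator f v" by blast
next
  assume "\<exists>v. W = cyclic v \<and> has_annihilator f v"
  then show "represented_on W (companion_mat f)"
    using represents_companion[OF f] unfolding represented_on_def by blast
qed

end

section \<open>Nilpotent operators with a skew-commuting square root\<close>

context endomorphism
begin

lemma direct_sum_subset:
  assumes "direct_sum A B W"
  shows "A \<subseteq> W" "B \<subseteq> W"
proof -
  have W: "W = {x + y | x y. x \<in> A \<and> y \<in> B}" and 0: "0 \<in> A" "0 \<in> B"
    using assms subspace_0 unfolding direct_sum_def by blast+
  show "A \<subseteq> W"
  proof
    fix x assume "x \<in> A"
    then have "x + 0 \<in> W" unfolding W using 0 by blast
    then show "x \<in> W" by simp
  qed
  show "B \<subseteq> W"
  proof
    fix x assume "x \<in> B"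
    then have "0 + x \<in> W" unfolding W using 0 by blast
    then show "x \<in> W" by simp
  qed
qed

definition stable :: "('v \<Rightarrow> 'v) \<Rightarrow> ('v \<Rightarrow> 'v) \<Rightarrow> 'v set \<Rightarrow> bool" where
  "stable f g S \<longleftrightarrow> subspace S \<and> f ` S \<subseteq> S \<and> g ` S \<subseteq> S"

text \<open>Defined as a hull, so that inclusions follow from minimality;
  \<open>generated_elem\<close> and \<open>generated_eq\<close> give explicit descriptions.\<close>

definition generated :: "('v \<Rightarrow> 'v) \<Rightarrow> ('v \<Rightarrow> 'v) \<Rightarrow> 'v \<Rightarrow> 'v set" where
  "generated f g v = (stable f g) hull {v}"

lemma stable_generated: "stable f g (generated f g v)"
  unfolding generated_def
proof (rule hull_in)
  fix T assume *: "Ball T (stable f g)"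
  then have "subspace (\<Inter> T)" by (intro subspace_Inter) (simp add: stable_def)
  moreover have "f ` \<Inter> T \<subseteq> \<Inter> T" "g ` \<Inter> T \<subseteq> \<Inter> T" using * unfolding stable_def by blast+
  ultimately show "stable f g (\<Inter> T)" by (simp add: stable_def)
qed

lemma mem_generated: "v \<in> generated f g v"
  unfolding generated_def by (rule hull_inc) simp

lemma generated_minimal: "stable f g S \<Longrightarrow> v \<in> S \<Longrightarrow> generated f g v \<subseteq> S"
  unfolding generated_def by (rule hull_minimal) simp_all

lemma stableD:
  assumes "stable f g S"
  shows "subspace S" "\<And>x. x \<in> S \<Longrightarrow> f x \<in> S" "\<And>x. x \<in> S \<Longrightarrow> g x \<in> S"
  using assms by (auto simp: stable_def)

end

text \<open>The operator \<open>x\<close> induces on the kernel and on the cokernel of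
  \<open>N\<close> a square root of the nonsquare \<open>c\<close>, which makes both of them vector
  spaces over F(sqrt c). Nilpotency of \<open>N\<close> is assumed later, on subspaces, so that one
  locale serves both primary parts.\<close>

locale skew_pair = endomorphism scale N + finite_dimensional_vector_space scale Basis
  for scale :: "'a::field \<Rightarrow> 'v::ab_group_add \<Rightarrow> 'v" and N :: "'v \<Rightarrow> 'v" and Basis :: "'v set" +
  fixes x :: "'v \<Rightarrow> 'v" and c :: 'a
  assumes linear_x: "Vector_Spaces.linear scale scale x"
    and x_N: "x (N v) = - N (x v)"
    and x_x: "x (x v) = scale c v - N (N v)"
    and nonsquare: "e * e \<noteq> c"
begin

lemmas N_simps = u_simps
lemmas x_simps = linear_add[OF linear_x] linear_scale[OF linear_x] linear_zero[OF linear_x]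
  linear_minus[OF linear_x] linear_diff[OF linear_x]

text \<open>This is the norm form of F(sqrt c), anisotropic because \<open>c\<close> is not a
  square.\<close>

lemma norm_nonzero:
  assumes "\<alpha> \<noteq> 0 \<or> \<beta> \<noteq> 0"
  shows "\<alpha> * \<alpha> - \<beta> * \<beta> * c \<noteq> 0"
proof
  assume eq: "\<alpha> * \<alpha> - \<beta> * \<beta> * c = 0"
  show False
  proof (cases "\<beta> = 0")
    case True
    then show False using assms eq by simp
  next
    case False
    then have "(\<alpha> / \<beta>) * (\<alpha> / \<beta>) = c" using eq by (simp add: field_simps)
    then show False using nonsquare by blast
  qed
qed

text \<open>Generators are nonzero for two reasons: lifting needs \<open>N y \<noteq> 0\<close> for
  a preimage \<open>y\<close> of a generator, and the blocks need a last nonvanishing power.\<close>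

inductive decomposes :: "'v set \<Rightarrow> bool" where
  zero: "decomposes {0}"
| add: "decomposes W' \<Longrightarrow> v \<noteq> 0 \<Longrightarrow> direct_sum (generated N x v) W' W \<Longrightarrow> decomposes W"

lemma stable_sum:
  assumes "stable N x A" "stable N x B" "direct_sum A B W"
  shows "stable N x W"
  unfolding stable_def
proof (intro conjI)
  show "subspace W" using assms(3) by (rule direct_sum_subspace)
  show "N ` W \<subseteq> W"
    using assms(3) stableD(2)[OF assms(1)] stableD(2)[OF assms(2)]
    by (auto simp: direct_sum_def N_simps) blast
  show "x ` W \<subseteq> W"
    using assms(3) stableD(3)[OF assms(1)] stableD(3)[OF assms(2)]
    by (auto simp: direct_sum_def x_simps) blast
qed

lemma stable_decomposes: "decomposes W \<Longrightarrow> stable N x W"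
proof (induction rule: decomposes.induct)
  case zero
  then show ?case by (auto simp: stable_def subspace_single_0 N_simps x_simps)
next
  case (add W' v W)
  then show ?case using stable_sum stable_generated by blast
qed

lemma stable_image:
  assumes "stable N x W"
  shows "stable N x (N ` W)"
  unfolding stable_def
proof (intro conjI)
  note W = stableD[OF assms]
  show "subspace (N ` W)"
  proof (rule subspaceI)
    show "0 \<in> N ` W" using subspace_0[OF W(1)] N_simps by (metis imageI)
    show "a + b \<in> N ` W" if "a \<in> N ` W" "b \<in> N ` W" for a b
      using that subspace_add[OF W(1)] N_simps(1) by (auto simp: image_iff) (metis)
    show "scale k a \<in> N ` W" if "a \<in> N ` W" for a k
      using that subspace_scale[OF W(1)] N_simps(2) by (auto simp: image_iff) (metis)
  qed
  show "N ` (N ` W) \<subseteq> N ` W" using W by blast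
  show "x ` (N ` W) \<subseteq> N ` W"
  proof clarify
    fix y assume "y \<in> W"
    then have "- x y \<in> W" using W subspace_neg by blast
    moreover have "x (N y) = N (- x y)" by (simp add: x_N N_simps)
    ultimately show "x (N y) \<in> N ` W" by blast
  qed
qed

text \<open>Modulo its image under \<open>N\<close>, the generated subspace is spanned over F(sqrt
  c) by the class of \<open>v\<close>. The vectors of the stated form make up a stable subspace that
  contains \<open>v\<close>.\<close>

lemma generated_elem:
  assumes "q \<in> generated N x v"
  obtains \<alpha> \<beta> q' where "q' \<in> generated N x v" "q = scale \<alpha> v + scale \<beta> (x v) + N q'"
proof -
  let ?Q = "generated N x v"
  note Q = stableD[OF stable_generated[of N x v]] and v = mem_generated[of v N x]
  define T where "T = {scale \<alpha> v + scale \<beta> (x v) + N q' | \<alpha> \<beta> q'. q' \<in> ?Q}"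
  have TI: "scale \<alpha> v + scale \<beta> (x v) + N q' \<in> T" if "q' \<in> ?Q" for \<alpha> \<beta> q'
    using that by (auto simp: T_def)
  have T_Q: "t \<in> ?Q" if "t \<in> T" for t
    using that Q v by (auto simp: T_def intro!: subspace_add subspace_scale)
  have "stable N x T" unfolding stable_def
  proof (intro conjI)
    show "subspace T"
    proof (rule subspaceI)
      show "0 \<in> T" using TI[of 0 0 0] subspace_0[OF Q(1)] by (simp add: N_simps)
      show "a + b \<in> T" if ab: "a \<in> T" "b \<in> T" for a b
      proof -
        obtain \<alpha> \<beta> q \<alpha>' \<beta>' q' where *: "q \<in> ?Q" "a = scale \<alpha> v + scale \<beta> (x v) + N q"
          "q' \<in> ?Q" "b = scale \<alpha>' v + scale \<beta>' (x v) + N q'"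
          using ab unfolding T_def by blast
        have "a + b = scale (\<alpha> + \<alpha>') v + scale (\<beta> + \<beta>') (x v) + N (q + q')"
          using * by (simp add: scale_left_distrib N_simps algebra_simps)
        then show ?thesis using TI subspace_add[OF Q(1) *(1,3)] by simp
      qed
      show "scale k a \<in> T" if a: "a \<in> T" for a k
      proof -
        obtain \<alpha> \<beta> q where *: "q \<in> ?Q" "a = scale \<alpha> v + scale \<beta> (x v) + N q"
          using a unfolding T_def by blast
        have "scale k a = scale (k * \<alpha>) v + scale (k * \<beta>) (x v) + N (scale k q)"
          using * by (simp add: scale_right_distrib N_simps)
        then show ?thesis using TI subspace_scale[OF Q(1) *(1)] by simp
      qed
    qed
    show "N ` T \<subseteq> T" using TI[of _ 0 0] T_Q by auto
    show "x ` T \<subseteq> T"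
    proof
      fix z assume "z \<in> x ` T"
      then obtain \<alpha> \<beta> q where *: "q \<in> ?Q" "z = x (scale \<alpha> v + scale \<beta> (x v) + N q)"
        unfolding T_def by blast
      \<comment> \<open>By \<open>x_x\<close> the term in \<open>x (x v)\<close> becomes a multiple
        of \<open>v\<close> plus an image under \<open>N\<close>; the sign before \<open>x q\<close>
        comes from \<open>x_N\<close>.\<close>
      have "z = scale (\<beta> * c) v + scale \<alpha> (x v) + N (- scale \<beta> (N v) - x q)"
        using * by (simp add: x_simps x_x x_N N_simps scale_right_diff_distrib)
      moreover have "- scale \<beta> (N v) - x q \<in> ?Q"
        using Q * v by (intro subspace_diff subspace_neg subspace_scale) auto
      ultimately show "z \<in> T" using TI by simp
    qed
  qed
  moreover have "v \<in> T" using TI[of 0 1 0] subspace_0[OF Q(1)] by (simp add: N_simps)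
  ultimately have "?Q \<subseteq> T" by (rule generated_minimal)
  then show ?thesis using assms that unfolding T_def by blast
qed

text \<open>Skew-commutation introduces just signs, so images and preimages of stable subspaces
  under \<open>N\<close> are stable, and minimality gives both inclusions.\<close>

lemma generated_image: "generated N x (N v) = N ` generated N x v"
proof
  show "generated N x (N v) \<subseteq> N ` generated N x v"
    using stable_image[OF stable_generated] mem_generated by (intro generated_minimal) auto
  let ?R = "generated N x (N v)"
  note R = stableD[OF stable_generated[of N x "N v"]]
  have "stable N x {q. N q \<in> ?R}" unfolding stable_def
  proof (intro conjI)
    show "subspace {q. N q \<in> ?R}"
      by (rule subspaceI) (auto simp: N_simps intro: subspace_0[OF R(1)] subspace_add[OF R(1)] subspace_scale[OF R(1)])
    show "N ` {q. N q \<in> ?R} \<subseteq> {q. N q \<in> ?R}" using R(2) by auto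
    show "x ` {q. N q \<in> ?R} \<subseteq> {q. N q \<in> ?R}"
    proof clarify
      fix q assume "N q \<in> ?R"
      then have "- x (N q) \<in> ?R" using R subspace_neg by blast
      then show "N (x q) \<in> ?R" by (simp add: x_N)
    qed
  qed
  then have "generated N x v \<subseteq> {q. N q \<in> ?R}"
    using mem_generated by (intro generated_minimal) auto
  then show "N ` generated N x v \<subseteq> ?R" by blast
qed

text \<open>If \<open>v\<close> lies in the image, so does the whole generated subspace, and this
  inclusion iterates. For a nilpotent \<open>N\<close> it forces \<open>v = 0\<close>.\<close>

lemma mem_generated_funpow:
  assumes "v \<in> N ` generated N x v"
  shows "v \<in> (N ^^ k) ` generated N x v"
proof (induction k)
  case 0
  then show ?case using mem_generated by simp
next
  case (Suc k)
  then obtain q where q: "q \<in> generated N x v" "v = (N ^^ k) q" by blast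
  have "generated N x v \<subseteq> N ` generated N x v"
    using assms stable_image[OF stable_generated] by (intro generated_minimal)
  then obtain q' where "q' \<in> generated N x v" "q = N q'" using q by blast
  then show ?case using q by (auto simp: funpow_swap1 intro: image_eqI[of _ _ q'])
qed

text \<open>As in a Jordan chain, a kernel vector has no component at the top. Otherwise, applying
  the conjugate \<alpha> - \<beta> x to the kernel vector \<open>q\<close> yields another kernel
  vector that is a nonzero multiple of \<open>v\<close> modulo the image of \<open>N\<close>. Then
  \<open>N v\<close> lies in the image of its own generated subspace and vanishes by
  nilpotency.\<close>

lemma generated_kernel:
  assumes nil: "\<And>q. q \<in> generated N x v \<Longrightarrow> (N ^^ k) q = 0"
    and "N v \<noteq> 0" and q: "q \<in> generated N x v" "N q = 0"
  shows "q \<in> N ` generated N x v"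
proof -
  let ?Q = "generated N x v"
  note Q = stableD[OF stable_generated[of N x v]] and v = mem_generated[of v N x]
  obtain \<alpha> \<beta> q' where q': "q' \<in> ?Q" "q = scale \<alpha> v + scale \<beta> (x v) + N q'"
    using q(1) by (rule generated_elem)
  show ?thesis
  proof (cases "\<alpha> = 0 \<and> \<beta> = 0")
    case True
    then show ?thesis using q' by simp
  next
    case False
    let ?n = "\<alpha> * \<alpha> - \<beta> * \<beta> * c"
    have n: "?n \<noteq> 0" using norm_nonzero False by blast
    \<comment> \<open>The vector \<open>q2\<close> collects the terms of
      \<open>scale \<alpha> q - scale \<beta> (x q)\<close> that carry a factor \<open>N\<close>;
      the terms in \<open>x v\<close> cancel.\<close>
    define q2 where "q2 = scale \<alpha> q' + scale (\<beta> * \<beta>) (N v) + scale \<beta> (x q')"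
    have q2: "q2 \<in> ?Q" unfolding q2_def using Q q' v by (intro subspace_add subspace_scale) auto
    have "scale \<alpha> q - scale \<beta> (x q) = scale ?n v + N q2"
      unfolding q'(2) q2_def
      by (simp add: x_simps x_x x_N N_simps scale_right_distrib scale_right_diff_distrib
          scale_left_diff_distrib mult.commute)
    moreover have "N (scale \<alpha> q - scale \<beta> (x q)) = 0"
      using x_N[of q] q(2) by (simp add: N_simps x_simps)
    ultimately have "scale ?n (N v) + N (N q2) = 0" by (simp add: N_simps)
    then have "scale ?n (N v) = - N (N q2)" by (simp only: eq_neg_iff_add_eq_0)
    then have "scale (1 / ?n) (scale ?n (N v)) = N (N (scale (1 / ?n) (- q2)))"
      by (simp add: N_simps)
    then have "N v = N (N (scale (1 / ?n) (- q2)))" using n by simp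
    moreover have "N (scale (1 / ?n) (- q2)) \<in> generated N x (N v)"
      unfolding generated_image using Q(1) q2 subspace_scale subspace_neg by blast
    ultimately have "N v \<in> N ` generated N x (N v)" by blast
    then have "N v \<in> (N ^^ k) ` generated N x (N v)" by (rule mem_generated_funpow)
    then obtain t where t: "t \<in> generated N x (N v)" "N v = (N ^^ k) t" by (rule imageE)
    have "t \<in> ?Q" using t(1) Q(2) unfolding generated_image by blast
    then have "N v = 0" using nil t(2) by simp
    then show ?thesis using assms(2) by blast
  qed
qed

text \<open>Chains are prolonged by replacing each generator of \<open>Z\<close> by a preimage under
  \<open>N\<close>. The last conjunct, that the kernel of \<open>N\<close> in \<open>U\<close> stays
  inside \<open>Z\<close>, is the strengthening that keeps the new sum direct.\<close>

lemma lift_decomposition: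
  assumes "decomposes Z" "stable N x W" "\<And>v. v \<in> W \<Longrightarrow> (N ^^ k) v = 0" "Z \<subseteq> N ` W"
  shows "\<exists>U. decomposes U \<and> U \<subseteq> W \<and> N ` U = Z \<and> Z \<subseteq> U \<and> (\<forall>q\<in>U. N q = 0 \<longrightarrow> q \<in> Z)"
  using assms(1,4)
proof (induction rule: decomposes.induct)
  case zero
  have "decomposes {0}" "{0} \<subseteq> W" using subspace_0[OF stableD(1)[OF assms(2)]] decomposes.zero by auto
  then show ?case by (intro exI[of _ "{0}"]) (auto simp: N_simps)
next
  case (add W' z Z)
  note W = stableD[OF assms(2)]
  note W' = stableD[OF stable_decomposes[OF add.hyps(1)]]
  let ?Qz = "generated N x z"
  note Qz = stableD[OF stable_generated[of N x z]]
  have Z: "Z = {a + b | a b. a \<in> ?Qz \<and> b \<in> W'}" "?Qz \<inter> W' = {0}"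
    using add.hyps(3) by (auto simp: direct_sum_def)
  note subs = direct_sum_subset[OF add.hyps(3)]
  have "W' \<subseteq> N ` W" using subs(2) add.prems by (rule order_trans)
  from add.IH[OF this] obtain U where U: "decomposes U" "U \<subseteq> W" "N ` U = W'" "W' \<subseteq> U"
    "\<forall>q\<in>U. N q = 0 \<longrightarrow> q \<in> W'"
    by (elim exE conjE)
  note SU = stableD[OF stable_decomposes[OF U(1)]]
  obtain y where y: "y \<in> W" "z = N y" using subs(1) mem_generated[of z N x] add.prems by blast
  let ?Q = "generated N x y"
  note Q = stableD[OF stable_generated[of N x y]]
  have QW: "?Q \<subseteq> W" using generated_minimal[OF assms(2) y(1)] .
  have img: "N ` ?Q = ?Qz" using generated_image y(2) by simp
  have ker: "q \<in> ?Qz" if "q \<in> ?Q" "N q = 0" for q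
    using generated_kernel[of y k q] that assms(3) QW y(2) add.hyps(2) img by blast
  \<comment> \<open>A common vector is mapped into \<open>?Qz \<inter> W'\<close>, hence to 0. So it
    is a kernel vector of both summands, which puts it into \<open>?Qz \<inter> W'\<close>
    itself.\<close>
  have "?Q \<inter> U \<subseteq> {0}"
  proof
    fix q assume q: "q \<in> ?Q \<inter> U"
    then have "N q \<in> ?Qz \<inter> W'" using img U(3) by blast
    then have "N q = 0" using Z(2) by blast
    then have "q \<in> ?Qz \<inter> W'" using q ker U(5) by blast
    then show "q \<in> {0}" using Z(2) by blast
  qed
  then have "?Q \<inter> U = {0}" using subspace_0[OF Q(1)] subspace_0[OF SU(1)] by blast
  then have ds: "direct_sum ?Q U {a + b | a b. a \<in> ?Q \<and> b \<in> U}" (is "direct_sum _ _ ?U")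
    using Q(1) SU(1) by (auto simp: direct_sum_def)
  have "y \<noteq> 0" using y(2) add.hyps(2) N_simps by auto
  then have "decomposes ?U" using U(1) ds by (blast intro: decomposes.add)
  moreover have "?U \<subseteq> W" using QW U(2) subspace_add[OF W(1)] by blast
  moreover have "N ` ?U = Z"
  proof
    show "N ` ?U \<subseteq> Z" unfolding Z using img U(3) by (auto simp: N_simps) blast
    show "Z \<subseteq> N ` ?U"
    proof
      fix t assume "t \<in> Z"
      then obtain a' b' where t: "a' \<in> N ` ?Q" "b' \<in> N ` U" "t = a' + b'"
        unfolding Z img U(3) by blast
      then obtain a b where "a \<in> ?Q" "b \<in> U" "t = N a + N b" by blast
      then have "a + b \<in> ?U" "t = N (a + b)" by (auto simp: N_simps)
      then show "t \<in> N ` ?U" by blast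
    qed
  qed
  moreover have "Z \<subseteq> ?U"
  proof -
    have "?Qz \<subseteq> ?Q" using Q(2) unfolding img[symmetric] by (rule image_subsetI)
    then show ?thesis unfolding Z using U(4) by fast
  qed
  moreover have "q \<in> Z" if q: "q \<in> ?U" "N q = 0" for q
  proof -
    obtain a b where ab: "a \<in> ?Q" "b \<in> U" "q = a + b" using q by blast
    then have 0: "N a + N b = 0" using q(2) by (simp add: N_simps)
    then have "N a = - N b" by (simp add: add_eq_0_iff2)
    moreover have "N a \<in> ?Qz" "N b \<in> W'" using ab img U(3) by auto
    ultimately have "N a \<in> ?Qz \<inter> W'" using subspace_neg[OF W'(1)] by simp
    then have "N a = 0" using Z(2) by blast
    moreover from this have "N b = 0" using 0 by simp
    ultimately have "a \<in> ?Qz" "b \<in> W'" using ab ker[of a] U(5) by simp_all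
    then show ?thesis unfolding Z ab(3) by blast
  qed
  ultimately show ?case by (intro exI[of _ ?U] conjI ballI impI) simp_all
qed

text \<open>As \<open>U\<close> already reaches the whole image of \<open>W\<close>, what is missing
  can be taken from the kernel of \<open>N\<close>, where a vector \<open>e\<close> generates no
  more than the span of \<open>e\<close> and \<open>x e\<close>.\<close>

lemma extend_decomposition:
  assumes "decomposes U" "U \<subseteq> W" "stable N x W" "N ` W \<subseteq> N ` U"
  shows "decomposes W"
  using assms(1,2,4)
proof (induction "dim W - dim U" arbitrary: U rule: less_induct)
  case less
  note W = stableD[OF assms(3)]
  note U = stableD[OF stable_decomposes[OF less.prems(1)]]
  show ?case
  proof (cases "U = W")
    case True
    then show ?thesis using less.prems by simp
  next
    case False
    then obtain t where t: "t \<in> W" "t \<notin> U" using less.prems by blast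
    then obtain t' where t': "t' \<in> U" "N t = N t'" using less.prems by blast
    \<comment> \<open>Subtracting a vector of \<open>U\<close> with the same image moves
      \<open>t\<close> into the kernel but not into \<open>U\<close>.\<close>
    define e where "e = t - t'"
    have e: "e \<in> W" "e \<notin> U" "N e = 0"
      using t t' less.prems(2) W(1) U(1) subspace_diff subspace_add[OF U(1), of e t'] by (auto simp: e_def N_simps)
    have xxe: "x (x e) = scale c e" using e by (simp add: x_x N_simps)
    have xe: "N (x e) = 0" using x_N[of e] e by (simp add: x_simps)
    let ?Q = "generated N x e"
    note Q = stableD[OF stable_generated[of N x e]]
    define T where "T = {scale \<alpha> e + scale \<beta> (x e) | \<alpha> \<beta>. True}"
    have TI: "scale \<alpha> e + scale \<beta> (x e) \<in> T" for \<alpha> \<beta> by (auto simp: T_def)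
    have "stable N x T" unfolding stable_def
    proof (intro conjI)
      show "subspace T"
      proof (rule subspaceI)
        show "0 \<in> T" using TI[of 0 0] by simp
        show "a + b \<in> T" if ab: "a \<in> T" "b \<in> T" for a b
        proof -
          obtain \<alpha> \<beta> \<alpha>' \<beta>' where "a = scale \<alpha> e + scale \<beta> (x e)" "b = scale \<alpha>' e + scale \<beta>' (x e)"
            using ab unfolding T_def by blast
          then have "a + b = scale (\<alpha> + \<alpha>') e + scale (\<beta> + \<beta>') (x e)"
            by (simp add: scale_left_distrib algebra_simps)
          then show ?thesis using TI by simp
        qed
        show "scale k a \<in> T" if a: "a \<in> T" for a k
        proof -
          obtain \<alpha> \<beta> where "a = scale \<alpha> e + scale \<beta> (x e)" using a unfolding T_def by blast
          then have "scale k a = scale (k * \<alpha>) e + scale (k * \<beta>) (x e)"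
            by (simp add: scale_right_distrib)
          then show ?thesis using TI by simp
        qed
      qed
      show "N ` T \<subseteq> T"
      proof
        fix z assume "z \<in> N ` T"
        then obtain \<alpha> \<beta> where "z = N (scale \<alpha> e + scale \<beta> (x e))" unfolding T_def by blast
        then show "z \<in> T" using TI[of 0 0] by (simp add: N_simps e xe)
      qed
      show "x ` T \<subseteq> T"
      proof
        fix z assume "z \<in> x ` T"
        then obtain \<alpha> \<beta> where "z = x (scale \<alpha> e + scale \<beta> (x e))" unfolding T_def by blast
        then have "z = scale (\<beta> * c) e + scale \<alpha> (x e)" by (simp add: x_simps xxe)
        then show "z \<in> T" using TI by simp
      qed
    qed
    moreover have "e \<in> T" using TI[of 1 0] by simp
    ultimately have QT: "?Q \<subseteq> T" by (rule generated_minimal)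
    have "?Q \<inter> U \<subseteq> {0}"
    proof
      fix q assume q: "q \<in> ?Q \<inter> U"
      then obtain \<alpha> \<beta> where ab: "q = scale \<alpha> e + scale \<beta> (x e)" using QT unfolding T_def by blast
      show "q \<in> {0}"
      proof (cases "\<alpha> = 0 \<and> \<beta> = 0")
        case True
        then show ?thesis using ab by simp
      next
        case False
        \<comment> \<open>The conjugate recovers a nonzero multiple of \<open>e\<close> from an
          element of \<open>U\<close>, against the choice of \<open>e\<close>.\<close>
        let ?n = "\<alpha> * \<alpha> - \<beta> * \<beta> * c"
        have n: "?n \<noteq> 0" using norm_nonzero False by blast
        have "scale \<alpha> q - scale \<beta> (x q) \<in> U" using q U by (intro subspace_diff subspace_scale) auto
        moreover have "scale \<alpha> q - scale \<beta> (x q) = scale ?n e"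
          unfolding ab by (simp add: x_simps xxe scale_right_distrib scale_left_diff_distrib mult.commute)
        ultimately have "scale ?n e \<in> U" by simp
        then have "scale (1 / ?n) (scale ?n e) \<in> U" by (rule subspace_scale[OF U(1)])
        then have "e \<in> U" using n by simp
        then show ?thesis using e by blast
      qed
    qed
    then have "?Q \<inter> U = {0}" using subspace_0[OF Q(1)] subspace_0[OF U(1)] by blast
    then have ds: "direct_sum ?Q U {a + b | a b. a \<in> ?Q \<and> b \<in> U}" (is "direct_sum _ _ ?U")
      using Q(1) U(1) by (auto simp: direct_sum_def)
    have "e \<noteq> 0" using e subspace_0[OF U(1)] by auto
    then have dec: "decomposes ?U" using less.prems(1) ds by (blast intro: decomposes.add)
    have UU: "U \<subseteq> ?U" by (rule direct_sum_subset(2)[OF ds])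
    have "e \<in> ?U" using direct_sum_subset(1)[OF ds] mem_generated[of e N x] by blast
    then have "U \<noteq> ?U" using e by blast
    have UW: "?U \<subseteq> W"
      using generated_minimal[OF assms(3) e(1)] less.prems(2) subspace_add[OF W(1)] by blast
    have "dim U < dim ?U"
      using subspace_dim_equal[OF U(1) direct_sum_subspace[OF ds] UU] \<open>U \<noteq> ?U\<close> by linarith
    moreover have "dim ?U \<le> dim W" using UW by (rule dim_subset)
    ultimately have "dim W - dim ?U < dim W - dim U" by linarith
    moreover have "N ` W \<subseteq> N ` ?U" using less.prems(3) UU by blast
    ultimately show ?thesis using less.hyps[OF _ dec UW] by blast
  qed
qed

text \<open>The image under \<open>N\<close> has smaller nilpotency index. Its decomposition is
  lifted along \<open>N\<close>, and kernel vectors supply the rest.\<close>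

theorem decomposition:
  assumes "stable N x W" "\<And>v. v \<in> W \<Longrightarrow> (N ^^ k) v = 0"
  shows "decomposes W"
  using assms
proof (induction k arbitrary: W)
  case 0
  then have "W = {0}" using subspace_0[OF stableD(1)[OF 0(1)]] by auto
  then show ?case by (simp add: decomposes.zero)
next
  case (Suc k)
  have "decomposes (N ` W)"
  proof (rule Suc.IH[OF stable_image[OF Suc.prems(1)]])
    fix v assume "v \<in> N ` W"
    then obtain y where "y \<in> W" "v = N y" by blast
    then show "(N ^^ k) v = 0" using Suc.prems(2)[of y] by (simp add: funpow_swap1)
  qed
  then have "\<exists>U. decomposes U \<and> U \<subseteq> W \<and> N ` U = N ` W \<and> N ` W \<subseteq> U \<and> (\<forall>q\<in>U. N q = 0 \<longrightarrow> q \<in> N ` W)"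
    using Suc.prems subset_refl by (rule lift_decomposition)
  then obtain U where U: "decomposes U" "U \<subseteq> W" "N ` U = N ` W" by (elim exE conjE)
  show ?case by (rule extend_decomposition[OF U(1,2) Suc.prems(1)]) (simp add: U(3))
qed

end

section \<open>Cyclic blocks of a skew pair\<close>

text \<open>The substitution t -> 2 d - t is the twist that a polynomial in \<open>u\<close>
  undergoes when it passes the operator \<open>s\<close>, see \<open>s_act\<close>.\<close>

definition reflect :: "'a::comm_ring_1 \<Rightarrow> 'a poly \<Rightarrow> 'a poly" where
  "reflect d f = f \<circ>\<^sub>p [:2 * d, - 1:]"

lemma reflect_mult: "reflect d (f * g) = reflect d f * reflect d g"
  by (simp add: reflect_def pcompose_mult)

lemma reflect_add: "reflect d (f + g) = reflect d f + reflect d g"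
  by (simp add: reflect_def pcompose_add)

lemma reflect_diff: "reflect d (f - g) = reflect d f - reflect d g"
  by (simp add: reflect_def pcompose_diff)

lemma reflect_uminus: "reflect d (- f) = - reflect d f"
  by (simp add: reflect_def pcompose_uminus)

lemma reflect_smult: "reflect d (Polynomial.smult c f) = Polynomial.smult c (reflect d f)"
  by (simp add: reflect_def pcompose_smult)

lemma reflect_power: "reflect d (f ^ n) = reflect d f ^ n"
  by (induction n) (simp_all add: reflect_mult, simp add: reflect_def)

lemma reflect_pCons: "reflect d (pCons c f) = [:c:] + [:2 * d, - 1:] * reflect d f"
  by (simp add: reflect_def pcompose_pCons)

lemma reflect_reflect [simp]: "reflect d (reflect d f) = f"
proof -
  have "[:2 * d, - 1:] \<circ>\<^sub>p [:2 * d, - 1:] = [:0, 1:]" by (simp add: pcompose_pCons)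
  then show ?thesis by (simp add: reflect_def flip: pcompose_assoc)
qed

lemma reflect_dvd: "f dvd g \<Longrightarrow> reflect d f dvd reflect d g"
  by (auto elim!: dvdE simp: reflect_mult)

abbreviation block :: "'a::field poly \<Rightarrow> 'a poly \<Rightarrow> 'a mat" where
  "block f g \<equiv> diag_block_mat [companion_mat f, companion_mat g]"

text \<open>These are the blocks of (iii) for \<open>l = t - d\<close> and \<open>q = r\<close>,
  kept abstract because the passage to invariant factors works for any two monic comaximal
  polynomials. For \<open>n = 0\<close> and \<epsilon> = 1 the block is a single
  \<open>companion_mat q\<close>.\<close>

definition paired_blocks :: "'a::field poly \<Rightarrow> 'a poly \<Rightarrow> 'a mat list \<Rightarrow> bool" where
  "paired_blocks l q Bs \<longleftrightarrow> (\<forall>B\<in>set Bs. (\<exists>n \<epsilon>. \<epsilon> \<in> {0, 1} \<and> B = block (q ^ (n + \<epsilon>)) (q ^ n)) \<or>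
     (\<exists>n\<ge>1. B = block (l ^ n) (l ^ n)))"

text \<open>The assumption \<open>s_u\<close> says that \<open>s\<close> anticommutes with u - d,
  written without that operator.\<close>

locale skew = endomorphism scale u + finite_dimensional_vector_space scale Basis
  for scale :: "'a::field \<Rightarrow> 'v::ab_group_add \<Rightarrow> 'v" and u :: "'v \<Rightarrow> 'v" and Basis :: "'v set" +
  fixes s :: "'v \<Rightarrow> 'v" and d \<Delta> :: 'a
  assumes linear_s: "Vector_Spaces.linear scale scale s"
    and s_u: "s (u v) = scale (2 * d) (s v) - u (s v)"
    and s_s: "s (s v) = scale \<Delta> v - act ([:- d, 1:] ^ 2) v"
    and nonsquare: "e * e \<noteq> \<Delta>"
begin

definition \<tau> :: "'a poly" where "\<tau> = [:- d, 1:]"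
definition r :: "'a poly" where "r = \<tau> ^ 2 - [:\<Delta>:]"
abbreviation \<sigma> :: "'a poly \<Rightarrow> 'a poly" where "\<sigma> \<equiv> reflect d"

lemmas s_simps = linear_add[OF linear_s] linear_scale[OF linear_s] linear_zero[OF linear_s]
  linear_minus[OF linear_s] linear_diff[OF linear_s]

lemma \<sigma>_\<tau> [simp]: "\<sigma> \<tau> = - \<tau>"
  by (simp add: reflect_def \<tau>_def pcompose_pCons)

lemma \<sigma>_r [simp]: "\<sigma> r = r"
proof -
  have "\<sigma> r = \<sigma> \<tau> ^ 2 - [:\<Delta>:]"
    by (simp add: r_def reflect_def pcompose_diff pcompose_mult power2_eq_square)
  then show ?thesis by (simp add: r_def)
qed

lemma s_act: "s (act f v) = act (\<sigma> f) (s v)"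
proof (induction f)
  case 0
  then show ?case by (simp add: reflect_def s_simps)
next
  case (pCons a f)
  have "\<sigma> (pCons a f) = [:a:] + [:2 * d, - 1:] * \<sigma> f" by (simp add: reflect_def pcompose_pCons)
  then have "act (\<sigma> (pCons a f)) (s v) =
      scale a (s v) + (scale (2 * d) (act (\<sigma> f) (s v)) - u (act (\<sigma> f) (s v)))"
    by (simp only: act_add act_mult) (simp add: u_simps)
  then show ?case using pCons by (simp add: s_simps s_u)
qed

text \<open>This turns powers of \<open>r\<close> into even powers of \<open>s\<close>, so
  \<open>s\<close> is nilpotent wherever a power of \<open>r\<close> vanishes.\<close>

lemma act_r: "act r v = - s (s v)"
  by (simp add: r_def s_s act_diff \<tau>_def u_simps)

lemma act_r_power: "act (r ^ j) x = scale ((- 1) ^ j) ((s ^^ (2 * j)) x)"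
  by (induction j) (simp_all add: act_mult act_r s_simps)

lemma s_\<tau>: "s (act \<tau> v) = - act \<tau> (s v)"
  by (simp add: s_act act_uminus)

lemma funpow_act: "(act f ^^ n) v = act (f ^ n) v"
  by (induction n) (simp_all add: act_mult)

lemma funpow_s_act: "(s ^^ m) (act f v) = act ((\<sigma> ^^ m) f) ((s ^^ m) v)"
  by (induction m) (simp_all add: s_act)

lemma funpow_s_add: "(s ^^ m) (x + y) = (s ^^ m) x + (s ^^ m) y"
  by (induction m) (simp_all add: s_simps)

lemma funpow_s_zero: "(s ^^ m) 0 = 0"
  by (induction m) (simp_all add: s_simps)

lemma funpow_\<sigma>_dvd: "f dvd g \<Longrightarrow> (\<sigma> ^^ m) f dvd (\<sigma> ^^ m) g"
  by (induction m) (auto elim!: dvdE simp: reflect_mult)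

lemma funpow_\<sigma>_r: "(\<sigma> ^^ m) r = r"
  by (induction m) simp_all

lemma funpow_\<sigma>_\<sigma>: "(\<sigma> ^^ m) ((\<sigma> ^^ m) f) = f"
  by (induction m arbitrary: f) (simp_all add: funpow_swap1)

text \<open>On the kernel of \<tau> the square of \<open>s\<close> is \<Delta>. The relation and its
  image under \<open>s\<close> form a linear system in \<open>y\<close> and \<open>s y\<close> whose
  determinant is, up to sign, the norm \<open>a * a - b * b * \<Delta>\<close>.\<close>

lemma combination_eq_0:
  assumes "y \<noteq> 0" "act \<tau> y = 0" "scale a y + scale b (s y) = 0"
  shows "a = 0" "b = 0"
proof -
  have ss: "s (s y) = scale \<Delta> y"
    using s_s[of y] assms(2) by (simp add: power2_eq_square act_mult flip: \<tau>_def) (simp add: act_simps)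
  have "s (scale a y + scale b (s y)) = 0" using assms(3) by (simp add: s_simps)
  then have 2: "scale a (s y) + scale (b * \<Delta>) y = 0" by (simp add: s_simps ss)
  have "scale a (scale a y + scale b (s y)) - scale b (scale a (s y) + scale (b * \<Delta>) y) = 0"
    using assms(3) 2 by simp
  moreover have "scale a (scale a y + scale b (s y)) - scale b (scale a (s y) + scale (b * \<Delta>) y) =
      scale (a * a - b * b * \<Delta>) y"
    by (simp add: scale_right_distrib scale_left_diff_distrib mult.commute mult.left_commute)
  ultimately have eq: "a * a = b * b * \<Delta>" using assms(1) by simp
  show "b = 0"
  proof (rule ccontr)
    assume "b \<noteq> 0"
    then have "(a / b) * (a / b) = \<Delta>" using eq by (simp add: field_simps)
    then show False using nonsquare by blast
  qed
  then show "a = 0" using eq by simp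
qed

text \<open>A nonzero remainder of degree at most 1 that kills \<open>y\<close> is not constant, so
  it makes \<open>y\<close> an eigenvector. Its eigenvalue is a root of \<open>r\<close>, and
  \<Delta> would be a square.\<close>

lemma r_dvd:
  assumes "y \<noteq> 0" "act r y = 0" "act g y = 0"
  shows "r dvd g"
proof -
  have r_eq: "r = [:d * d - \<Delta>, - 2 * d, 1:]" by (simp add: r_def \<tau>_def power2_eq_square)
  then have deg: "Polynomial.degree r = 2" and r0: "r \<noteq> 0" by auto
  have "act (r * (g div r) + g mod r) y = 0" using assms(3) by simp
  then have 0: "act (g mod r) y = 0"
    by (simp only: act_add act_mult act_commute[of r] assms(2)) (simp add: act_simps)
  show ?thesis
  proof (rule ccontr)
    assume "\<not> r dvd g"
    then have nz: "g mod r \<noteq> 0" by (simp add: mod_eq_0_iff_dvd)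
    then have "Polynomial.degree (g mod r) < 2" using degree_mod_less[OF r0, of g] deg by simp
    then obtain a b where ab: "g mod r = [:a, b:]"
      by (metis degree1_coeffs degree_0_id less_2_cases_iff One_nat_def pCons_0_0)
    then have eq: "scale a y + scale b (u y) = 0" using 0 by (simp add: u_simps)
    show False
    proof (cases "b = 0")
      case True
      then show False using eq assms(1) ab nz by simp
    next
      case False
      have "scale (1 / b) (scale a y + scale b (u y)) = 0" using eq by simp
      then have "u y = scale (- (a / b)) y" using False by (simp add: scale_right_distrib add_eq_0_iff)
      then have "poly r (- (a / b)) = 0"
        using act_eigenvector[of y "- (a / b)" r] assms by simp
      then have "(- (a / b) - d) * (- (a / b) - d) = \<Delta>"
        by (simp add: r_def \<tau>_def power2_eq_square algebra_simps)
      then show False using nonsquare by blast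
    qed
  qed
qed

text \<open>The vectors \<open>v\<close> and \<open>s v\<close> are free generators over
  F[t]/(\<tau>^m). After multiplication by the last nonvanishing power of \<tau>, the coefficients
  act through their values at \<open>d\<close>, which must vanish; one factor \<tau> then passes
  from the coefficients to the vector.\<close>

lemma block_nilpotent:
  assumes "act (\<tau> ^ m) v = 0" "m > 0 \<Longrightarrow> act (\<tau> ^ (m - 1)) v \<noteq> 0" "act g v + act h (s v) = 0"
  shows "\<tau> ^ m dvd g \<and> \<tau> ^ m dvd h"
  using assms
proof (induction m arbitrary: v g h)
  case 0
  then show ?case by simp
next
  case (Suc m)
  define y where "y = act (\<tau> ^ m) v"
  have y: "y \<noteq> 0" "act \<tau> y = 0" using Suc.prems by (simp_all add: y_def act_mult)
  have sy: "act (\<tau> ^ m) (s v) = scale ((- 1) ^ m) (s y)"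
  proof -
    have "s y = act ((- \<tau>) ^ m) (s v)" by (simp add: y_def s_act reflect_power)
    also have "(- \<tau>) ^ m = Polynomial.smult ((- 1) ^ m) (\<tau> ^ m)"
      by (induction m) auto
    finally show ?thesis by (simp add: act_smult flip: power_mult_distrib)
  qed
  have u_y: "u y = scale d y" using y(2) by (simp add: \<tau>_def u_simps)
  have "act \<tau> (s y) = 0" using s_\<tau>[of y] y(2) by (simp add: s_simps)
  then have u_sy: "u (s y) = scale d (s y)" by (simp add: \<tau>_def u_simps)
  have "act (\<tau> ^ m) (act g v + act h (s v)) = act g y + act h (act (\<tau> ^ m) (s v))"
    unfolding y_def by (simp add: act_simps act_commute)
  also have "\<dots> = scale (poly g d) y + scale ((- 1) ^ m * poly h d) (s y)"
    by (simp add: sy act_simps act_eigenvector[OF u_y] act_eigenvector[OF u_sy])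
  finally have eq: "scale (poly g d) y + scale ((- 1) ^ m * poly h d) (s y) = 0"
    using Suc.prems(3) by (simp add: act_simps)
  have "poly g d = 0" "poly h d = 0"
    using combination_eq_0(1)[OF y eq] combination_eq_0(2)[OF y eq] by simp_all
  then obtain g' h' where gh: "g = \<tau> * g'" "h = \<tau> * h'"
    by (auto simp: poly_eq_0_iff_dvd \<tau>_def elim!: dvdE)
  define v' where "v' = act \<tau> v"
  \<comment> \<open>The sign of \<open>h'\<close> changes because \<tau> is moved past
    \<open>s\<close>.\<close>
  have "act g' v' + act (- h') (s v') = act g v + act h (s v)"
    by (simp add: gh v'_def s_\<tau> act_uminus act_simps mult.commute[of \<tau>] act_mult)
  then have "act g' v' + act (- h') (s v') = 0" using Suc.prems(3) by simp
  moreover have "act (\<tau> ^ m) v' = 0"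
    using Suc.prems(1) by (simp add: v'_def mult.commute[of \<tau>] act_mult)
  moreover have "act (\<tau> ^ (m - 1)) v' \<noteq> 0" if m: "m > 0"
  proof -
    have "\<tau> ^ m = \<tau> ^ (m - 1) * \<tau>" using m power_minus_mult[of m \<tau>] by simp
    then have "act (\<tau> ^ (m - 1)) v' = act (\<tau> ^ m) v" by (simp add: v'_def act_mult)
    then show ?thesis using Suc.prems(2) by simp
  qed
  ultimately have "\<tau> ^ m dvd g' \<and> \<tau> ^ m dvd - h'" by (intro Suc.IH)
  then show ?case unfolding gh by (simp add: mult_dvd_mono)
qed

text \<open>Applying the last nonvanishing power of \<open>s\<close> removes the term in
  \<open>s v\<close> and yields \<open>r dvd g\<close>. Since \<open>act r v = - s (s v)\<close>,
  cancelling this factor gives a relation for \<open>s v\<close> with the two coefficients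
  exchanged. This alternation produces the two halves of \<open>m\<close>.\<close>

lemma block_r:
  assumes "(s ^^ m) v = 0" "m > 0 \<Longrightarrow> (s ^^ (m - 1)) v \<noteq> 0" "act g v + act h (s v) = 0"
  shows "r ^ ((m + 1) div 2) dvd g \<and> r ^ (m div 2) dvd h"
  using assms
proof (induction m arbitrary: v g h)
  case 0
  then show ?case by simp
next
  case (Suc m)
  define y where "y = (s ^^ m) v"
  have y: "y \<noteq> 0" "s y = 0" using Suc.prems by (simp_all add: y_def)
  have "(s ^^ m) (s v) = 0" using Suc.prems(1) by (simp add: funpow_swap1)
  then have "(s ^^ m) (act g v + act h (s v)) = act ((\<sigma> ^^ m) g) y"
    by (simp add: funpow_s_add funpow_s_act y_def act_simps)
  then have "act ((\<sigma> ^^ m) g) y = 0" using Suc.prems(3) by (simp add: funpow_s_zero)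
  moreover have "act r y = 0" using y(2) by (simp add: act_r s_simps)
  ultimately have "r dvd (\<sigma> ^^ m) g" using r_dvd y(1) by blast
  \<comment> \<open>The reflections are undone by applying them again, and they fix
    \<open>r\<close>.\<close>
  then have "r dvd g" using funpow_\<sigma>_dvd[of r "(\<sigma> ^^ m) g" m] by (simp add: funpow_\<sigma>_r funpow_\<sigma>_\<sigma>)
  then obtain g' where g: "g = r * g'" by (rule dvdE)
  have "act h (s v) + act (- g') (s (s v)) = 0"
    using Suc.prems(3) by (simp add: g mult.commute[of r] act_mult act_r act_uminus act_simps add.commute)
  moreover have "(s ^^ (m - 1)) (s v) \<noteq> 0" if "m > 0"
    using that Suc.prems(2) by (cases m) (simp_all add: funpow_swap1)
  ultimately have "r ^ ((m + 1) div 2) dvd h \<and> r ^ (m div 2) dvd - g'"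
    using Suc.IH \<open>(s ^^ m) (s v) = 0\<close> by blast
  then show ?case unfolding g by (simp add: mult_dvd_mono)
qed

lemma block_square: "square_mat (block f g)"
  by (rule diag_block_mat_square) (simp del: square_mat.simps add: companion_square)

text \<open>The right-hand side is stable under \<open>s\<close> because \<open>s (s v)\<close> is
  \<open>- act r v\<close>, so \<open>s\<close> exchanges the two terms up to polynomials in
  \<open>u\<close>.\<close>

lemma generated_eq: "generated u s v = {act g v + act h (s v) | g h. True}" (is "_ = ?T")
proof
  note Q = stableD[OF stable_generated[of u s v]] and v = mem_generated[of v u s]
  show "?T \<subseteq> generated u s v"
    using act_mem[OF Q(1,2)] Q(3) v subspace_add[OF Q(1)] by blast
  have TI: "act g v + act h (s v) \<in> ?T" for g h by blast
  have "stable u s ?T" unfolding stable_def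
  proof (intro conjI)
    show "subspace ?T"
    proof (rule subspaceI)
      show "0 \<in> ?T" using TI[of 0 0] by simp
      show "x + y \<in> ?T" if xy: "x \<in> ?T" "y \<in> ?T" for x y
      proof -
        obtain g h g' h' where "x = act g v + act h (s v)" "y = act g' v + act h' (s v)"
          using xy by blast
        then have "x + y = act (g + g') v + act (h + h') (s v)" by (simp add: act_add algebra_simps)
        then show ?thesis using TI by simp
      qed
      show "scale c x \<in> ?T" if x: "x \<in> ?T" for c x
      proof -
        obtain g h where "x = act g v + act h (s v)" using x by blast
        then have "scale c x = act (Polynomial.smult c g) v + act (Polynomial.smult c h) (s v)"
          by (simp add: act_smult scale_right_distrib)
        then show ?thesis using TI by simp
      qed
    qed
    show "u ` ?T \<subseteq> ?T"
    proof clarify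
      fix g h
      have "u (act g v + act h (s v)) = act (pCons 0 g) v + act (pCons 0 h) (s v)"
        by (simp add: u_simps)
      then show "\<exists>g' h'. u (act g v + act h (s v)) = act g' v + act h' (s v) \<and> True" by blast
    qed
    show "s ` ?T \<subseteq> ?T"
    proof clarify
      fix g h
      have "s (act g v + act h (s v)) = act (- (\<sigma> h * r)) v + act (\<sigma> g) (s v)"
        by (simp add: s_simps s_act act_uminus act_mult act_r act_simps)
      then show "\<exists>g' h'. s (act g v + act h (s v)) = act g' v + act h' (s v) \<and> True" by blast
    qed
  qed
  moreover have "v \<in> ?T" using TI[of 1 0] by simp
  ultimately show "generated u s v \<subseteq> ?T" by (rule generated_minimal)
qed

text \<open>The hypothesis \<open>indep\<close> gives both annihilators, by setting one coefficient
  to 0, and also the trivial intersection of the two cyclic subspaces.\<close>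

lemma represented_on_block:
  assumes "lead_coeff f1 = 1" "lead_coeff f2 = 1" "act f1 v = 0" "act f2 (s v) = 0"
    and indep: "\<And>g h. act g v + act h (s v) = 0 \<Longrightarrow> f1 dvd g \<and> f2 dvd h"
  shows "represented_on (generated u s v) (block f1 f2)"
proof -
  have 1: "has_annihilator f1 v"
    by (rule has_annihilatorI[OF assms(3)]) (use indep[where h = 0] in simp)
  have 2: "has_annihilator f2 (s v)"
    by (rule has_annihilatorI[OF assms(4)]) (use indep[where g = 0] in simp)
  have "cyclic v \<inter> cyclic (s v) \<subseteq> {0}"
  proof
    fix x assume "x \<in> cyclic v \<inter> cyclic (s v)"
    then obtain g h where x: "x = act g v" "x = act h (s v)" unfolding cyclic_def by blast
    then have "act g v + act (- h) (s v) = 0" by (simp add: act_uminus)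
    then have "f1 dvd g" using indep by blast
    then show "x \<in> {0}" using x(1) assms(3) act_dvd by simp
  qed
  then have "cyclic v \<inter> cyclic (s v) = {0}"
    using subspace_0[OF subspace_cyclic[of v]] subspace_0[OF subspace_cyclic[of "s v"]] by blast
  moreover have "generated u s v = {x + y | x y. x \<in> cyclic v \<and> y \<in> cyclic (s v)}"
    unfolding generated_eq cyclic_def by blast
  ultimately have ds: "direct_sum (cyclic v) (cyclic (s v)) (generated u s v)"
    by (auto simp: direct_sum_def subspace_cyclic)
  have "represented_on (cyclic v) (companion_mat f1)" "represented_on (cyclic (s v)) (companion_mat f2)"
    using represented_on_companion[OF assms(1)] represented_on_companion[OF assms(2)] 1 2 by blast+
  then have "\<exists>W1 W2. represented_on W1 (companion_mat f1) \<and>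
      represented_on W2 (diag_block_mat [companion_mat f2]) \<and> direct_sum W1 W2 (generated u s v)"
    using ds unfolding diag_block_mat_singleton by blast
  then show ?thesis
    by (subst represented_on_Cons) (simp_all only: companion_square list.set ball_simps simp_thms)
qed

abbreviation good_blocks :: "'a mat list \<Rightarrow> bool" where
  "good_blocks \<equiv> paired_blocks \<tau> r"

lemma good_blocks_square: "good_blocks Bs \<Longrightarrow> Ball (set Bs) square_mat"
  unfolding paired_blocks_def using block_square by metis

lemma monic_\<tau>: "lead_coeff (\<tau> ^ n) = 1"
  by (simp add: \<tau>_def lead_coeff_power)

lemma monic_r: "lead_coeff (r ^ n) = 1"
  by (simp add: r_def \<tau>_def lead_coeff_power power2_eq_square)

lemma represented_on_good_block_Cons:
  assumes "represented_on A B" "square_mat B" "represented_on W' (diag_block_mat Bs)" "good_blocks Bs" "direct_sum A W' W"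
    "good_blocks [B]"
  shows "\<exists>Bs. good_blocks Bs \<and> represented_on W (diag_block_mat Bs)"
proof -
  have "represented_on W (diag_block_mat (B # Bs))"
    using represented_on_Cons[OF assms(2) good_blocks_square[OF assms(4)]] assms by blast
  moreover have "good_blocks (B # Bs)" using assms by (simp add: paired_blocks_def)
  ultimately show ?thesis by blast
qed

lemma stable_commute: "stable f g = stable g f"
  by (rule ext) (auto simp: stable_def)

text \<open>The operators \<open>act \<tau>\<close> and \<open>u\<close> differ by the scalar
  \<open>d\<close>, so summands found for a \<open>skew_pair\<close> are generated by
  \<open>u\<close> and \<open>s\<close>.\<close>

lemma stable_act_\<tau>: "stable (act \<tau>) s = stable u s"
proof (rule ext)
  fix S
  have "act \<tau> x = u x - scale d x" for x by (simp add: \<tau>_def u_simps)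
  then have *: "act \<tau> x \<in> S \<longleftrightarrow> u x \<in> S" if "subspace S" "x \<in> S" for x
    using that subspace_diff[OF that(1)] subspace_add[OF that(1)] subspace_scale[OF that]
    by (metis diff_add_cancel)
  then show "stable (act \<tau>) s S = stable u s S"
    unfolding stable_def by (auto simp: image_subset_iff)
qed

lemma s_s_\<tau>: "s (s v) = scale \<Delta> v - act \<tau> (act \<tau> v)"
  unfolding s_s power2_eq_square \<tau>_def[symmetric] act_mult ..

lemma skew_pair_nil: "skew_pair scale (act \<tau>) Basis s \<Delta>"
proof (intro skew_pair.intro skew_pair_axioms.intro endomorphism.intro endomorphism_axioms.intro)
  show "s (act \<tau> v) = - act \<tau> (s v)" for v by (rule s_\<tau>)
  show "s (s v) = scale \<Delta> v - act \<tau> (act \<tau> v)" for v by (rule s_s_\<tau>)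
qed (rule vector_space_axioms finite_dimensional_vector_space_axioms linear_act linear_s nonsquare)+

text \<open>The same relations, solved for the square of \<open>act \<tau>\<close> instead of the
  square of \<open>s\<close>.\<close>

lemma skew_pair_reg: "skew_pair scale s Basis (act \<tau>) \<Delta>"
proof (intro skew_pair.intro skew_pair_axioms.intro endomorphism.intro endomorphism_axioms.intro)
  show "act \<tau> (s v) = - s (act \<tau> v)" for v by (simp add: s_\<tau>)
  show "act \<tau> (act \<tau> v) = scale \<Delta> v - s (s v)" for v by (simp add: s_s_\<tau>)
qed (rule vector_space_axioms finite_dimensional_vector_space_axioms linear_act linear_s nonsquare)+

interpretation nil: skew_pair scale "act \<tau>" Basis s \<Delta>
  by (rule skew_pair_nil)

interpretation reg: skew_pair scale s Basis "act \<tau>" \<Delta>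
  by (rule skew_pair_reg)

lemma least_power:
  fixes f :: "'v \<Rightarrow> 'v"
  assumes "(f ^^ k) v = 0" "v \<noteq> 0"
  obtains m where "(f ^^ m) v = 0" "(f ^^ (m - 1)) v \<noteq> 0" "m \<ge> 1"
proof -
  define m where "m = (LEAST m. (f ^^ m) v = 0)"
  have 1: "(f ^^ m) v = 0" unfolding m_def using assms(1) by (rule LeastI)
  have 2: "m \<noteq> 0"
  proof
    assume "m = 0"
    then show False using 1 assms(2) by simp
  qed
  then have "(f ^^ (m - 1)) v \<noteq> 0"
    using not_less_Least[of "m - 1" "\<lambda>m. (f ^^ m) v = 0", folded m_def] by simp
  then show ?thesis using 1 2 that by simp
qed

lemma good_blocks_nilpotent:
  assumes "nil.decomposes W" "\<And>v. v \<in> W \<Longrightarrow> act (\<tau> ^ k) v = 0"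
  shows "\<exists>Bs. good_blocks Bs \<and> represented_on W (diag_block_mat Bs)"
  using assms
proof (induction rule: nil.decomposes.induct)
  case zero
  have "represented_on {0} (diag_block_mat [])" using represented_on_Nil by blast
  then show ?case by (intro exI[of _ "[]"]) (simp add: paired_blocks_def)
next
  case (add W' v W)
  have Q: "generated (act \<tau>) s v = generated u s v" by (simp add: generated_def stable_act_\<tau>)
  note sub = direct_sum_subset[OF add.hyps(3)]
  obtain Bs where Bs: "good_blocks Bs" "represented_on W' (diag_block_mat Bs)"
    using add.IH add.prems sub by blast
  have "v \<in> W" using sub(1) mem_generated by blast
  then have "(act \<tau> ^^ k) v = 0" using add.prems by (simp add: funpow_act)
  then obtain m where m: "(act \<tau> ^^ m) v = 0" "(act \<tau> ^^ (m - 1)) v \<noteq> 0" "m \<ge> 1"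
    using add.hyps(2) by (rule least_power)
  \<comment> \<open>Passing \<open>s\<close> turns \<open>\<tau> ^ m\<close> into
    \<open>(- \<tau>) ^ m\<close>, which is associated to it.\<close>
  have 2: "act (\<tau> ^ m) (s v) = 0"
  proof -
    have "(- \<tau>) ^ m dvd \<tau> ^ m" by (simp add: dvd_power_same)
    moreover have "act ((- \<tau>) ^ m) (s v) = s (act (\<tau> ^ m) v)" by (simp add: s_act reflect_power)
    ultimately show ?thesis using m(1) act_dvd by (simp add: funpow_act s_simps)
  qed
  have "represented_on (generated u s v) (block (\<tau> ^ m) (\<tau> ^ m))"
    using represented_on_block[OF monic_\<tau> monic_\<tau> _ 2] m block_nilpotent by (auto simp: funpow_act simp del: diag_block_mat.simps)
  moreover have "good_blocks [block (\<tau> ^ m) (\<tau> ^ m)]" using m(3) by (auto simp: paired_blocks_def simp del: diag_block_mat.simps)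
  ultimately show ?case
    using represented_on_good_block_Cons[OF _ block_square Bs(2,1)] add.hyps(3) Q by metis
qed

lemma good_blocks_r:
  assumes "reg.decomposes W" "\<And>v. v \<in> W \<Longrightarrow> (s ^^ k) v = 0"
  shows "\<exists>Bs. good_blocks Bs \<and> represented_on W (diag_block_mat Bs)"
  using assms
proof (induction rule: reg.decomposes.induct)
  case zero
  have "represented_on {0} (diag_block_mat [])" using represented_on_Nil by blast
  then show ?case by (intro exI[of _ "[]"]) (simp add: paired_blocks_def)
next
  case (add W' v W)
  have Q: "generated s (act \<tau>) v = generated u s v"
    by (simp add: generated_def stable_act_\<tau> stable_commute[of s])
  note sub = direct_sum_subset[OF add.hyps(3)]
  obtain Bs where Bs: "good_blocks Bs" "represented_on W' (diag_block_mat Bs)"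
    using add.IH add.prems sub by blast
  have "(s ^^ k) v = 0" using add.prems sub mem_generated by blast
  then obtain m where m: "(s ^^ m) v = 0" "(s ^^ (m - 1)) v \<noteq> 0" "m \<ge> 1"
    using add.hyps(2) by (rule least_power)
  \<comment> \<open>In a chain of \<open>m = 2 * n + \<epsilon>\<close> steps of \<open>s\<close>,
    the vector \<open>v\<close> is killed by \<open>r ^ (n + \<epsilon>)\<close> and
    \<open>s v\<close> by \<open>r ^ n\<close>.\<close>
  define n \<epsilon> where "n = m div 2" and "\<epsilon> = m mod 2"
  have n: "(m + 1) div 2 = n + \<epsilon>" "\<epsilon> \<in> {0, 1}" unfolding n_def \<epsilon>_def by presburger auto
  have zero: "(s ^^ j) v = 0" if "m \<le> j" for j
    using that m(1) funpow_s_zero by (metis funpow_add le_add_diff_inverse2 comp_apply)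
  have 1: "act (r ^ (n + \<epsilon>)) v = 0"
    using zero[of "2 * (n + \<epsilon>)"] n by (simp add: act_r_power n_def \<epsilon>_def)
  have "(s ^^ (2 * n)) (s v) = (s ^^ (2 * n + 1)) v" by (simp add: funpow_swap1)
  moreover have "m \<le> 2 * n + 1" unfolding n_def by linarith
  ultimately have 2: "act (r ^ n) (s v) = 0" using zero[of "2 * n + 1"] by (simp add: act_r_power)
  have "r ^ (n + \<epsilon>) dvd g \<and> r ^ n dvd h" if "act g v + act h (s v) = 0" for g h
    using block_r[OF m(1) m(2) that] n(1) n_def by simp
  then have "represented_on (generated u s v) (block (r ^ (n + \<epsilon>)) (r ^ n))"
    using represented_on_block[OF monic_r monic_r 1 2] by blast
  moreover have "good_blocks [block (r ^ (n + \<epsilon>)) (r ^ n)]"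
    using n(2) unfolding paired_blocks_def by (auto simp del: diag_block_mat.simps)
  ultimately show ?case
    using represented_on_good_block_Cons[OF _ block_square Bs(2,1)] add.hyps(3) Q by metis
qed

lemma \<tau>_r_comaximal: "comaximal (\<tau> ^ m) (r ^ n)"
proof (rule comaximal_power)
  have "\<Delta> \<noteq> 0" using nonsquare[of 0] by auto
  then show "comaximal \<tau> r" unfolding r_def by (rule comaximal_square_diff)
qed

text \<open>The primary decomposition for the coprime pair \<tau>, \<open>r\<close>. Both kernels
  are stable under \<open>s\<close>, as reflection negates \<tau> and fixes
  \<open>r\<close>.\<close>

theorem exists_good_blocks:
  assumes "\<And>v. act ((\<tau> * r) ^ k) v = 0"
  shows "\<exists>Bs. good_blocks Bs \<and> represented_on UNIV (diag_block_mat Bs)"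
proof -
  define V0 V1 where "V0 = {v. act (\<tau> ^ k) v = 0}" and "V1 = {v. act (r ^ k) v = 0}"
  have sub: "subspace {v. act f v = 0}" for f
    by (rule subspaceI) (simp_all add: act_simps)
  have s0: "s v \<in> V0" if "v \<in> V0" for v
  proof -
    have "(- \<tau>) ^ k dvd \<tau> ^ k" by (simp add: dvd_power_same)
    moreover have "act ((- \<tau>) ^ k) (s v) = s (act (\<tau> ^ k) v)" by (simp add: s_act reflect_power)
    ultimately show ?thesis using that act_dvd by (simp add: V0_def s_simps)
  qed
  have s1: "s v \<in> V1" if "v \<in> V1" for v
  proof -
    have "act (r ^ k) (s v) = s (act (r ^ k) v)" by (simp add: s_act reflect_power)
    then show ?thesis using that by (simp add: V1_def s_simps)
  qed
  have "stable (act \<tau>) s V0" unfolding stable_def V0_def[symmetric]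
    using sub[of "\<tau> ^ k"] s0 act_commute[of "\<tau> ^ k" \<tau>] by (auto simp: V0_def act_simps)
  then have "nil.decomposes V0"
    by (rule nil.decomposition[where k = k]) (simp add: V0_def funpow_act)
  then have "\<exists>Bs. good_blocks Bs \<and> represented_on V0 (diag_block_mat Bs)"
    by (rule good_blocks_nilpotent[where k = k]) (simp add: V0_def)
  then obtain Bs0 where 0: "good_blocks Bs0" "represented_on V0 (diag_block_mat Bs0)"
    by (elim exE conjE)
  \<comment> \<open>On this part \<open>s\<close> is the nilpotent operator, because
    \<open>r ^ k\<close> acts as \<open>s ^^ (2 * k)\<close> up to sign.\<close>
  have s_nil: "(s ^^ (2 * k)) v = 0" if "v \<in> V1" for v
    using that act_r_power[of k v] by (simp add: V1_def)
  have "stable s (act \<tau>) V1" unfolding stable_def V1_def[symmetric]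
    using sub[of "r ^ k"] s1 act_commute[of "r ^ k" \<tau>] by (auto simp: V1_def act_simps)
  then have "reg.decomposes V1"
    by (rule reg.decomposition[where k = "2 * k"]) (rule s_nil)
  then have "\<exists>Bs. good_blocks Bs \<and> represented_on V1 (diag_block_mat Bs)"
    by (rule good_blocks_r) (rule s_nil)
  then obtain Bs1 where 1: "good_blocks Bs1" "represented_on V1 (diag_block_mat Bs1)"
    by (elim exE conjE)
  \<comment> \<open>The Bezout terms \<open>b * r ^ k\<close> and \<open>a * \<tau> ^ k\<close> act
    as the projections onto \<open>V0\<close> and \<open>V1\<close>.\<close>
  obtain a b where ab: "a * \<tau> ^ k + b * r ^ k = 1"
    using \<tau>_r_comaximal[of k k] by (auto simp: comaximal_def)
  then have split: "v = act (b * r ^ k) v + act (a * \<tau> ^ k) v" for v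
    by (metis act_add act_1 add.commute)
  have "v = 0" if "v \<in> V0 \<inter> V1" for v
    using that split[of v] by (simp add: V0_def V1_def act_mult act_simps)
  moreover have "act (b * r ^ k) v \<in> V0" for v
    using assms[of v] act_dvd[of "(\<tau> * r) ^ k" "\<tau> ^ k * (b * r ^ k)" v]
    by (simp add: V0_def power_mult_distrib mult.left_commute flip: act_mult)
  moreover have "act (a * \<tau> ^ k) v \<in> V1" for v
    using assms[of v] act_dvd[of "(\<tau> * r) ^ k" "r ^ k * (a * \<tau> ^ k)" v]
    by (simp add: V1_def power_mult_distrib mult.left_commute mult.commute flip: act_mult)
  moreover have "subspace V0" "subspace V1" using sub by (auto simp: V0_def V1_def)
  moreover from this have "0 \<in> V0" "0 \<in> V1" using subspace_0 by blast+
  ultimately have "V0 \<inter> V1 = {0}" "\<exists>x y. v = x + y \<and> x \<in> V0 \<and> y \<in> V1" for v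
    using split[of v] by blast+
  then have "direct_sum V0 V1 UNIV"
    using sub by (auto simp: direct_sum_def V0_def V1_def)
  then have "represented_on UNIV (diag_block_mat (Bs0 @ Bs1))"
    using represented_on_append[OF good_blocks_square[OF 0(1)] good_blocks_square[OF 1(1)]] 0 1 by blast
  moreover have "good_blocks (Bs0 @ Bs1)" using 0 1 by (auto simp: paired_blocks_def)
  ultimately show ?thesis by blast
qed

end

section \<open>Elementary divisors and invariant factors\<close>

definition flatten_pairs :: "('b \<times> 'b) list \<Rightarrow> 'b list" where
  "flatten_pairs ps = concat (map (\<lambda>(a, b). [a, b]) ps)"

lemma flatten_pairs_simps [simp]:
  "flatten_pairs [] = []" "flatten_pairs ((a, b) # ps) = a # b # flatten_pairs ps"
  "flatten_pairs (ps @ qs) = flatten_pairs ps @ flatten_pairs qs"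
  by (simp_all add: flatten_pairs_def)

lemma length_flatten_pairs [simp]: "length (flatten_pairs ps) = 2 * length ps"
  by (induction ps) auto

lemma nth_flatten_pairs:
  "k < length ps \<Longrightarrow> flatten_pairs ps ! (2 * k) = fst (ps ! k)"
  "k < length ps \<Longrightarrow> flatten_pairs ps ! (2 * k + 1) = snd (ps ! k)"
  by (induction ps arbitrary: k) (auto simp: less_Suc_eq_0_disj)

text \<open>Pairs are inserted as units: sorting the single entries would hide which neighbours are
  close to each other, and that is what the relation between \<open>s (2*k - 1)\<close> and
  \<open>s (2*k)\<close> expresses.\<close>

fun insert_pair :: "nat \<times> nat \<Rightarrow> (nat \<times> nat) list \<Rightarrow> (nat \<times> nat) list" where
  "insert_pair (c, e) [] = [(c, e)]"
| "insert_pair (c, e) ((a, b) # ps) =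
    (if a \<le> e then (c, e) # (a, b) # ps
     else if c \<le> b then (a, b) # insert_pair (c, e) ps
     else (c, a) # insert_pair (b, e) ps)"

lemma mset_insert_pair:
  "mset (flatten_pairs (insert_pair p ps)) = mset (flatten_pairs (p # ps))"
  by (induction p ps rule: insert_pair.induct) auto

text \<open>The exponents of \<open>r\<close> are paired with \<delta> = 1, those of t - d with
  \<delta> = 0.\<close>

abbreviation near_pairs :: "nat \<Rightarrow> (nat \<times> nat) list \<Rightarrow> bool" where
  "near_pairs \<delta> ps \<equiv> \<forall>(a, b)\<in>set ps. b \<le> a \<and> a \<le> b + \<delta>"

text \<open>Two overlapping pairs are both of the form \<open>(n + 1, n)\<close>, and are regrouped as
  \<open>(n + 1, n + 1)\<close> and \<open>(n, n)\<close>.\<close>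

lemma insert_pair_sorted:
  assumes "\<delta> \<le> 1" "near_pairs \<delta> (p # ps)" "sorted_wrt (\<ge>) (flatten_pairs ps)"
  shows "near_pairs \<delta> (insert_pair p ps) \<and> sorted_wrt (\<ge>) (flatten_pairs (insert_pair p ps))"
  using assms
proof (induction p ps rule: insert_pair.induct)
  case (1 c e)
  then show ?case by auto
next
  case (2 c e a b ps)
  have set: "set (flatten_pairs (insert_pair p ps)) = set (flatten_pairs (p # ps))" for p ps
    using mset_insert_pair[of p ps] by (rule mset_eq_setD)
  have *: "e \<le> c" "c \<le> e + \<delta>" "b \<le> a" "a \<le> b + \<delta>" "near_pairs \<delta> ps"
    "sorted_wrt (\<ge>) (flatten_pairs ps)" "\<And>x. x \<in> set (flatten_pairs ps) \<Longrightarrow> x \<le> b"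
    using 2 by auto
  consider "a \<le> e" | "\<not> a \<le> e" "c \<le> b" | "\<not> a \<le> e" "\<not> c \<le> b" by blast
  then show ?case
  proof cases
    case 1
    have "x \<le> a \<and> x \<le> b \<and> x \<le> c \<and> x \<le> e" if "x \<in> set (flatten_pairs ps)" for x
      using *(7)[OF that] * 1 by linarith
    then show ?thesis using 1 * by auto
  next
    case c: 2
    have "near_pairs \<delta> (insert_pair (c, e) ps) \<and> sorted_wrt (\<ge>) (flatten_pairs (insert_pair (c, e) ps))"
      using 2(1)[OF c] * 2(3) by auto
    moreover have "x \<le> a \<and> x \<le> b" if "x \<in> set (flatten_pairs ps)" for x
      using *(7)[OF that] * by linarith
    ultimately show ?thesis using c * by (auto simp: set)
  next
    case c: 3
    \<comment> \<open>The overlap leaves no room: c \<le> e + 1 \<le> a \<le> b + 1 \<le> c.\<close>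
    then have eq: "a = c" "b = e" using * \<open>\<delta> \<le> 1\<close> by linarith+
    have "near_pairs \<delta> (insert_pair (b, e) ps) \<and> sorted_wrt (\<ge>) (flatten_pairs (insert_pair (b, e) ps))"
      using 2(2)[OF c] * 2(3) eq by auto
    moreover have "x \<le> c \<and> x \<le> e" if "x \<in> set (flatten_pairs ps)" for x
      using *(7)[OF that] * eq by linarith
    ultimately show ?thesis using c * eq by (auto simp: set)
  qed
qed

lemma exists_sorted_pairs:
  assumes "\<delta> \<le> 1" "near_pairs \<delta> ps"
  shows "\<exists>qs. near_pairs \<delta> qs \<and> sorted_wrt (\<ge>) (flatten_pairs qs) \<and>
    mset (flatten_pairs qs) = mset (flatten_pairs ps)"
  using assms(2)
proof (induction ps)
  case Nil
  then show ?case by (intro exI[of _ "[]"]) auto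
next
  case (Cons p ps)
  then obtain qs where qs: "near_pairs \<delta> qs" "sorted_wrt (\<ge>) (flatten_pairs qs)"
    "mset (flatten_pairs qs) = mset (flatten_pairs ps)" by auto
  have "near_pairs \<delta> (p # qs)" using Cons.prems qs(1) by auto
  then have "near_pairs \<delta> (insert_pair p qs) \<and> sorted_wrt (\<ge>) (flatten_pairs (insert_pair p qs))"
    using insert_pair_sorted assms(1) qs(2) by blast
  moreover have "mset (flatten_pairs (insert_pair p qs)) = mset (flatten_pairs (p # ps))"
    unfolding mset_insert_pair using qs(3) by (cases p) simp
  ultimately show ?case by blast
qed

text \<open>Exponent 0 stands for the trivial factor 1. The padding makes the two exponent lists
  equally long before their powers are multiplied entry by entry.\<close>

lemma pad_pairs:
  assumes "near_pairs \<delta> ps" "sorted_wrt (\<ge>) (flatten_pairs ps)"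
  shows "near_pairs \<delta> (ps @ replicate k (0, 0))"
    "sorted_wrt (\<ge>) (flatten_pairs (ps @ replicate k (0, 0)))"
    "flatten_pairs (ps @ replicate k (0, 0)) = flatten_pairs ps @ replicate (2 * k) 0"
proof -
  show 3: "flatten_pairs (ps @ replicate k (0, 0)) = flatten_pairs ps @ replicate (2 * k) 0"
    by (induction k) (auto simp: replicate_append_same[symmetric])
  show "near_pairs \<delta> (ps @ replicate k (0, 0))" using assms(1) by auto
  have "sorted_wrt (\<ge>) (replicate n (0::nat))" for n by (induction n) auto
  then show "sorted_wrt (\<ge>) (flatten_pairs (ps @ replicate k (0, 0)))"
    using assms(2) unfolding 3 by (auto simp: sorted_wrt_append)
qed

section \<open>Decompositions into cyclic summands, recorded by their annihilators\<close>

context endomorphism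
begin

text \<open>A multiset without any divisibility condition: it holds elementary divisors and
  invariant factors alike, and summands can be regrouped freely.\<close>

inductive splits :: "'a poly multiset \<Rightarrow> 'v set \<Rightarrow> bool" where
  empty: "splits {#} {0}"
| add: "splits F W' \<Longrightarrow> has_annihilator f v \<Longrightarrow> direct_sum (cyclic v) W' W \<Longrightarrow> splits (add_mset f F) W"

lemma splits_remove:
  assumes "splits (add_mset f F) W"
  shows "\<exists>v W'. has_annihilator f v \<and> splits F W' \<and> direct_sum (cyclic v) W' W"
  using assms
proof (induction "add_mset f F" W arbitrary: F rule: splits.induct)
  case (add G W' g v W)
  show ?case
  proof (cases "f = g")
    case True
    then have "G = F" using add.hyps(5) by simp
    then show ?thesis using add True by blast
  next
    case False
    then obtain F1 where F1: "G = add_mset f F1" "F = add_mset g F1"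
      using add.hyps(5) by (auto simp: add_eq_conv_ex)
    then obtain v' W'' where IH: "has_annihilator f v'" "splits F1 W''" "direct_sum (cyclic v') W'' W'"
      using add.hyps(2) by blast
    obtain E where "direct_sum W'' (cyclic v) E" "direct_sum (cyclic v') E W"
      using direct_sum_assoc[OF IH(3) direct_sum_commute[OF add.hyps(4)]] by blast
    then have "splits F E" unfolding F1(2)
      using splits.add[OF IH(2) add.hyps(3)] direct_sum_commute by blast
    then show ?thesis using IH(1) \<open>direct_sum (cyclic v') E W\<close> by blast
  qed
qed simp

lemma splits_subspace: "splits F W \<Longrightarrow> subspace W"
  by (induction rule: splits.induct) (auto simp: subspace_single_0 direct_sum_subspace)

lemma u_cyclic: "x \<in> cyclic v \<Longrightarrow> u x \<in> cyclic v"
  by (elim cyclicE) (metis act_pCons add_0 cyclicI scale_zero_left)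

lemma splits_stable: "splits F W \<Longrightarrow> x \<in> W \<Longrightarrow> u x \<in> W"
proof (induction arbitrary: x rule: splits.induct)
  case empty
  then show ?case by (simp add: u_simps)
next
  case (add F W' f v W)
  then obtain y z where yz: "y \<in> cyclic v" "z \<in> W'" "x = y + z" by (auto simp: direct_sum_def)
  then have "u y \<in> cyclic v" "u z \<in> W'" "u x = u y + u z" using u_cyclic add.IH by (auto simp: u_simps)
  then show ?case using add.hyps(3) by (auto simp: direct_sum_def)
qed

lemma splits_one:
  assumes "splits F W"
  shows "splits (add_mset 1 F) W"
proof -
  have "has_annihilator 1 0" by (simp add: has_annihilator_def act_simps)
  moreover have "cyclic 0 = {0}" by (auto simp: cyclic_def act_simps)
  then have "direct_sum (cyclic 0) W W" using direct_sum_zero(1) splits_subspace[OF assms] by simp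
  ultimately show ?thesis using assms splits.add by blast
qed

lemma splits_replicate_one: "splits F W \<Longrightarrow> splits (replicate_mset n 1 + F) W"
  by (induction n) (auto intro: splits_one)

text \<open>The Chinese remainder theorem: \<open>v + v'\<close> generates both cyclic subspaces. A
  polynomial that kills the sum kills both vectors, since the summands meet trivially.\<close>

lemma splits_merge:
  assumes "splits (add_mset f (add_mset g F)) W" "comaximal f g"
  shows "splits (add_mset (f * g) F) W"
proof -
  obtain v W' where v: "has_annihilator f v" "splits (add_mset g F) W'" "direct_sum (cyclic v) W' W"
    using splits_remove[OF assms(1)] by blast
  obtain v' W'' where v': "has_annihilator g v'" "splits F W''" "direct_sum (cyclic v') W'' W'"
    using splits_remove[OF v(2)] by blast
  obtain E where E: "direct_sum (cyclic v') (cyclic v) E" "direct_sum W'' E W"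
    using direct_sum_assoc[OF direct_sum_commute[OF v'(3)] direct_sum_commute[OF v(3)]] by blast
  obtain a b where ab: "a * f + b * g = 1" using assms(2) by (auto simp: comaximal_def)
  have fv: "act f v = 0" and gv: "act g v' = 0" using v(1) v'(1) by (simp_all add: has_annihilator_def)
  have "has_annihilator (f * g) (v + v')"
  proof (rule has_annihilatorI)
    have "act (f * g) (v + v') = act g (act f v) + act f (act g v')"
      by (simp add: act_simps act_mult act_commute[of f g v])
    then show "act (f * g) (v + v') = 0" by (simp add: fv gv act_simps)
    fix h assume "act h (v + v') = 0"
    then have "act h v = - act h v'" by (simp add: act_simps eq_neg_iff_add_eq_0)
    then have "act h v = act (- h) v'" by (simp add: act_uminus)
    then have "act h v \<in> cyclic v' \<inter> cyclic v" using cyclicI[of h v] cyclicI[of "- h" v'] by simp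
    then have "act h v = 0" using E(1) unfolding direct_sum_def by blast
    moreover from this have "act h v' = 0" using \<open>act h v = - act h v'\<close> by simp
    ultimately have "f dvd h" "g dvd h" using v(1) v'(1) by (simp_all add: has_annihilator_def)
    then show "f * g dvd h" by (rule comaximal_dvd_mult[OF assms(2)])
  qed
  moreover have "E = cyclic (v + v')"
  proof
    show "cyclic (v + v') \<subseteq> E"
    proof
      fix x assume "x \<in> cyclic (v + v')"
      then obtain h where "x = act h v' + act h v" by (elim cyclicE) (simp add: act_simps add.commute)
      then show "x \<in> E" using E(1) cyclicI by (auto simp: direct_sum_def)
    qed
    show "E \<subseteq> cyclic (v + v')"
    proof
      fix x assume "x \<in> E"
      then obtain h k where x: "x = act h v' + act k v"
        using E(1) by (auto simp: direct_sum_def cyclic_def)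
      \<comment> \<open>The two Bezout terms single out \<open>v\<close> and \<open>v'\<close> from
        \<open>v + v'\<close>.\<close>
      have v_eq: "act (b * g) v = v" using ab fv
        by (metis act_1 act_add act_mult act_simps(3) add_0)
      have v'_eq: "act (a * f) v' = v'" using ab gv
        by (metis act_1 act_add act_mult act_simps(3) add.right_neutral)
      have "act (h * (a * f) + k * (b * g)) (v + v') =
          act h (act (a * f) v' + act a (act f v)) + act k (act (b * g) v + act b (act g v'))"
        by (simp add: act_add act_mult act_simps add.commute add.left_commute)
      also have "\<dots> = x" using x by (simp add: v_eq v'_eq fv gv act_simps)
      finally show "x \<in> cyclic (v + v')" by (metis cyclicI)
    qed
  qed
  ultimately show ?thesis using splits.add[OF v'(2)] direct_sum_commute[OF E(2)] by blast
qed

lemma splits_merge_lists: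
  assumes "length xs = length ys" "\<And>x y. x \<in> set xs \<Longrightarrow> y \<in> set ys \<Longrightarrow> comaximal x y"
    "splits (mset xs + mset ys + F) W"
  shows "splits (mset (map2 (*) xs ys) + F) W"
  using assms
proof (induction xs ys arbitrary: F rule: list_induct2)
  case Nil
  then show ?case by simp
next
  case (Cons x xs y ys)
  have "splits (add_mset x (add_mset y (mset xs + mset ys + F))) W"
    using Cons.prems(2) by (simp add: add_mset_commute)
  then have "splits (mset xs + mset ys + add_mset (x * y) F) W"
    using splits_merge Cons.prems(1) by fastforce
  then have "splits (mset (map2 (*) xs ys) + add_mset (x * y) F) W"
    using Cons.IH Cons.prems(1) by fastforce
  then show ?case by simp
qed

lemma splits_append:
  assumes "splits F A" "splits G B" "direct_sum A B W"
  shows "splits (F + G) W"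
  using assms(1,3)
proof (induction arbitrary: W rule: splits.induct)
  case empty
  then have "W = B" by (auto simp: direct_sum_def)
  then show ?case using assms(2) by simp
next
  case (add F W' f v A)
  obtain E where E: "direct_sum W' B E" "direct_sum (cyclic v) E W"
    using direct_sum_assoc[OF add.hyps(3) add.prems] by blast
  show ?case using splits.add[OF add.IH[OF E(1)] add.hyps(2) E(2)] by simp
qed

lemma splits_iff_represented:
  assumes "\<And>f. f \<in> set fs \<Longrightarrow> lead_coeff f = 1"
  shows "represented_on W (diag_block_mat (map companion_mat fs)) \<longleftrightarrow> splits (mset fs) W"
  using assms
proof (induction fs arbitrary: W)
  case Nil
  have "splits {#} W \<longleftrightarrow> W = {0}" by (auto elim: splits.cases intro: splits.empty)
  then show ?case using represented_on_Nil by simp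
next
  case (Cons f fs)
  have sq: "Ball (set (map companion_mat fs)) square_mat"
    using companion_square by auto
  have "represented_on W (diag_block_mat (map companion_mat (f # fs))) \<longleftrightarrow>
      (\<exists>W1 W2. represented_on W1 (companion_mat f) \<and>
        represented_on W2 (diag_block_mat (map companion_mat fs)) \<and> direct_sum W1 W2 W)"
    unfolding list.map by (rule represented_on_Cons[OF companion_square sq])
  also have "\<dots> \<longleftrightarrow> (\<exists>v W2. has_annihilator f v \<and> splits (mset fs) W2 \<and> direct_sum (cyclic v) W2 W)"
    using Cons by (auto simp: represented_on_companion)
  also have "\<dots> \<longleftrightarrow> splits (mset (f # fs)) W"
    using splits_remove splits.add by auto
  finally show ?case .
qed

lemma splits_has_annihilator: "splits F W \<Longrightarrow> f \<in># F \<Longrightarrow> \<exists>v. has_annihilator f v"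
  by (induction rule: splits.induct) auto

lemma splits_annihilated: "splits F W \<Longrightarrow> (\<And>f. f \<in># F \<Longrightarrow> f dvd m) \<Longrightarrow> x \<in> W \<Longrightarrow> act m x = 0"
proof (induction arbitrary: x rule: splits.induct)
  case empty
  then show ?case by (simp add: act_simps)
next
  case (add F W' f v W)
  obtain g z where x: "x = act g v + z" "z \<in> W'"
    using add.prems(2) add.hyps(3) by (auto simp: direct_sum_def cyclic_def)
  have "act m v = 0" using add.prems(1)[of f] add.hyps(2) by (simp add: has_annihilator_def)
  then have "act m (act g v) = 0" by (simp add: act_commute[of m] act_simps)
  moreover have "act m z = 0" using add.IH add.prems(1) x(2) by auto
  ultimately show ?case by (simp add: x(1) act_simps)
qed

text \<open>A common multiple of the annihilators that is itself one of them. The alternative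
  \<open>m = 1\<close> covers the zero space, whose multiset may be empty.\<close>

lemma minimal_polynomial_splits:
  assumes "splits F UNIV" "\<And>f. f \<in># F \<Longrightarrow> f dvd m" "lead_coeff m = 1" "m \<in># F \<or> m = 1"
  shows "minimal_polynomial scale u = m" "annihilates scale m u"
proof -
  show ann: "annihilates scale m u"
    using splits_annihilated[OF assms(1,2)] by (simp add: annihilates_def)
  have dvd: "m dvd f" if f: "annihilates scale f u" for f
  proof (cases "m = 1")
    case False
    then obtain v where v: "has_annihilator m v" using splits_has_annihilator assms(1,4) by blast
    have "act f v = 0" using f by (simp add: annihilates_def)
    then show ?thesis using v by (simp add: has_annihilator_def)
  qed simp
  show "minimal_polynomial scale u = m"
    unfolding minimal_polynomial_def
  proof (rule the_equality)
    show "lead_coeff m = 1 \<and> annihilates scale m u \<and> (\<forall>f. annihilates scale f u \<longrightarrow> m dvd f)"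
      using ann dvd assms(3) by blast
    fix m' assume "lead_coeff m' = 1 \<and> annihilates scale m' u \<and> (\<forall>f. annihilates scale f u \<longrightarrow> m' dvd f)"
    then show "m' = m" using ann dvd assms(3) poly_dvd_antisym[of m' m] by auto
  qed
qed

lemma splits_paired_blocks:
  assumes l: "lead_coeff l = 1" and q: "lead_coeff q = 1"
    and "represented_on W (diag_block_mat Bs)" "paired_blocks l q Bs"
  shows "\<exists>ps ts. near_pairs 1 ps \<and> near_pairs 0 ts \<and>
    splits (mset (map ((^) q) (flatten_pairs ps)) + mset (map ((^) l) (flatten_pairs ts))) W"
  using assms(3,4)
proof (induction Bs arbitrary: W)
  case Nil
  then have "W = {0}" using represented_on_Nil by blast
  then show ?case by (intro exI[of _ "[]"]) (simp add: splits.empty)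
next
  case (Cons B Bs)
  have monic: "lead_coeff (l ^ n) = 1" "lead_coeff (q ^ n) = 1" for n
    using l q by (simp_all add: lead_coeff_power)
  have sq: "square_mat B'" if "B' \<in> set (B # Bs)" for B'
  proof -
    have "\<exists>f g. B' = block f g" using Cons.prems(2) that unfolding paired_blocks_def by blast
    then show ?thesis using diag_block_mat_square companion_square
      by (metis (no_types, lifting) empty_iff empty_set set_ConsD)
  qed
  then obtain W1 W2 where W: "represented_on W1 B" "represented_on W2 (diag_block_mat Bs)" "direct_sum W1 W2 W"
    using represented_on_Cons[of B Bs W] Cons.prems(1) by auto
  have "paired_blocks l q Bs" using Cons.prems(2) by (simp add: paired_blocks_def)
  then obtain ps ts where IH: "near_pairs 1 ps" "near_pairs 0 ts"
    "splits (mset (map ((^) q) (flatten_pairs ps)) + mset (map ((^) l) (flatten_pairs ts))) W2"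
    using Cons.IH[OF W(2)] by blast
  have block: "splits {#f, g#} W1" if "B = block f g" "lead_coeff f = 1" "lead_coeff g = 1" for f g
    using splits_iff_represented[of "[f, g]" W1] W(1) that by auto
  consider n \<epsilon> where "\<epsilon> \<in> {0, 1}" "B = block (q ^ (n + \<epsilon>)) (q ^ n)" | n where "B = block (l ^ n) (l ^ n)"
    using Cons.prems(2) by (auto simp: paired_blocks_def simp del: diag_block_mat.simps)
  then show ?case
  proof cases
    case 1
    have "splits {#q ^ (n + \<epsilon>), q ^ n#} W1" using block 1(2) monic by blast
    from splits_append[OF this IH(3) W(3)]
    have "splits (mset (map ((^) q) (flatten_pairs ((n + \<epsilon>, n) # ps))) + mset (map ((^) l) (flatten_pairs ts))) W"
      by simp
    moreover have "near_pairs 1 ((n + \<epsilon>, n) # ps)" using IH(1) 1(1) by auto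
    ultimately show ?thesis using IH(2) by blast
  next
    case 2
    have "splits {#l ^ n, l ^ n#} W1" using block 2 monic by blast
    from splits_append[OF this IH(3) W(3)]
    have "splits (mset (map ((^) q) (flatten_pairs ps)) + mset (map ((^) l) (flatten_pairs ((n, n) # ts)))) W"
      by simp
    moreover have "near_pairs 0 ((n, n) # ts)" using IH(2) by auto
    ultimately show ?thesis using IH(1) by blast
  qed
qed

text \<open>Elementary divisors become invariant factors by multiplying, position by position, the
  descending powers of \<open>l\<close> and of \<open>q\<close>. Within a pair the exponents of
  \<open>l\<close> agree and those of \<open>q\<close> differ by at most 1.\<close>

theorem invariant_factors_paired_blocks:
  assumes l: "lead_coeff l = 1" and q: "lead_coeff q = 1" and "comaximal l q"
    and "represented_on UNIV (diag_block_mat Bs)" "paired_blocks l q Bs"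
  shows "(\<exists>a b. minimal_polynomial scale u = l ^ a * q ^ b) \<and>
    (\<exists>s. invariant_factors scale u s \<and> (\<forall>k\<ge>1. s (2*k - 1) = s (2*k) \<or> s (2*k - 1) = q * s (2*k)))"
proof -
  obtain ps ts where "near_pairs 1 ps" "near_pairs 0 ts"
    and sp: "splits (mset (map ((^) q) (flatten_pairs ps)) + mset (map ((^) l) (flatten_pairs ts))) UNIV"
    using splits_paired_blocks[OF l q assms(4,5)] by blast
  then obtain ps' ts' where
    ps': "near_pairs 1 ps'" "sorted_wrt (\<ge>) (flatten_pairs ps')" "mset (flatten_pairs ps') = mset (flatten_pairs ps)" and
    ts': "near_pairs 0 ts'" "sorted_wrt (\<ge>) (flatten_pairs ts')" "mset (flatten_pairs ts') = mset (flatten_pairs ts)"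
    using exists_sorted_pairs[of 1 ps] exists_sorted_pairs[of 0 ts] by auto
  define M where "M = max (length ps') (length ts')"
  define ps2 where "ps2 = ps' @ replicate (M - length ps') (0, 0)"
  define ts2 where "ts2 = ts' @ replicate (M - length ts') (0, 0)"
  note p2 = pad_pairs[OF ps'(1,2), of "M - length ps'", folded ps2_def]
  note t2 = pad_pairs[OF ts'(1,2), of "M - length ts'", folded ts2_def]
  have len: "length ps2 = M" "length ts2 = M" by (auto simp: ps2_def ts2_def M_def)
  define \<alpha> \<nu> where "\<alpha> = flatten_pairs ps2" and "\<nu> = flatten_pairs ts2"
  have len\<alpha>: "length \<alpha> = 2 * M" "length \<nu> = 2 * M" using len by (simp_all add: \<alpha>_def \<nu>_def)
  have pow_mset: "mset (map ((^) x) ys) = image_mset ((^) x) (mset ys)" for x :: "'a poly" and ys by simp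
  have padded: "mset (map ((^) q) \<alpha>) = mset (map ((^) q) (flatten_pairs ps)) + replicate_mset (2 * (M - length ps')) 1"
    "mset (map ((^) l) \<nu>) = mset (map ((^) l) (flatten_pairs ts)) + replicate_mset (2 * (M - length ts')) 1"
    unfolding \<alpha>_def \<nu>_def p2(3) t2(3) using ps'(3) ts'(3) by (simp_all add: pow_mset del: mset_map)
  have eq: "mset (map ((^) l) \<nu>) + mset (map ((^) q) \<alpha>) + {#} =
      replicate_mset (2 * (M - length ps') + 2 * (M - length ts')) 1 +
      (mset (map ((^) q) (flatten_pairs ps)) + mset (map ((^) l) (flatten_pairs ts)))"
    unfolding padded by (auto simp: multiset_eq_iff)
  define fs where "fs = map2 (*) (map ((^) l) \<nu>) (map ((^) q) \<alpha>)"
  have "splits (mset fs + {#}) UNIV" unfolding fs_def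
  proof (rule splits_merge_lists)
    show "comaximal x y" if "x \<in> set (map ((^) l) \<nu>)" "y \<in> set (map ((^) q) \<alpha>)" for x y
      using that comaximal_power[OF assms(3)] by auto
    show "splits (mset (map ((^) l) \<nu>) + mset (map ((^) q) \<alpha>) + {#}) UNIV"
      unfolding eq using sp by (rule splits_replicate_one)
  qed (simp add: len\<alpha>)
  then have sp_fs: "splits (mset fs) UNIV" by simp
  have len_fs: "length fs = 2 * M" using len\<alpha> by (simp add: fs_def)
  have fs_nth: "fs ! i = l ^ (\<nu> ! i) * q ^ (\<alpha> ! i)" if "i < 2 * M" for i
    using that len\<alpha> by (simp add: fs_def)
  have monic: "lead_coeff (l ^ a * q ^ b) = 1" for a b
    using l q by (simp add: lead_coeff_mult lead_coeff_power)
  have monic_fs: "lead_coeff f = 1" if "f \<in> set fs" for f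
    using that fs_nth len_fs monic by (metis in_set_conv_nth)
  have dvd: "fs ! j dvd fs ! i" if "i < j" "j < 2 * M" for i j
  proof -
    have "\<nu> ! j \<le> \<nu> ! i" "\<alpha> ! j \<le> \<alpha> ! i"
      using p2(2) t2(2) that len\<alpha> by (auto simp: sorted_wrt_iff_nth_less \<alpha>_def \<nu>_def)
    then show ?thesis using that fs_nth by (simp add: mult_dvd_mono le_imp_power_dvd)
  qed
  \<comment> \<open>The list \<open>fs\<close> counts from 0 and the invariant factors from 1;
    beyond position \<open>2 * M\<close> they are 1.\<close>
  define s where "s i = (if 1 \<le> i \<and> i \<le> 2 * M then fs ! (i - 1) else 1)" for i
  have "map (\<lambda>i. companion_mat (s i)) [1..<2 * M + 1] = map companion_mat fs"
    by (rule nth_equalityI) (auto simp: len_fs s_def simp del: upt_Suc)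
  moreover have "represented_on UNIV (diag_block_mat (map companion_mat fs))"
    using splits_iff_represented[of fs UNIV] monic_fs sp_fs by blast
  moreover have "lead_coeff (s i) = 1 \<and> s (i + 1) dvd s i" if "1 \<le> i" for i
  proof -
    have "lead_coeff (s i) = 1" using monic_fs len_fs by (auto simp: s_def)
    moreover have "s (i + 1) dvd s i" using that dvd[of "i - 1" i] by (auto simp: s_def)
    ultimately show ?thesis by blast
  qed
  ultimately have "invariant_factors scale u s"
    unfolding invariant_factors_def represented_by_iff
    by (intro conjI exI[of _ "2 * M"]) (auto simp: s_def)
  moreover have "s (2*k - 1) = s (2*k) \<or> s (2*k - 1) = q * s (2*k)" if k: "k \<ge> 1" for k
  proof (cases "k \<le> M")
    case True
    \<comment> \<open>The factors \<open>s (2*k - 1)\<close> and \<open>s (2*k)\<close> are the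
      entries \<open>2 * j\<close> and \<open>2 * j + 1\<close> of \<open>fs\<close>, built from
      pair number \<open>j\<close> of each exponent list.\<close>
    define j where "j = k - 1"
    have j: "j < M" "2 * k - 1 = 2 * j + 1" "2 * k = 2 * j + 2" using True k by (auto simp: j_def)
    obtain a b where ab: "ps2 ! j = (a, b)" by fastforce
    obtain n n' where n: "ts2 ! j = (n, n')" by fastforce
    have "(a, b) \<in> set ps2" "(n, n') \<in> set ts2" using ab n j(1) len by (metis nth_mem)+
    then have "b \<le> a \<and> a \<le> b + 1" "n = n'" using p2(1) t2(1) by auto
    then have *: "a = b \<or> a = Suc b" "n = n'" by auto
    have "s (2*k - 1) = l ^ n * q ^ a" "s (2*k) = l ^ n' * q ^ b"
      using j fs_nth[of "2 * j"] fs_nth[of "2 * j + 1"] nth_flatten_pairs[of j ps2] nth_flatten_pairs[of j ts2]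
      by (auto simp: s_def \<alpha>_def \<nu>_def len ab n)
    then show ?thesis using * by (auto simp: ac_simps)
  next
    case False
    then have "\<not> 2 * k - 1 \<le> 2 * M" "\<not> 2 * k \<le> 2 * M" by linarith+
    then show ?thesis by (simp add: s_def)
  qed
  moreover have "\<exists>a b. minimal_polynomial scale u = l ^ a * q ^ b"
  proof (cases "M = 0")
    case True
    then have "fs = []" using len_fs by simp
    then have "minimal_polynomial scale u = 1" using sp_fs by (intro minimal_polynomial_splits(1)) auto
    then show ?thesis by (intro exI[of _ 0]) simp
  next
    case False
    have "f dvd fs ! 0" if "f \<in># mset fs" for f
      using that dvd[of 0] len_fs by (metis dvd_refl gr0I in_set_conv_nth set_mset_mset)
    moreover have "fs ! 0 \<in> set fs" using len_fs False by simp
    ultimately have "minimal_polynomial scale u = fs ! 0"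
      using sp_fs monic_fs by (intro minimal_polynomial_splits(1)) auto
    then show ?thesis using fs_nth[of 0] False by auto
  qed
  ultimately show ?thesis by blast
qed

text \<open>For generators \<open>v\<close>, \<open>v'\<close> with annihilators \<open>f\<close>,
  \<open>g\<close>, the operator sends \<open>v\<close> to \<open>v'\<close> and \<open>v'\<close>
  to \<open>- act q v\<close>, and it twists the polynomials in front of them. The two divisibility
  hypotheses make this well defined. Its laws are stated on \<open>W\<close> alone because it is
  built summand by summand.\<close>

lemma splits_reflection:
  assumes "splits (mset (flatten_pairs ps)) W" "reflect d q = q"
    "\<And>f g. (f, g) \<in> set ps \<Longrightarrow> g dvd reflect d f \<and> f dvd q * reflect d g"
  shows "\<exists>s. (\<forall>x\<in>W. s x \<in> W) \<and> (\<forall>x\<in>W. \<forall>y\<in>W. s (x + y) = s x + s y) \<and>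
    (\<forall>c. \<forall>x\<in>W. s (scale c x) = scale c (s x)) \<and>
    (\<forall>x\<in>W. s (u x) = scale (2 * d) (s x) - u (s x)) \<and> (\<forall>x\<in>W. s (s x) = - act q x)"
  using assms(1,3)
proof (induction ps arbitrary: W)
  case Nil
  then have "splits {#} W" by simp
  then have "W = {0}" by (cases rule: splits.cases) auto
  then show ?case by (intro exI[of _ "\<lambda>x. x"]) (simp add: u_simps act_simps)
next
  case (Cons p ps)
  obtain f g where p: "p = (f, g)" by fastforce
  have fg: "g dvd reflect d f" "f dvd q * reflect d g" using Cons.prems(2) p by auto
  have "splits (add_mset f (add_mset g (mset (flatten_pairs ps)))) W"
    using Cons.prems(1) p by simp
  then obtain v W1 where v: "has_annihilator f v" "splits (add_mset g (mset (flatten_pairs ps))) W1"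
    "direct_sum (cyclic v) W1 W" using splits_remove by blast
  obtain v' W2 where v': "has_annihilator g v'" "splits (mset (flatten_pairs ps)) W2"
    "direct_sum (cyclic v') W2 W1" using splits_remove[OF v(2)] by blast
  have "\<exists>s. (\<forall>x\<in>W2. s x \<in> W2) \<and> (\<forall>x\<in>W2. \<forall>y\<in>W2. s (x + y) = s x + s y) \<and>
    (\<forall>c. \<forall>x\<in>W2. s (scale c x) = scale c (s x)) \<and>
    (\<forall>x\<in>W2. s (u x) = scale (2 * d) (s x) - u (s x)) \<and> (\<forall>x\<in>W2. s (s x) = - act q x)"
    by (rule Cons.IH[OF v'(2)]) (use Cons.prems(2) in auto)
  then obtain t where t: "\<forall>x\<in>W2. t x \<in> W2" "\<forall>x\<in>W2. \<forall>y\<in>W2. t (x + y) = t x + t y"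
    "\<forall>c. \<forall>x\<in>W2. t (scale c x) = scale c (t x)"
    "\<forall>x\<in>W2. t (u x) = scale (2 * d) (t x) - u (t x)" "\<forall>x\<in>W2. t (t x) = - act q x"
    by (elim exE conjE)
  note t = t[rule_format]
  have W2: "subspace W2" using splits_subspace v'(2) .
  have elem: "\<exists>a b z. z \<in> W2 \<and> x = act a v + (act b v' + z)" if "x \<in> W" for x
    using that v(3) v'(3) unfolding direct_sum_def cyclic_def by blast
  have elem_W: "act a v + (act b v' + z) \<in> W" if "z \<in> W2" for a b z
    using that v(3) v'(3) unfolding direct_sum_def cyclic_def by blast
  define img where "img a b z = act (reflect d a) v' - act (q * reflect d b) v + t z" for a b z
  \<comment> \<open>The coefficient \<open>a\<close> is determined modulo \<open>f\<close> and
    \<open>b\<close> modulo \<open>g\<close>; the twist turns these ambiguities into multiples of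
    \<open>g\<close> and, after the factor \<open>q\<close>, of \<open>f\<close>.\<close>
  have unique: "img a b z = img a' b' z'"
    if z: "z \<in> W2" "z' \<in> W2" and eq: "act a v + (act b v' + z) = act a' v + (act b' v' + z')" for a b z a' b' z'
  proof -
    have mem: "act b v' + z \<in> W1" "act b' v' + z' \<in> W1"
      using z v'(3) unfolding direct_sum_def cyclic_def by blast+
    have 1: "act a v = act a' v" "act b v' + z = act b' v' + z'"
      using direct_sum_unique[OF v(3) cyclicI cyclicI mem eq] by blast+
    have 2: "act b v' = act b' v'" "z = z'"
      using direct_sum_unique[OF v'(3) cyclicI cyclicI z 1(2)] by blast+
    have "act (a - a') v = 0" "act (b - b') v' = 0" using 1(1) 2(1) by (simp_all add: act_diff)
    then have "f dvd a - a'" "g dvd b - b'" using v(1) v'(1) unfolding has_annihilator_def by blast+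
    then have "reflect d f dvd reflect d a - reflect d a'" "reflect d g dvd reflect d b - reflect d b'"
      using reflect_dvd by (metis reflect_diff)+
    then have "g dvd reflect d a - reflect d a'" "f dvd q * (reflect d b - reflect d b')"
      using fg by (meson dvd_trans dvd_refl mult_dvd_mono)+
    then have "act (reflect d a - reflect d a') v' = 0" "act (q * (reflect d b - reflect d b')) v = 0"
      using v(1) v'(1) unfolding has_annihilator_def by blast+
    then show ?thesis using 2(2) by (simp add: img_def act_diff right_diff_distrib)
  qed
  define s where "s x = (SOME y. \<exists>a b z. z \<in> W2 \<and> x = act a v + (act b v' + z) \<and> y = img a b z)" for x
  have s: "s (act a v + (act b v' + z)) = img a b z" if "z \<in> W2" for a b z
    unfolding s_def
  proof (rule some_equality)
    show "\<exists>a' b' z'. z' \<in> W2 \<and> act a v + (act b v' + z) = act a' v + (act b' v' + z') \<and> img a b z = img a' b' z'"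
      using that by blast
    show "y = img a b z"
      if "\<exists>a' b' z'. z' \<in> W2 \<and> act a v + (act b v' + z) = act a' v + (act b' v' + z') \<and> y = img a' b' z'" for y
      using that unique \<open>z \<in> W2\<close> by metis
  qed
  \<comment> \<open>The value is brought into the form of an element of \<open>W\<close>, so that
    \<open>s\<close> can be applied a second time.\<close>
  have img: "img a b z = act (- (q * reflect d b)) v + (act (reflect d a) v' + t z)" for a b z
    by (simp add: img_def act_uminus)
  have s_W: "s x \<in> W" if "x \<in> W" for x
    using elem[OF that] s img elem_W t(1) by metis
  have s_add: "s (x + y) = s x + s y" if xy: "x \<in> W" "y \<in> W" for x y
  proof -
    obtain a b z a' b' z' where *: "z \<in> W2" "x = act a v + (act b v' + z)"
      "z' \<in> W2" "y = act a' v + (act b' v' + z')" using elem xy by metis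
    have eq: "x + y = act (a + a') v + (act (b + b') v' + (z + z'))" by (simp add: * act_add algebra_simps)
    have "s (x + y) = img (a + a') (b + b') (z + z')"
      unfolding eq by (rule s[OF subspace_add[OF W2 *(1,3)]])
    also have "\<dots> = img a b z + img a' b' z'"
      using * by (simp add: img_def act_add act_mult act_simps reflect_add t(2) algebra_simps)
    also have "img a b z = s x" unfolding *(2) by (rule s[OF *(1), symmetric])
    also have "img a' b' z' = s y" unfolding *(4) by (rule s[OF *(3), symmetric])
    finally show ?thesis .
  qed
  have s_scale: "s (scale c x) = scale c (s x)" if x: "x \<in> W" for c x
  proof -
    obtain a b z where *: "z \<in> W2" "x = act a v + (act b v' + z)" using elem x by metis
    have eq: "scale c x = act (Polynomial.smult c a) v + (act (Polynomial.smult c b) v' + scale c z)"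
      by (simp add: * act_smult scale_right_distrib)
    have "s (scale c x) = img (Polynomial.smult c a) (Polynomial.smult c b) (scale c z)"
      unfolding eq by (rule s[OF subspace_scale[OF W2 *(1)]])
    also have "\<dots> = scale c (img a b z)"
      using * by (simp add: img_def act_smult act_mult reflect_smult t(3) scale_right_distrib scale_right_diff_distrib act_simps)
    also have "img a b z = s x" unfolding *(2) by (rule s[OF *(1), symmetric])
    finally show ?thesis .
  qed
  have s_u: "s (u x) = scale (2 * d) (s x) - u (s x)" if x: "x \<in> W" for x
  proof -
    obtain a b z where *: "z \<in> W2" "x = act a v + (act b v' + z)" using elem x by metis
    have eq: "u x = act (pCons 0 a) v + (act (pCons 0 b) v' + u z)"
      by (simp add: * u_simps)
    have "s (u x) = img (pCons 0 a) (pCons 0 b) (u z)"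
      unfolding eq by (rule s[OF splits_stable[OF v'(2) *(1)]])
    also have "\<dots> = scale (2 * d) (img a b z) - u (img a b z)"
      using * by (simp add: img_def reflect_pCons act_add act_diff act_smult act_mult act_uminus act_simps t(4) u_simps act_u
          scale_right_distrib scale_right_diff_distrib algebra_simps)
    also have "img a b z = s x" unfolding *(2) by (rule s[OF *(1), symmetric])
    finally show ?thesis .
  qed
  have s_s: "s (s x) = - act q x" if x: "x \<in> W" for x
  proof -
    obtain a b z where *: "z \<in> W2" "x = act a v + (act b v' + z)" using elem x by metis
    \<comment> \<open>Two twists cancel and \<open>q\<close> is fixed by the twist, which leaves the
      factor \<open>- q\<close>.\<close>
    have "s (s x) = img (- (q * reflect d b)) (reflect d a) (t z)"
      unfolding *(2) s[OF *(1)] img[of a b z] by (rule s[OF t(1)[OF *(1)]])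
    also have "\<dots> = - act q x"
      using * assms(2) by (simp add: img_def reflect_uminus reflect_mult act_uminus act_mult act_simps t(5) act_commute[of q] algebra_simps)
    finally show ?thesis .
  qed
  show ?case using s_W s_add s_scale s_u s_s by blast
qed

lemma exists_reflection:
  assumes "invariant_factors scale u s" "\<And>k. k \<ge> 1 \<Longrightarrow> s (2*k - 1) = s (2*k) \<or> s (2*k - 1) = q * s (2*k)"
    and "reflect d q = q" "\<And>i. i \<ge> 1 \<Longrightarrow> s i dvd reflect d (s i)"
  shows "\<exists>t. Vector_Spaces.linear scale scale t \<and> (\<forall>x. t (u x) = scale (2 * d) (t x) - u (t x)) \<and>
    (\<forall>x. t (t x) = - act q x)"
proof -
  obtain N where N: "\<And>i. i > N \<Longrightarrow> s i = 1"
    "represented_by scale u (diag_block_mat (map (\<lambda>i. companion_mat (s i)) [1..<N + 1]))"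
    using assms(1) by (auto simp: invariant_factors_def)
  have monic: "lead_coeff (s i) = 1" if "i \<ge> 1" for i using assms(1) that by (simp add: invariant_factors_def)
  have "represented_on UNIV (diag_block_mat (map companion_mat (map s [1..<N + 1])))"
    using N(2) by (simp add: represented_by_iff o_def del: upt_Suc)
  then have "splits (mset (map s [1..<N + 1])) UNIV"
    by (subst (asm) splits_iff_represented) (auto simp: monic simp del: upt_Suc)
  \<comment> \<open>Appending \<open>N\<close> trivial factors completes the sequence to length
    \<open>2 * N\<close>, which can be grouped in pairs whatever the parity of
    \<open>N\<close>.\<close>
  then have sp: "splits (replicate_mset N 1 + mset (map s [1..<N + 1])) UNIV" by (rule splits_replicate_one)
  define ps where "ps n = map (\<lambda>k. (s (2*k - 1), s (2*k))) [1..<n + 1]" for n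
  have flat: "flatten_pairs (ps n) = map s [1..<2 * n + 1]" for n
    by (induction n) (simp_all add: ps_def)
  have "[1..<2 * N + 1] = [1..<N + 1] @ [N + 1..<2 * N + 1]"
    using upt_add_eq_append[of 1 "N + 1" N] by (simp add: mult_2 del: upt_Suc)
  moreover have "map s [N + 1..<2 * N + 1] = replicate N 1"
    by (rule nth_equalityI) (auto simp: N(1) simp del: upt_Suc)
  ultimately have "mset (flatten_pairs (ps N)) = replicate_mset N 1 + mset (map s [1..<N + 1])"
    unfolding flat by (simp del: upt_Suc)
  then have sp: "splits (mset (flatten_pairs (ps N))) UNIV" using sp by simp
  have "g dvd reflect d f \<and> f dvd q * reflect d g" if fg: "(f, g) \<in> set (ps N)" for f g
  proof -
    obtain k where k: "k \<ge> 1" "f = s (2 * k - 1)" "g = s (2 * k)" using fg by (auto simp: ps_def)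
    then have fg: "f dvd reflect d f" "g dvd reflect d g" using assms(4) by auto
    from assms(2)[OF k(1)] have "f = g \<or> f = q * g" using k by simp
    then show ?thesis
    proof
      assume "f = g"
      then show ?thesis using fg by simp
    next
      assume "f = q * g"
      then show ?thesis using fg(2) assms(3) by (simp add: reflect_mult mult_dvd_mono)
    qed
  qed
  from splits_reflection[OF sp assms(3) this]
  obtain t where t: "\<And>x y. t (x + y) = t x + t y" "\<And>c x. t (scale c x) = scale c (t x)"
    "\<And>x. t (u x) = scale (2 * d) (t x) - u (t x)" "\<And>x. t (t x) = - act q x" by auto
  have "Vector_Spaces.linear scale scale t" using t(1,2) by (rule linearI)
  then show ?thesis using t(3,4) by blast
qed

text \<open>Completing the square: \<open>A (A x) - scale \<Delta> x\<close> is 4 times the value of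
  the quadratic polynomial, and \<open>h\<close> witnesses that 2 is invertible. It is applied with
  \<open>a\<close> and with \<open>b\<close> in the place of \<open>u\<close>.\<close>

lemma annihilated_quadratic_iff:
  fixes h :: 'a
  assumes "h * 2 = 1" "c1 * c1 - 4 * c0 = \<Delta>" "\<And>x. A x = scale 2 (u x) + scale c1 x"
  shows "annihilates scale [:c0, c1, 1:] u \<longleftrightarrow> (\<forall>x. A (A x) = scale \<Delta> x)"
proof -
  have AA: "A (A x) - scale \<Delta> x = scale 4 (act [:c0, c1, 1:] x)" for x
  proof -
    have D: "scale \<Delta> x = scale (c1 * c1) x - scale (4 * c0) x"
      by (simp add: scale_left_diff_distrib flip: assms(2))
    have "A (A x) = scale 4 (u (u x)) + (scale (4 * c1) (u x) + scale (c1 * c1) x)"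
      by (simp add: assms(3) u_simps scale_right_distrib flip: scale_left_distrib)
    then show ?thesis unfolding D
      by (simp add: u_simps scale_right_distrib algebra_simps)
  qed
  have "(4::'a) * (h * h) = (h * 2) * (h * 2)" by (simp add: algebra_simps)
  then have "(4::'a) \<noteq> 0" using assms(1) by auto
  then have "A (A x) = scale \<Delta> x \<longleftrightarrow> act [:c0, c1, 1:] x = 0" for x
    using AA[of x] by (metis right_minus_eq scale_eq_0_iff)
  then show ?thesis by (simp add: annihilates_def)
qed

end

section \<open>Eigenvalues in the algebraic closure\<close>

abbreviation eval_closure :: "'a::field poly \<Rightarrow> 'a alg_closure \<Rightarrow> 'a alg_closure" where
  "eval_closure f x \<equiv> poly (map_poly to_ac f) x"

lemma eval_closure_pCons [simp]: "eval_closure (pCons c f) x = to_ac c + x * eval_closure f x"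
  by (cases "c = 0 \<and> f = 0") (auto simp: map_poly_pCons)

lemma eval_closure_add: "eval_closure (f + g) x = eval_closure f x + eval_closure g x"
  by (induction f g rule: poly_induct2) (auto simp: algebra_simps)

lemma eval_closure_smult: "eval_closure (Polynomial.smult c f) x = to_ac c * eval_closure f x"
  by (induction f) (auto simp: algebra_simps)

lemma eval_closure_mult: "eval_closure (f * g) x = eval_closure f x * eval_closure g x"
  by (induction f) (auto simp: algebra_simps eval_closure_add eval_closure_smult)

lemma eval_closure_power: "eval_closure (f ^ n) x = eval_closure f x ^ n"
  by (induction n) (auto simp: eval_closure_mult one_pCons)

lemma degree_map_to_ac: "Polynomial.degree (map_poly to_ac f) = Polynomial.degree f"
  by (rule degree_map_poly) simp

lemma eval_closure_root:
  assumes "Polynomial.degree f > 0"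
  shows "\<exists>x. eval_closure f x = 0"
  by (rule alg_closed_imp_poly_has_root) (use assms in \<open>simp add: degree_map_to_ac\<close>)

text \<open>A Bezout identity over the ground field persists in the closure and would read 0 = 1 at
  the common root.\<close>

lemma irreducible_dvd_if_common_root:
  assumes "Factorial_Ring.irreducible f" "eval_closure f x = 0" "eval_closure g x = 0"
  shows "f dvd g"
proof (rule ccontr)
  assume "\<not> f dvd g"
  then obtain a b where "a * f + b * g = 1" by (rule irreducible_bezout[OF assms(1)])
  then have "eval_closure (a * f + b * g) x = 1" by (simp add: one_pCons)
  then show False using assms(2,3) by (simp add: eval_closure_add eval_closure_mult)
qed

interpretation to_ac: semiring_hom to_ac
  by unfold_locales simp_all

text \<open>Over the closure, the companion matrix is multiplication by t modulo f. The polynomial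
  \<open>G\<close>, which is f / (t - x), is killed by t - x there, so its coefficients form an
  eigenvector.\<close>

lemma companion_eigenvector:
  assumes f: "lead_coeff f = 1" "Polynomial.degree f = Suc m" and G: "map_poly to_ac f = [:- x, 1:] * G"
    and i: "i \<le> m"
  shows "(\<Sum>j<Suc m. to_ac (companion_mat f $$ (i, j)) * Polynomial.coeff G j) = x * Polynomial.coeff G i"
proof -
  have "Polynomial.degree (map_poly to_ac f) = Suc m" by (simp add: degree_map_to_ac f(2))
  moreover have "G \<noteq> 0" using G f by (metis calculation degree_0 mult_zero_right nat.distinct(1))
  ultimately have degG: "Polynomial.degree G = m"
    using degree_mult_eq[of "[:- x, 1:]" G] unfolding G by simp
  have F: "to_ac (Polynomial.coeff f k) = Polynomial.coeff ([:- x, 1:] * G) k" for k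
    unfolding G[symmetric] by (simp add: coeff_map_poly)
  have lead: "Polynomial.coeff G m = 1"
    using F[of "Suc m"] f degG by (simp add: coeff_eq_0)
  have "(\<Sum>j<m. to_ac (companion_mat f $$ (i, j)) * Polynomial.coeff G j) =
      (\<Sum>j<m. if Suc j = i then Polynomial.coeff G j else 0)"
    using f(2) i by (intro sum.cong) (auto simp: companion_mat_def Let_def)
  also have "\<dots> = (if i = 0 then 0 else Polynomial.coeff G (i - 1))"
    using i by (cases i) (auto simp: sum.delta)
  finally have "(\<Sum>j<Suc m. to_ac (companion_mat f $$ (i, j)) * Polynomial.coeff G j) =
      (if i = 0 then 0 else Polynomial.coeff G (i - 1)) - to_ac (Polynomial.coeff f i)"
    using f(2) i lead by (simp add: companion_mat_def Let_def)
  \<comment> \<open>This compares coefficient \<open>i\<close> in f = (t - x) G; for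
    \<open>i = 0\<close> the shifted term is absent.\<close>
  then show ?thesis unfolding F by (cases i) simp_all
qed

section \<open>From the eigenvalues in the closure to a nilpotent polynomial in
  \<open>u\<close>\<close>

locale fd_endomorphism = endomorphism scale u + finite_dimensional_vector_space scale Basis
  for scale :: "'a::field \<Rightarrow> 'v::ab_group_add \<Rightarrow> 'v" and u :: "'v \<Rightarrow> 'v" and Basis :: "'v set"
begin

text \<open>The powers of \<open>y\<close> are completed to a basis of the whole space. The
  resulting matrix has the companion block in its first columns with zeros below, so an eigenvector
  of the block extends by zeros.\<close>

lemma root_is_eigenvalue:
  assumes f: "lead_coeff f = 1" "Polynomial.degree f > 0" "has_annihilator f y"
    and x: "eval_closure f x = 0"
  shows "x \<in> eigenvalues_in_closure scale u"
proof -
  obtain m where m: "Polynomial.degree f = Suc m" using f(2) gr0_implies_Suc by blast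
  define xs where "xs = powers (Suc m) y"
  have xs: "represents (cyclic y) xs (companion_mat f)"
    using represents_companion[OF f(1,3)] by (simp add: xs_def m)
  then have ind: "distinct xs" "\<not> dependent (set xs)"
    using independent_list_iff[of xs] by (auto simp: represents_def)
  let ?B = "extend_basis (set xs)"
  have B: "set xs \<subseteq> ?B" "\<not> dependent ?B" "span ?B = UNIV"
    using extend_basis_superset[OF ind(2)] independent_extend_basis[OF ind(2)] span_extend_basis[OF ind(2)] by auto
  have "finite (?B - set xs)" using finiteI_independent[OF B(2)] by simp
  then obtain ys where ys: "set ys = ?B - set xs" "distinct ys" using finite_distinct_list by blast
  define bs where "bs = xs @ ys"
  have set: "set bs = ?B" using B(1) ys by (auto simp: bs_def)
  have dist: "distinct bs" using ind ys by (auto simp: bs_def)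
  have ind_bs: "independent_list bs" using B(2) set dist by (simp add: independent_list_iff)
  have UNIV: "range (lin_comb bs) = UNIV" using span_set_list[OF dist] B(3) set by simp
  have len: "length xs = Suc m" by (simp add: xs_def)
  define e where "e j i = (if i < Suc m then companion_mat f $$ (i, j) else 0)" for i j
  have e: "u (bs ! j) = lin_comb bs (e j)" if "j < Suc m" for j
  proof -
    have "u (bs ! j) = lin_comb xs (\<lambda>i. companion_mat f $$ (i, j))"
      using that xs len by (simp add: bs_def nth_append represents_def)
    also have "\<dots> = lin_comb xs (e j) + lin_comb ys (\<lambda>_. 0)"
      using len lin_comb_cong[of xs "e j" "\<lambda>i. companion_mat f $$ (i, j)"] by (simp add: e_def)
    also have "lin_comb ys (\<lambda>_. 0) = lin_comb ys (\<lambda>i. e j (i + length xs))"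
      by (rule lin_comb_cong) (simp add: e_def len)
    finally show ?thesis by (simp add: bs_def lin_comb_append)
  qed
  have "\<exists>c. u (bs ! j) = lin_comb bs c \<and> (j < Suc m \<longrightarrow> c = e j)" for j
    using e[of j] UNIV by (cases "j < Suc m") auto
  then obtain C where C: "\<And>j. u (bs ! j) = lin_comb bs (C j)" "\<And>j. j < Suc m \<Longrightarrow> C j = e j" by metis
  define N where "N = length bs"
  define M where "M = mat N N (\<lambda>(i, j). C j i)"
  have "represents UNIV bs M"
    unfolding represents_def
  proof (intro conjI allI impI)
    show "u (bs ! j) = lin_comb bs (\<lambda>i. M $$ (i, j))" if "j < length bs" for j
      unfolding C(1) by (rule lin_comb_cong) (use that in \<open>simp add: M_def N_def\<close>)
  qed (simp_all add: ind_bs UNIV M_def N_def)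
  then have rep: "represented_by scale u M" unfolding represented_by_iff represented_on_def by blast
  obtain G where G: "map_poly to_ac f = [:- x, 1:] * G" using x by (auto simp: poly_eq_0_iff_dvd)
  have F0: "map_poly to_ac f \<noteq> 0" using m degree_map_to_ac[of f] by auto
  then have G0: "G \<noteq> 0" using G by auto
  have "Polynomial.degree (map_poly to_ac f) = Suc m" by (simp add: degree_map_to_ac m)
  then have degG: "Polynomial.degree G = m"
    using degree_mult_eq[of "[:- x, 1:]" G] G0 unfolding G by simp
  have N: "Suc m \<le> N" by (simp add: N_def bs_def len)
  \<comment> \<open>The coefficients of \<open>G\<close> beyond its degree vanish, which is the
    extension by zeros.\<close>
  define w where "w = vec N (Polynomial.coeff G)"
  have "w $ m \<noteq> 0" using G0 degG N leading_coeff_neq_0[of G] by (auto simp: w_def)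
  then have w0: "w \<noteq> 0\<^sub>v N" using N by auto
  have "map_mat to_ac M *\<^sub>v w = x \<cdot>\<^sub>v w"
  proof (rule eq_vecI)
    fix i assume "i < dim_vec (x \<cdot>\<^sub>v w)"
    then have i: "i < N" by (simp add: w_def)
    have "(map_mat to_ac M *\<^sub>v w) $ i = (\<Sum>j<N. to_ac (C j i) * Polynomial.coeff G j)"
      using i by (simp add: M_def w_def scalar_prod_def lessThan_atLeast0)
    also have "\<dots> = (\<Sum>j<Suc m. to_ac (C j i) * Polynomial.coeff G j)"
      using N degG by (intro sum.mono_neutral_right) (auto simp: coeff_eq_0)
    also have "\<dots> = (\<Sum>j<Suc m. to_ac (e j i) * Polynomial.coeff G j)"
      by (intro sum.cong) (auto simp: C(2))
    also have "\<dots> = x * Polynomial.coeff G i"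
    proof (cases "i \<le> m")
      case True
      then show ?thesis using companion_eigenvector[OF f(1) m G True] by (simp add: e_def)
    next
      case False
      then show ?thesis using degG by (simp add: e_def coeff_eq_0)
    qed
    finally show "(map_mat to_ac M *\<^sub>v w) $ i = (x \<cdot>\<^sub>v w) $ i" using i by (simp add: w_def)
  qed (simp add: M_def w_def)
  then have "eigenvector (map_mat to_ac M) w x"
    using w0 by (simp add: eigenvector_def M_def w_def)
  then show ?thesis using rep unfolding eigenvalues_in_closure_def eigenvalue_def by blast
qed

text \<open>An irreducible polynomial killing a nonzero vector generates its annihilator, and
  scaling makes it monic, as a companion matrix requires.\<close>

lemma irreducible_root_is_eigenvalue:
  assumes f: "Factorial_Ring.irreducible f" and y: "y \<noteq> 0" "act f y = 0" and x: "eval_closure f x = 0"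
  shows "x \<in> eigenvalues_in_closure scale u"
proof -
  define c where "c = inverse (lead_coeff f)"
  have f0: "f \<noteq> 0" "\<not> is_unit f" using f by (auto simp: irreducible_def)
  then have c: "c \<noteq> 0" by (simp add: c_def)
  have deg: "Polynomial.degree f > 0" using f0 by (auto simp: is_unit_iff_degree)
  have "f dvd g" if g: "act g y = 0" for g
  proof (rule ccontr)
    assume "\<not> f dvd g"
    then obtain a b where ab: "a * f + b * g = 1" by (rule irreducible_bezout[OF f])
    have "y = act (a * f + b * g) y" by (simp add: ab)
    then show False using y g by (simp add: act_add act_mult act_simps)
  qed
  then have "has_annihilator (Polynomial.smult c f) y"
    using y(2) c by (intro has_annihilatorI) (simp_all add: act_smult smult_dvd)
  moreover have "lead_coeff (Polynomial.smult c f) = 1" using f0 by (simp add: c_def)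
  ultimately show ?thesis using root_is_eigenvalue[of "Polynomial.smult c f" y x] deg x c
    by (simp add: eval_closure_smult)
qed

text \<open>Irreducible factors of \<open>g\<close> are removed one at a time. If the cofactor
  \<open>g'\<close> does not kill \<open>y\<close>, then the factor \<open>p\<close> kills the
  nonzero vector \<open>act g' y\<close>; a root of \<open>p\<close> is thus an eigenvalue, and
  \<open>p\<close> divides \<open>f\<close>.\<close>

lemma nilpotent_at_vector:
  assumes eig: "\<And>x. x \<in> eigenvalues_in_closure scale u \<Longrightarrow> eval_closure f x = 0"
    and "g \<noteq> 0" "act g y = 0"
  shows "\<exists>k. act (f ^ k) y = 0"
  using assms(2,3)
proof (induction "Polynomial.degree g" arbitrary: g y rule: less_induct)
  case less
  show ?case
  proof (cases "Polynomial.degree g = 0")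
    case True
    then obtain c where c: "g = [:c:]" by (rule degree_eq_zeroE)
    then have "y = 0" using less.prems by (simp add: u_simps)
    then show ?thesis by (simp add: act_simps)
  next
    case False
    then obtain p where p: "Factorial_Ring.irreducible p" "p dvd g" using exists_irreducible_factor by blast
    then obtain g' where g': "g = p * g'" by (elim dvdE)
    have nz: "p \<noteq> 0" "g' \<noteq> 0" using less.prems g' by auto
    have "Polynomial.degree p > 0" using p(1) nz by (auto simp: irreducible_def is_unit_iff_degree)
    then have lt: "Polynomial.degree g' < Polynomial.degree g" using g' nz by (simp add: degree_mult_eq)
    show ?thesis
    proof (cases "act g' y = 0")
      case True
      then show ?thesis using less.hyps[OF lt nz(2)] by blast
    next
      case False
      obtain x where x: "eval_closure p x = 0" using eval_closure_root[OF \<open>Polynomial.degree p > 0\<close>] by blast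
      have "act p (act g' y) = 0" using less.prems g' by (simp add: act_mult)
      then have "x \<in> eigenvalues_in_closure scale u"
        using irreducible_root_is_eigenvalue[OF p(1) False _ x] by blast
      then have "p dvd f" using irreducible_dvd_if_common_root[OF p(1) x] eig by blast
      have "act g' (act p y) = 0" using less.prems g' by (simp add: act_mult act_commute)
      then obtain k where "act (f ^ k) (act p y) = 0" using less.hyps[OF lt nz(2)] by blast
      then have "act (f ^ k * p) y = 0" by (simp add: act_mult)
      moreover have "f ^ k * p dvd f ^ Suc k" using \<open>p dvd f\<close> by (simp add: mult.commute mult_dvd_mono)
      ultimately show ?thesis using act_dvd by blast
    qed
  qed
qed

lemma exists_annihilator_at: "\<exists>g. g \<noteq> 0 \<and> act g y = 0"
proof (cases "independent_list (powers (Suc (dim UNIV)) y)")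
  case True
  then have *: "distinct (powers (Suc (dim UNIV)) y)" "\<not> dependent (set (powers (Suc (dim UNIV)) y))"
    using independent_list_iff by blast+
  have "card (set (powers (Suc (dim UNIV)) y)) \<le> dim UNIV"
    by (rule independent_card_le_dim) (use *(2) in auto)
  then show ?thesis using distinct_card[OF *(1)] by simp
next
  case False
  then obtain c i where c: "lin_comb (powers (Suc (dim UNIV)) y) c = 0" "i < Suc (dim UNIV)" "c i \<noteq> 0"
    unfolding independent_list_def length_powers by blast
  obtain g where "lin_comb (powers (Suc (dim UNIV)) y) c = act g y" "\<forall>i<Suc (dim UNIV). Polynomial.coeff g i = c i"
    using lin_comb_powers_poly by blast
  then have "act g y = 0" "Polynomial.coeff g i \<noteq> 0" using c by auto
  then show ?thesis by (intro exI[of _ g]) auto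
qed

lemma nilpotent_if_eigenvalues:
  assumes eig: "\<And>x. x \<in> eigenvalues_in_closure scale u \<Longrightarrow> eval_closure f x = 0"
  shows "\<exists>k. \<forall>y. act (f ^ k) y = 0"
proof -
  have "\<exists>k. act (f ^ k) y = 0" for y
    using nilpotent_at_vector[OF eig] exists_annihilator_at[of y] by blast
  then obtain k where k: "\<And>y. act (f ^ k y) y = 0" by metis
  \<comment> \<open>The sum bounds the exponents at all vectors of the finite basis.\<close>
  define K where "K = (\<Sum>b\<in>Basis. k b)"
  have "act (f ^ K) b = 0" if "b \<in> Basis" for b
  proof -
    have "k b \<le> K" unfolding K_def using that finite_Basis by (intro member_le_sum) auto
    then show ?thesis using k[of b] act_dvd le_imp_power_dvd by blast
  qed
  moreover have "subspace {y. act (f ^ K) y = 0}"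
    by (rule subspaceI) (simp_all add: act_simps)
  ultimately have "span Basis \<subseteq> {y. act (f ^ K) y = 0}" by (intro span_minimal) auto
  then show ?thesis using span_Basis by blast
qed

end

section \<open>From an annihilating polynomial back to the eigenvalues in the closure\<close>

context endomorphism
begin

lemma lin_comb_sum: "lin_comb bs (\<lambda>i. \<Sum>k\<in>K. c k i) = (\<Sum>k\<in>K. lin_comb bs (c k))"
  by (simp add: lin_comb_def scale_sum_left) (rule sum.swap)

lemma represents_funpow:
  assumes M: "represents UNIV bs M" and j: "j < length bs"
  shows "(u ^^ k) (bs ! j) = lin_comb bs (\<lambda>i. (M ^\<^sub>m k) $$ (i, j))"
  using j
proof (induction k arbitrary: j)
  case 0
  have "M \<in> carrier_mat (length bs) (length bs)" using M by (simp add: represents_def)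
  then have "lin_comb bs (\<lambda>i. (M ^\<^sub>m 0) $$ (i, j)) = (\<Sum>i<length bs. if i = j then bs ! j else 0)"
    using 0 unfolding lin_comb_def by (intro sum.cong) auto
  then show ?case using 0 by simp
next
  case (Suc k)
  let ?n = "length bs"
  have carrier: "M \<in> carrier_mat ?n ?n" using M by (simp add: represents_def)
  then have carrier_pow: "M ^\<^sub>m k \<in> carrier_mat ?n ?n" by (rule pow_carrier_mat)
  have lin: "Vector_Spaces.linear scale scale (u ^^ k)"
  proof (rule linearI)
    show "(u ^^ k) (x + y) = (u ^^ k) x + (u ^^ k) y" for x y by (induction k) (simp_all add: u_simps)
    show "(u ^^ k) (scale c x) = scale c ((u ^^ k) x)" for c x by (induction k) (simp_all add: u_simps)
  qed
  have "(u ^^ Suc k) (bs ! j) = (u ^^ k) (u (bs ! j))" by (simp add: funpow_swap1)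
  also have "u (bs ! j) = (\<Sum>i<?n. scale (M $$ (i, j)) (bs ! i))"
    using M Suc.prems by (simp add: represents_def lin_comb_def)
  also have "(u ^^ k) \<dots> = (\<Sum>i<?n. scale (M $$ (i, j)) (lin_comb bs (\<lambda>l. (M ^\<^sub>m k) $$ (l, i))))"
    by (simp add: linear_sum[OF lin] linear_scale[OF lin] Suc.IH)
  also have "\<dots> = lin_comb bs (\<lambda>l. \<Sum>i<?n. M $$ (i, j) * (M ^\<^sub>m k) $$ (l, i))"
    by (simp add: lin_comb_sum lin_comb_scale)
  also have "\<dots> = lin_comb bs (\<lambda>l. (M ^\<^sub>m Suc k) $$ (l, j))"
    using Suc.prems carrier carrier_pow
    by (intro lin_comb_cong) (simp add: scalar_prod_def lessThan_atLeast0 mult.commute)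
  finally show ?case .
qed

text \<open>If f(u) = 0, then f(M) vanishes entrywise for whichever representing matrix
  \<open>M\<close> produced the eigenvalue; on an eigenvector over the closure f(M) is
  multiplication by f(x).\<close>

lemma eigenvalue_annihilated:
  assumes f: "annihilates scale f u" and x: "x \<in> eigenvalues_in_closure scale u"
  shows "eval_closure f x = 0"
proof -
  obtain M bs w where M: "represents UNIV bs M" and w: "eigenvector (map_mat to_ac M) w x"
    using x by (auto simp: eigenvalues_in_closure_def eigenvalue_def represented_by_iff represented_on_def)
  let ?n = "length bs" and ?A = "map_mat to_ac M"
  have carrier: "M \<in> carrier_mat ?n ?n" using M by (simp add: represents_def)
  then have A: "?A \<in> carrier_mat ?n ?n" by simp
  have w': "w \<in> carrier_vec ?n" "w \<noteq> 0\<^sub>v ?n" using w A by (auto simp: eigenvector_def)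
  have pow_carrier: "M ^\<^sub>m k \<in> carrier_mat ?n ?n" for k using carrier by (rule pow_carrier_mat)
  \<comment> \<open>Column \<open>j\<close> of f(M) holds the coordinates of
    \<open>act f (bs ! j)\<close>, which is 0.\<close>
  have 0: "(\<Sum>k\<le>Polynomial.degree f. Polynomial.coeff f k * (M ^\<^sub>m k) $$ (i, j)) = 0" if "i < ?n" "j < ?n" for i j
  proof -
    have "lin_comb bs (\<lambda>i. \<Sum>k\<le>Polynomial.degree f. Polynomial.coeff f k * (M ^\<^sub>m k) $$ (i, j)) = act f (bs ! j)"
      by (simp add: lin_comb_sum lin_comb_scale poly_endo_def represents_funpow[OF M that(2)])
    also have "\<dots> = 0" using f by (simp add: annihilates_def)
    finally show ?thesis using M that(1) unfolding represents_def independent_list_def by blast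
  qed
  have pow: "(\<Sum>j<?n. to_ac ((M ^\<^sub>m k) $$ (i, j)) * w $ j) = x ^ k * w $ i" if "i < ?n" for i k
  proof -
    have "map_mat to_ac (M ^\<^sub>m k) *\<^sub>v w = x ^ k \<cdot>\<^sub>v w"
      unfolding to_ac.mat_hom_pow[OF carrier] by (rule eigenvector_pow[OF A w])
    then have "(map_mat to_ac (M ^\<^sub>m k) *\<^sub>v w) $ i = (x ^ k \<cdot>\<^sub>v w) $ i" by simp
    then show ?thesis using that carrier_matD[OF pow_carrier[of k]] carrier_vecD[OF w'(1)] by (simp add: scalar_prod_def lessThan_atLeast0)
  qed
  obtain i where i: "i < ?n" "w $ i \<noteq> 0" using w' by (metis carrier_vecD eq_vecI index_zero_vec dim_vec)
  have "eval_closure f x * w $ i = (\<Sum>k\<le>Polynomial.degree f. to_ac (Polynomial.coeff f k) * (x ^ k * w $ i))"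
    by (simp add: poly_altdef degree_map_to_ac coeff_map_poly sum_distrib_right mult.assoc)
  also have "\<dots> = (\<Sum>k\<le>Polynomial.degree f. \<Sum>j<?n. to_ac (Polynomial.coeff f k * (M ^\<^sub>m k) $$ (i, j)) * w $ j)"
    by (simp add: pow[OF i(1), symmetric] sum_distrib_left mult.assoc)
  also have "\<dots> = (\<Sum>j<?n. to_ac (\<Sum>k\<le>Polynomial.degree f. Polynomial.coeff f k * (M ^\<^sub>m k) $$ (i, j)) * w $ j)"
    by (subst sum.swap) (simp add: to_ac_sum sum_distrib_right)
  also have "\<dots> = 0" using 0[OF i(1)] by simp
  finally show ?thesis using i(2) by simp
qed

text \<open>The divisibility chain makes \<open>s 1\<close> a multiple of all annihilators. It is
  one of them unless \<open>N = 0\<close>, when it equals 1.\<close>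

lemma minimal_polynomial_invariant_factors:
  assumes "invariant_factors scale u s"
  shows "minimal_polynomial scale u = s 1" "annihilates scale (s 1) u"
proof -
  obtain N where N: "\<And>i. i > N \<Longrightarrow> s i = 1"
    "represented_by scale u (diag_block_mat (map (\<lambda>i. companion_mat (s i)) [1..<N + 1]))"
    using assms by (auto simp: invariant_factors_def)
  have s: "lead_coeff (s i) = 1" "s (i + 1) dvd s i" if "i \<ge> 1" for i
    using assms that by (simp_all add: invariant_factors_def)
  have "represented_on UNIV (diag_block_mat (map companion_mat (map s [1..<N + 1])))"
    using N(2) by (simp add: represented_by_iff o_def del: upt_Suc)
  then have sp: "splits (mset (map s [1..<N + 1])) UNIV"
    by (subst (asm) splits_iff_represented) (auto simp: s simp del: upt_Suc)
  have chain: "s i dvd s 1" if "i \<ge> 1" for i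
    using that
  proof (induction i rule: dec_induct)
    case (step n)
    then show ?case using s(2)[of n] dvd_trans by simp
  qed simp
  have "s 1 \<in># mset (map s [1..<N + 1]) \<or> s 1 = 1"
    using N(1)[of 1] by (cases "N = 0") (auto simp del: upt_Suc)
  moreover have "f dvd s 1" if "f \<in># mset (map s [1..<N + 1])" for f using that chain by auto
  ultimately show "minimal_polynomial scale u = s 1" "annihilates scale (s 1) u"
    using minimal_polynomial_splits[OF sp] s(1)[of 1] by auto
qed

end

section \<open>Quadratic polynomials and the main theorem\<close>

lemma no_root_irreducible:
  fixes f :: "'a::field poly"
  assumes "Polynomial.degree f = 2" "\<And>x. poly f x \<noteq> 0"
  shows "Factorial_Ring.irreducible f"
proof (rule irreducibleI)
  show "f \<noteq> 0" "\<not> is_unit f" using assms(1) by (auto simp: is_unit_iff_degree)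
  fix a b assume ab: "f = a * b"
  have nz: "a \<noteq> 0" "b \<noteq> 0" using ab assms(1) by auto
  have "Polynomial.degree a \<noteq> 1" "Polynomial.degree b \<noteq> 1"
  proof -
    have *: "\<exists>x. poly g x = 0" if "Polynomial.degree g = 1" for g :: "'a poly"
    proof -
      have "Polynomial.coeff g 1 \<noteq> 0" using that leading_coeff_neq_0[of g] by fastforce
      then have "poly g (- Polynomial.coeff g 0 / Polynomial.coeff g 1) = 0"
        using that by (simp add: poly_altdef)
      then show ?thesis by blast
    qed
    show "Polynomial.degree a \<noteq> 1" "Polynomial.degree b \<noteq> 1" using *[of a] *[of b] assms(2) ab by auto
  qed
  moreover have "Polynomial.degree a + Polynomial.degree b = 2" using ab nz assms(1) by (simp add: degree_mult_eq)
  ultimately have "Polynomial.degree a = 0 \<or> Polynomial.degree b = 0" by linarith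
  then show "is_unit a \<or> is_unit b" using nz by (auto simp: is_unit_iff_degree)
qed

lemma quadratic_eq:
  fixes p :: "'a::field poly"
  assumes "lead_coeff p = 1" "Polynomial.degree p = 2"
  shows "p = [:poly p 0, - poly_trace p, 1:]"
proof (rule poly_eqI)
  fix n :: nat
  consider "n = 0" | "n = 1" | "n = 2" | "n > 2" by linarith
  then show "Polynomial.coeff p n = Polynomial.coeff [:poly p 0, - poly_trace p, 1:] n"
    by cases (use assms in \<open>auto simp: poly_trace_def poly_0_coeff_0 coeff_eq_0 numeral_2_eq_2\<close>)
qed

text \<open>By the quadratic formula \<open>(poly_trace p + e) / 2\<close> would be a root, giving a
  linear factor of an irreducible quadratic.\<close>

lemma discriminant_not_square:
  fixes p :: "'a::field poly"
  assumes "lead_coeff p = 1" "Polynomial.degree p = 2" "Factorial_Ring.irreducible p" "(2::'a) \<noteq> 0"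
  shows "e * e \<noteq> (poly_trace p)^2 - 4 * poly p 0"
proof
  assume e: "e * e = (poly_trace p)^2 - 4 * poly p 0"
  define x where "x = (poly_trace p + e) / 2"
  have two_x: "2 * x = poly_trace p + e" using assms(4) by (simp add: x_def)
  have "4 * poly p x = (2 * x - poly_trace p) * (2 * x - poly_trace p) - ((poly_trace p)^2 - 4 * poly p 0)"
    by (subst quadratic_eq[OF assms(1,2)]) (simp add: algebra_simps power2_eq_square)
  also have "\<dots> = 0" unfolding two_x by (simp add: e)
  finally have "(2 * 2) * poly p x = 0" by simp
  then have "poly p x = 0" using assms(4) by (metis mult_eq_0_iff)
  then have "[:- x, 1:] dvd p" by (simp add: poly_eq_0_iff_dvd)
  then have "p dvd [:- x, 1:] \<or> is_unit [:- x, 1:]" using assms(3) irreducibleD' by blast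
  then show False
  proof
    assume "p dvd [:- x, 1:]"
    then have "Polynomial.degree p \<le> Polynomial.degree [:- x, 1:]" by (rule dvd_imp_degree_le) simp
    then show False using assms(2) by simp
  qed (simp add: is_unit_iff_degree)
qed

text \<open>The roots of \<open>q\<close> are those of \<open>p\<close> shifted by
  \<open>- d\<close>, so z - d runs through the differences of roots of \<open>p\<close>: zero and
  the square roots of \<Delta>. These are the roots of (t - d) r, shifted by
  \<open>d\<close>.\<close>

lemma root_differences:
  fixes \<mu> \<alpha> d \<Delta> :: "'a::field"
  assumes two: "(2::'a) \<noteq> 0" and \<Delta>: "\<Delta> = \<mu>^2 - 4 * \<alpha>"
    and p: "p = [:\<alpha>, - \<mu>, 1:]" and q: "q = p \<circ>\<^sub>p [:d, 1:]"
  shows "z \<in> {x - y |x y. x \<in> Root p \<and> y \<in> Root q} \<longleftrightarrow>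
    (z - to_ac d) * ((z - to_ac d)^2 - to_ac \<Delta>) = 0"
proof -
  let ?D = "to_ac d" and ?L = "to_ac \<mu>" and ?A = "to_ac \<alpha>"
  have two': "(2::'a alg_closure) \<noteq> 0" using two to_ac_eq_0_iff[of "2::'a"] by (metis to_ac_numeral)
  have D: "to_ac \<Delta> = ?L ^ 2 - 4 * ?A" by (simp add: \<Delta>)
  have q': "q = [:d * d - \<mu> * d + \<alpha>, 2 * d - \<mu>, 1:]"
    by (simp add: q p pcompose_pCons algebra_simps)
  have rp: "x \<in> Root p \<longleftrightarrow> x * x - ?L * x + ?A = 0" for x
    by (simp add: Root_def p algebra_simps)
  have rq: "y \<in> Root q \<longleftrightarrow> (y + ?D) * (y + ?D) - ?L * (y + ?D) + ?A = 0" for y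
    by (simp add: Root_def q' algebra_simps)
  have half: "(L + e) / 2 \<in> Root p" if "e * e = to_ac \<Delta>" "L = ?L" for e L
  proof -
    define h where "h = (L + e) / 2"
    have h: "2 * h - L = e" using two' by (simp add: h_def)
    have "(2 * 2) * (h * h - L * h + ?A) = (2 * h - L) * (2 * h - L) - (L * L - 4 * ?A)"
      by (simp add: algebra_simps)
    also have "\<dots> = 0" unfolding h using that D by (simp add: power2_eq_square)
    finally have "(2 * 2) * (h * h - L * h + ?A) = 0" .
    then show ?thesis unfolding rp h_def[symmetric] using two' that(2) by (metis mult_eq_0_iff)
  qed
  have shift: "y - ?D \<in> Root q \<longleftrightarrow> y \<in> Root p" for y by (simp add: rp rq)
  show ?thesis
  proof
    assume "z \<in> {x - y |x y. x \<in> Root p \<and> y \<in> Root q}"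
    then obtain x y where xy: "z = x - y" "x \<in> Root p" "y \<in> Root q" by blast
    define y' where "y' = y + ?D"
    have y': "y' \<in> Root p" using xy(3) shift[of y'] by (simp add: y'_def)
    have z: "z - ?D = x - y'" by (simp add: xy(1) y'_def)
    have 1: "x * x - ?L * x + ?A = 0" "y' * y' - ?L * y' + ?A = 0" using xy(2) y' rp by auto
    have "(x - y') * (x + y' - ?L) = (x * x - ?L * x + ?A) - (y' * y' - ?L * y' + ?A)"
      by (simp add: algebra_simps)
    then have "(x - y') * (x + y' - ?L) = 0" using 1 by simp
    \<comment> \<open>Unless \<open>x = y'\<close>, the product above gives
      \<open>x + y' = ?L\<close>, and then this identity gives
      \<open>(x - y')^2 = to_ac \<Delta>\<close>.\<close>
    moreover have "(x - y')^2 - to_ac \<Delta> = (x + y' - ?L) * (x + y' + ?L) - 4 * (x * (x + y' - ?L)) + 4 * (x * x - ?L * x + ?A)"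
      by (simp add: D power2_eq_square algebra_simps)
    ultimately show "(z - ?D) * ((z - ?D)^2 - to_ac \<Delta>) = 0"
      unfolding z using 1 by (auto simp: mult_eq_0_iff)
  next
    assume "(z - ?D) * ((z - ?D)^2 - to_ac \<Delta>) = 0"
    then have "z - ?D = 0 \<or> (z - ?D)^2 = to_ac \<Delta>" by simp
    then show "z \<in> {x - y |x y. x \<in> Root p \<and> y \<in> Root q}"
    proof
      assume z: "z - ?D = 0"
      \<comment> \<open>Any root of \<open>p\<close> will do, paired with its own shift; a square
        root of \<Delta> supplies one.\<close>
      obtain e where "e ^ 2 = to_ac \<Delta>" using nth_root_exists[of 2 "to_ac \<Delta>"] by auto
      then have "(?L + e) / 2 \<in> Root p" using half by (simp add: power2_eq_square)
      moreover from this have "(?L + e) / 2 - ?D \<in> Root q" using shift by blast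
      moreover have "z = (?L + e) / 2 - ((?L + e) / 2 - ?D)" using z by simp
      ultimately show ?thesis by blast
    next
      assume z: "(z - ?D)^2 = to_ac \<Delta>"
      define e where "e = z - ?D"
      have e: "e * e = to_ac \<Delta>" using z by (simp add: e_def power2_eq_square)
      then have "(- e) * (- e) = to_ac \<Delta>" by simp
      with e have "(?L + e) / 2 \<in> Root p" "(?L + - e) / 2 \<in> Root p" using half by blast+
      moreover from this have "(?L + - e) / 2 - ?D \<in> Root q" using shift by blast
      moreover have "z = (?L + e) / 2 - ((?L + - e) / 2 - ?D)" using two' by (simp add: e_def field_simps)
      ultimately show ?thesis by blast
    qed
  qed
qed

theorem theorem3p24:
  fixes scale :: "'a::field \<Rightarrow> 'v::ab_group_add \<Rightarrow> 'v"
    and Basis :: "'v set"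
    and u :: "'v \<Rightarrow> 'v"
    and p q r :: "'a poly"
    and d \<Delta> :: 'a
  assumes char: "CHAR('a) \<noteq> 2"
    and p: "lead_coeff p = 1" "Polynomial.degree p = 2" "Factorial_Ring.irreducible p"
    and q: "lead_coeff q = 1" "Polynomial.degree q = 2" "Factorial_Ring.irreducible q"
    and q_shift: "q = p \<circ>\<^sub>p [:d, 1:]"
    and \<Delta>: "\<Delta> = (poly_trace p)^2 - 4 * poly p 0"
    and r: "r = [:- d, 1:]^2 - [:\<Delta>:]"
    and V: "finite_dimensional_vector_space scale Basis"
    and u: "Vector_Spaces.linear scale scale u"
  shows
    "((is_difference scale p q u \<and> d_exceptional scale p q u)
       \<longleftrightarrow>
      ((\<exists>a b. minimal_polynomial scale u = [:- d, 1:]^a * r^b) \<and>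
       (\<exists>s. invariant_factors scale u s \<and>
            (\<forall>k\<ge>1. s (2*k - 1) = s (2*k) \<or> s (2*k - 1) = r * s (2*k)))))
     \<and>
     (((\<exists>a b. minimal_polynomial scale u = [:- d, 1:]^a * r^b) \<and>
       (\<exists>s. invariant_factors scale u s \<and>
            (\<forall>k\<ge>1. s (2*k - 1) = s (2*k) \<or> s (2*k - 1) = r * s (2*k))))
       \<longleftrightarrow>
      (\<exists>Bs. represented_by scale u (diag_block_mat Bs) \<and>
            (\<forall>B \<in> set Bs.
               (\<exists>n \<epsilon>. \<epsilon> \<in> {0, 1} \<and>
                  B = diag_block_mat [companion_mat (r^(n + \<epsilon>)), companion_mat (r^n)]) \<or>
               (\<exists>n\<ge>1. B = diag_block_mat
                  [companion_mat ([:- d, 1:]^n), companion_mat ([:- d, 1:]^n)]))))"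
    (is "(?i \<longleftrightarrow> ?ii) \<and> (?ii \<longleftrightarrow> ?iii)")
proof -
  define \<mu> \<alpha> where "\<mu> = poly_trace p" and "\<alpha> = poly p 0"
  define l where "l = [:- d, 1:]"
  have p_eq: "p = [:\<alpha>, - \<mu>, 1:]" unfolding \<mu>_def \<alpha>_def by (rule quadratic_eq[OF p(1,2)])
  have q_eq: "q = [:d * d - \<mu> * d + \<alpha>, 2 * d - \<mu>, 1:]"
    by (simp add: q_shift p_eq pcompose_pCons algebra_simps)
  have \<Delta>_eq: "\<Delta> = \<mu>^2 - 4 * \<alpha>" by (simp add: \<Delta> \<mu>_def \<alpha>_def)
  have two: "(2::'a) \<noteq> 0"
  proof
    assume "(2::'a) = 0"
    then have "of_nat 2 = (0::'a)" by simp
    then have "CHAR('a) dvd 2" by (simp only: of_nat_eq_0_iff_char_dvd)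
    moreover have "CHAR('a) \<noteq> 1" by simp
    ultimately show False using char by (metis dvd_imp_le One_nat_def dvd_0_left_iff less_2_cases_iff nat_less_le pos2 zero_neq_numeral)
  qed
  have nonsquare: "e * e \<noteq> \<Delta>" for e unfolding \<Delta> by (rule discriminant_not_square[OF p two])
  then have \<Delta>0: "\<Delta> \<noteq> 0" by (metis mult_zero_left)
  interpret fd_endomorphism scale u Basis
    by (intro fd_endomorphism.intro endomorphism.intro endomorphism_axioms.intro u V
        finite_dimensional_vector_space.axioms(1)[OF V])
  have r_eq: "r = l^2 - [:\<Delta>:]" by (simp add: r l_def)
  have l_monic: "lead_coeff l = 1" by (simp add: l_def)
  have r_coeffs: "r = [:d * d - \<Delta>, - 2 * d, 1:]" by (simp add: r power2_eq_square)
  have r_monic: "lead_coeff r = 1" by (simp add: r_coeffs)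
  have comax: "comaximal l r" unfolding r_eq using \<Delta>0 by (rule comaximal_square_diff)
  have eval_l: "eval_closure l z = z - to_ac d" for z by (simp add: l_def)
  have eval_r: "eval_closure r z = (z - to_ac d)^2 - to_ac \<Delta>" for z
    by (simp add: r_coeffs power2_eq_square algebra_simps)
  have roots: "z \<in> {x - y |x y. x \<in> Root p \<and> y \<in> Root q} \<longleftrightarrow> eval_closure (l * r) z = 0" for z
    unfolding eval_closure_mult eval_l eval_r by (rule root_differences[OF two \<Delta>_eq p_eq q_shift])
  have h: "1 / 2 * 2 = (1::'a)" using two by simp
  have disc_p: "(- \<mu>) * (- \<mu>) - 4 * \<alpha> = \<Delta>" by (simp add: \<Delta>_eq power2_eq_square)
  \<comment> \<open>Translation preserves the discriminant, so \<open>A\<close> and \<open>B\<close>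
    below have the same square.\<close>
  have disc_q: "(2 * d - \<mu>) * (2 * d - \<mu>) - 4 * (d * d - \<mu> * d + \<alpha>) = \<Delta>"
    by (simp add: \<Delta>_eq power2_eq_square algebra_simps)
  have halves: "scale (c / 2) x + scale (c / 2) x = scale c x" for c x
  proof -
    have "c / 2 + c / 2 = c" using two by (simp flip: mult_2)
    then show ?thesis by (simp flip: scale_left_distrib)
  qed
  have two_d: "scale (2 * d) x = scale d x + scale d x" for x
    by (simp only: mult_2 scale_left_distrib)
  have dbl: "scale 2 x = x + x" for x
    using scale_left_distrib[of 1 1 x] by simp
  have i_iii: ?iii if i: ?i
  proof -
    obtain a b where ab: "Vector_Spaces.linear scale scale a" "Vector_Spaces.linear scale scale b"
      "annihilates scale p a" "annihilates scale q b" "u = (\<lambda>v. a v - b v)"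
      using i unfolding is_difference_def by blast
    \<comment> \<open>The traces of \<open>p\<close> and \<open>q\<close> are \<mu> and \<mu> - 2 d,
      so these are 2 a - tr p and 2 b - tr q.\<close>
    define A B where "A x = scale 2 (a x) + scale (- \<mu>) x" and "B x = scale 2 (b x) + scale (2 * d - \<mu>) x" for x
    have AA: "A (A x) = scale \<Delta> x" for x
      using endomorphism.annihilated_quadratic_iff[OF _ h disc_p, of scale a A] ab(1,3) vector_space_axioms
      by (simp add: p_eq A_def endomorphism_def endomorphism_axioms_def)
    have BB: "B (B x) = scale \<Delta> x" for x
      using endomorphism.annihilated_quadratic_iff[OF _ h disc_q, of scale b B] ab(2,4) vector_space_axioms
      by (simp add: q_eq B_def endomorphism_def endomorphism_axioms_def)
    have linA: "Vector_Spaces.linear scale scale A"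
      by (rule linearI) (simp_all add: A_def linear_add[OF ab(1)] linear_scale[OF ab(1)] scale_right_distrib
          algebra_simps)
    have linB: "Vector_Spaces.linear scale scale B"
      by (rule linearI) (simp_all add: B_def linear_add[OF ab(2)] linear_scale[OF ab(2)] scale_right_distrib
          algebra_simps)
    note AB_simps = linear_add[OF linA] linear_scale[OF linA] linear_diff[OF linA]
      linear_add[OF linB] linear_scale[OF linB] linear_diff[OF linB]
    \<comment> \<open>Equality of the two squares gives s w + w s = (A^2 - B^2) / 2 = 0 and s^2 +
      w^2 = (A^2 + B^2) / 2 = \<Delta>.\<close>
    define s where "s x = scale (1 / 2) (A x + B x)" for x
    define w where "w x = scale (1 / 2) (A x - B x)" for x
    have w: "w x = u x - scale d x" for x
    proof -
      have "A x - B x = scale 2 (u x - scale d x)"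
        by (simp add: A_def B_def ab(5) scale_right_diff_distrib scale_left_diff_distrib)
      then show ?thesis using two by (simp add: w_def)
    qed
    have lin_s: "Vector_Spaces.linear scale scale s"
      by (rule linearI) (simp_all add: s_def AB_simps scale_right_distrib mult.commute algebra_simps)
    have sw: "s (w x) + w (s x) = 0" for x
      by (simp add: s_def w_def AB_simps AA BB scale_right_distrib scale_right_diff_distrib)
    have ss: "s (s x) + w (w x) = scale \<Delta> x" for x
    proof -
      have "s (s x) + w (w x) = scale (1 / 2) ((scale (\<Delta> / 2) x + scale (\<Delta> / 2) x) +
          (scale (\<Delta> / 2) x + scale (\<Delta> / 2) x))"
        by (simp add: s_def w_def AB_simps AA BB scale_right_distrib scale_right_diff_distrib)
      also have "\<dots> = scale (\<Delta> / 2) x + scale (\<Delta> / 2) x" by (simp add: scale_right_distrib halves)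
      finally show ?thesis unfolding halves .
    qed
    have act_l: "act l x = w x" for x by (simp add: l_def w u_simps)
    interpret skew scale u Basis s d \<Delta>
    proof (intro skew.intro skew_axioms.intro endomorphism_axioms finite_dimensional_vector_space_axioms)
      show "Vector_Spaces.linear scale scale s" by (rule lin_s)
      show "e * e \<noteq> \<Delta>" for e by (rule nonsquare)
      show "s (s v) = scale \<Delta> v - act ([:- d, 1:]^2) v" for v
        using ss[of v] by (simp add: power2_eq_square act_mult act_l flip: l_def) (simp add: algebra_simps)
      show "s (u v) = scale (2 * d) (s v) - u (s v)" for v
      proof -
        have eq: "s (u v) - scale d (s v) + (u (s v) - scale d (s v)) = 0"
          using sw[of v] unfolding w by (simp add: linear_diff[OF lin_s] linear_scale[OF lin_s])
        show ?thesis unfolding two_d using eq by (simp add: algebra_simps)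
      qed
    qed
    have l': "\<tau> = l" by (simp add: \<tau>_def l_def)
    have r': "skew.r d \<Delta> = r" by (simp add: r_def l' r_eq)
    \<comment> \<open>Here d-exceptionality enters: the admissible eigenvalues are the roots of
      \<open>l * r\<close>.\<close>
    have "\<exists>k. \<forall>y. act ((l * r) ^ k) y = 0"
    proof (rule nilpotent_if_eigenvalues)
      fix x assume "x \<in> eigenvalues_in_closure scale u"
      then have "x \<in> {x - y |x y. x \<in> Root p \<and> y \<in> Root q}" using i unfolding d_exceptional_def by blast
      then show "eval_closure (l * r) x = 0" using roots by blast
    qed
    then obtain k where "\<And>y. act ((l * r) ^ k) y = 0" by blast
    then obtain Bs where "paired_blocks l r Bs" "represented_on UNIV (diag_block_mat Bs)"
      using exists_good_blocks[of k] unfolding l' r' by blast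
    then show ?iii unfolding paired_blocks_def l_def represented_by_iff by blast
  qed
  have iii_ii: ?ii if iii: ?iii
  proof -
    obtain Bs where "represented_on UNIV (diag_block_mat Bs)" "paired_blocks l r Bs"
      using iii unfolding paired_blocks_def l_def represented_by_iff by blast
    from invariant_factors_paired_blocks[OF l_monic r_monic comax this]
    show ?ii unfolding l_def .
  qed
  have ii_i: ?i if ii: ?ii
  proof -
    obtain m n s where min: "minimal_polynomial scale u = l ^ m * r ^ n"
      and s: "invariant_factors scale u s" "\<And>k. k \<ge> 1 \<Longrightarrow> s (2*k - 1) = s (2*k) \<or> s (2*k - 1) = r * s (2*k)"
      using ii unfolding l_def by blast
    have s1: "s 1 = l ^ m * r ^ n" "annihilates scale (l ^ m * r ^ n) u"
      using minimal_polynomial_invariant_factors[OF s(1)] min by simp_all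
    have l_irr: "Factorial_Ring.irreducible l" unfolding l_def by (rule irreducible_linear_field_poly) simp
    have r_irr: "Factorial_Ring.irreducible r"
    proof (rule no_root_irreducible)
      show "Polynomial.degree r = 2" by (simp add: r_coeffs)
      show "poly r x \<noteq> 0" for x
      proof
        assume "poly r x = 0"
        then have "(x - d) * (x - d) = \<Delta>" by (simp add: r_coeffs algebra_simps)
        then show False using nonsquare by blast
      qed
    qed
    have reflect_l: "reflect d l = - l" by (simp add: reflect_def l_def pcompose_pCons)
    have reflect_r: "reflect d r = r"
      by (simp add: reflect_def r_coeffs pcompose_pCons algebra_simps)
    have s_dvd: "s i dvd reflect d (s i)" if "i \<ge> 1" for i
    proof -
      have "s i dvd s 1" using that
      proof (induction i rule: dec_induct)
        case (step j)
        then show ?case using s(1) dvd_trans by (fastforce simp: invariant_factors_def)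
      qed simp
      \<comment> \<open>Being a divisor of \<open>l ^ m * r ^ n\<close>, the factor is a unit times
        powers of \<open>l\<close> and \<open>r\<close>, and reflection alters it just by a
        sign.\<close>
      then obtain c i' j' where c: "is_unit c" "s i = c * l ^ i' * r ^ j'"
        using dvd_power_mult_power[OF l_irr r_irr] s1 by metis
      have "l ^ i' * r ^ j' dvd (- l) ^ i' * r ^ j'" by (simp add: mult_dvd_mono dvd_power_same)
      then have "l ^ i' * r ^ j' dvd reflect d (s i)"
        by (simp add: c(2) reflect_mult reflect_power reflect_l reflect_r mult.assoc dvd_mult)
      then show ?thesis using c by (simp add: mult.assoc mult_unit_dvd_iff')
    qed
    obtain t where t: "Vector_Spaces.linear scale scale t" "\<And>x. t (u x) = scale (2 * d) (t x) - u (t x)"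
      "\<And>x. t (t x) = - act r x"
      using exists_reflection[OF s reflect_r s_dvd] by blast
    define w where "w x = u x - scale d x" for x
    have tt: "t (t x) = scale \<Delta> x - w (w x)" for x
    proof -
      have "act r x = act l (act l x) - scale \<Delta> x" by (simp add: r_eq power2_eq_square act_diff act_mult u_simps)
      then show ?thesis by (simp add: t(3) w_def l_def u_simps)
    qed
    have tw: "t (w x) = - w (t x)" for x
      by (simp add: w_def linear_diff[OF t(1)] linear_scale[OF t(1)] t(2) two_d)
    have lin_w: "Vector_Spaces.linear scale scale w"
      by (rule linearI) (simp_all add: w_def u_simps scale_right_distrib scale_right_diff_distrib mult.commute)
    \<comment> \<open>The passage to half sum and half difference is inverted, with \<open>t\<close>
      in the role of s.\<close>
    define A B where "A x = t x + w x" and "B x = t x - w x" for x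
    note tw_simps = linear_add[OF t(1)] linear_diff[OF t(1)] linear_add[OF lin_w] linear_diff[OF lin_w]
      linear_scale[OF t(1)] linear_scale[OF lin_w]
    have AA: "A (A x) = scale \<Delta> x" and BB: "B (B x) = scale \<Delta> x" for x
      by (simp_all add: A_def B_def tw_simps tt tw)
    \<comment> \<open>These solve A = 2 a - tr p and B = 2 b - tr q, where tr q = \<mu> - 2
      d.\<close>
    define a b where "a x = scale (1 / 2) (A x + scale \<mu> x)"
      and "b x = scale (1 / 2) (B x + scale (\<mu> - 2 * d) x)" for x
    have lin_a: "Vector_Spaces.linear scale scale a"
      by (rule linearI) (simp_all add: a_def A_def tw_simps scale_right_distrib algebra_simps)
    have lin_b: "Vector_Spaces.linear scale scale b"
      by (rule linearI) (simp_all add: b_def B_def tw_simps scale_right_distrib scale_right_diff_distrib algebra_simps)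
    have A_eq: "A x = scale 2 (a x) + scale (- \<mu>) x" for x using two by (simp add: a_def)
    have B_eq: "B x = scale 2 (b x) + scale (2 * d - \<mu>) x" for x
      using two by (simp add: b_def scale_left_diff_distrib)
    have "annihilates scale p a"
      unfolding p_eq
      using endomorphism.annihilated_quadratic_iff[OF _ h disc_p, of scale a A] lin_a vector_space_axioms AA A_eq
      by (simp add: endomorphism_def endomorphism_axioms_def)
    moreover have "annihilates scale q b"
      unfolding q_eq
      using endomorphism.annihilated_quadratic_iff[OF _ h disc_q, of scale b B] lin_b vector_space_axioms BB B_eq
      by (simp add: endomorphism_def endomorphism_axioms_def)
    moreover have "u = (\<lambda>v. a v - b v)"
    proof
      fix v
      have "a v - b v = scale (1 / 2) (scale 2 (u v))"
        unfolding scale_right_diff_distrib[symmetric] a_def b_def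
        by (rule arg_cong[where f = "scale (1 / 2)"])
          (simp add: A_def B_def w_def scale_left_diff_distrib dbl two_d)
      then show "u v = a v - b v" using two by simp
    qed
    ultimately have "is_difference scale p q u"
      unfolding is_difference_def using lin_a lin_b by blast
    moreover have "d_exceptional scale p q u"
      unfolding d_exceptional_def
    proof
      fix x assume "x \<in> eigenvalues_in_closure scale u"
      then have "eval_closure (l ^ m * r ^ n) x = 0" using eigenvalue_annihilated s1(2) by blast
      then have "eval_closure (l * r) x = 0" by (auto simp: eval_closure_mult eval_closure_power)
      then show "x \<in> {x - y |x y. x \<in> Root p \<and> y \<in> Root q}" using roots by blast
    qed
    ultimately show ?i by blast
  qed
  have "?i \<longleftrightarrow> ?ii" by (rule iffI) (erule iii_ii[OF i_iii], erule ii_i)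
  moreover have "?ii \<longleftrightarrow> ?iii" by (rule iffI) (erule i_iii[OF ii_i], erule iii_ii)
  ultimately show ?thesis by (rule conjI)
qed

end
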